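(* Let $k$ be a field and let $d\ge 2$, $m\ge 2$ be integers. For each integer $p$ with $1\le p\le\binom{d+m-1}{m}+m-2$, there is a $\mathbf{b}\in\mathbb{N}^{m+1}$ with $|\mathbf{b}|=d(p+1)$ and $\mathbf{b}_0=\sum_{i=1}^{p+1}\mathbf{a}^i_0-1$ such that $\beta_{p,\mathbf{b}}\ne 0$.
   Context: $\mathbb{N}$ includes $0$; coordinates of vectors in $\mathbb{Z}^{m+1}$ are indexed $0,1,\dots,m$, and $|\mathbf{a}|=\mathbf{a}_0+\dots+\mathbf{a}_m$. Let $\mathcal{A}=\{\mathbf{a}\in\mathbb{N}^{m+1}: |\mathbf{a}|=d\}$, which has $n=\binom{d+m}{m}$ elements. They are listed as $\mathbf{a}^1,\dots,\mathbf{a}^n$ in lexicographic order with the lexicographically largest first, so $\mathbf{a}^1=(d,0,\dots,0)$, $\mathbf{a}^2=(d-1,1,0,\dots,0)$, ..., $\mathbf{a}^n=(0,\dots,0,d)$. $\mathbb{N}\mathcal{A}\subset\mathbb{N}^{m+1}$ is the semigroup (with $\mathbf{0}$) generated by $\mathcal{A}$. Let $S=k[x_1,\dots,x_n]$ with the $\mathbb{Z}^{m+1}$-grading $\deg(x_i)=\mathbf{a}^i$. The semigroup ring $k[\mathbb{N}\mathcal{A}]$ (the $d$-th Veronese subring of $k[y_0,\dots,y_m]$) is a $\mathbb{Z}^{m+1}$-graded $S$-module via $x_i\mapsto \mathbf{y}^{\mathbf{a}^i}$. The multigraded Betti number is $\beta_{p,\mathbf{b}}=\dim_k \mathrm{Tor}^S_p(k[\mathbb{N}\mathcal{A}],k)_{\mathbf{b}}$.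 *)

theory Defs
  imports Complex_Main "HOL-Library.Poly_Mapping" "HOL-Library.Extended_Nat"
begin

section \<open>Exponent vectors\<close>

text \<open>
  Vectors in \<open>\<nat>\<^sup>m\<^sup>+\<^sup>1\<close> are finitely supported functions on \<open>nat\<close> whose support lies in
  \<open>{0..m}\<close>. Vectors in \<open>\<int>\<^sup>m\<^sup>+\<^sup>1\<close>, used as degrees, are functions \<open>nat \<Rightarrow> int\<close> that vanish beyond \<open>m\<close>.
\<close>

type_synonym expo = "nat \<Rightarrow>\<^sub>0 nat"
type_synonym mdegree = "nat \<Rightarrow> int"

definition nat_vecs :: "nat \<Rightarrow> expo set" where
  "nat_vecs m = {a. Poly_Mapping.keys a \<subseteq> {0..m}}"

definition int_vecs :: "nat \<Rightarrow> mdegree set" where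
  "int_vecs m = {g. \<forall>j>m. g j = 0}"

definition to_mdegree :: "expo \<Rightarrow> mdegree" where
  "to_mdegree a = (\<lambda>j. int (Poly_Mapping.lookup a j))"

definition vec_sum :: "nat \<Rightarrow> expo \<Rightarrow> nat" where
  "vec_sum m a = (\<Sum>j=0..m. Poly_Mapping.lookup a j)"

definition simplex_vecs :: "nat \<Rightarrow> nat \<Rightarrow> expo set" where
  "simplex_vecs m d = {a \<in> nat_vecs m. vec_sum m a = d}"

text \<open>
  The library order on \<open>expo\<close> is the lexicographic one (see \<open>expo_less_iff_lex\<close> below), so
  \<open>avec m d 1, avec m d 2, \<dots>\<close> lists \<open>simplex_vecs m d\<close> with the lexicographically largest first.
\<close>

definition avec :: "nat \<Rightarrow> nat \<Rightarrow> nat \<Rightarrow> expo" where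
  "avec m d i = rev (sorted_list_of_set (simplex_vecs m d)) ! (i - 1)"

inductive_set semigroup_NA :: "nat \<Rightarrow> nat \<Rightarrow> expo set" for m d :: nat where
  zero: "0 \<in> semigroup_NA m d"
| add: "a \<in> simplex_vecs m d \<Longrightarrow> b \<in> semigroup_NA m d \<Longrightarrow> a + b \<in> semigroup_NA m d"

lemma expo_less_iff_lex:
  fixes a b :: expo
  shows "a < b \<longleftrightarrow> (\<exists>j. Poly_Mapping.lookup a j < Poly_Mapping.lookup b j \<and> (\<forall>i<j. Poly_Mapping.lookup a i = Poly_Mapping.lookup b i))"
  by (simp add: less_poly_mapping.rep_eq less_fun_def)

lemma bij_betw_simplex_vecs:
  "bij_betw (\<lambda>a. map (Poly_Mapping.lookup a) [0..<m + 1]) (simplex_vecs m d)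
     {l::nat list. size l = m + 1 \<and> sum_list l = d}"
proof (rule bij_betw_byWitness[where f' = "\<lambda>l. Poly_Mapping.Abs_poly_mapping (\<lambda>j. if j \<le> m then l ! j else 0)"])
  have lk: "Poly_Mapping.lookup (Poly_Mapping.Abs_poly_mapping (\<lambda>j. if j \<le> m then l ! j else 0))
      = (\<lambda>j. if j \<le> m then l ! j else 0)" for l :: "nat list"
  proof (rule Poly_Mapping.lookup_Abs_poly_mapping)
    have "{x. (if x \<le> m then l ! x else 0) \<noteq> 0} \<subseteq> {..m}" by (auto split: if_splits)
    then show "finite {x. (if x \<le> m then l ! x else 0) \<noteq> 0}"
      using finite_subset by blast
  qed
  show "\<forall>a\<in>simplex_vecs m d. Abs_poly_mapping
      (\<lambda>j. if j \<le> m then map (Poly_Mapping.lookup a) [0..<m + 1] ! j else 0) = a"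
  proof
    fix a assume "a \<in> simplex_vecs m d"
    then have ks: "Poly_Mapping.keys a \<subseteq> {0..m}" by (simp add: simplex_vecs_def nat_vecs_def)
    show "Abs_poly_mapping
      (\<lambda>j. if j \<le> m then map (Poly_Mapping.lookup a) [0..<m + 1] ! j else 0) = a"
    proof (rule Poly_Mapping.poly_mapping_eqI)
      fix k
      have "Poly_Mapping.lookup a k = 0" if "\<not> k \<le> m"
        using ks that by (metis atLeastAtMost_iff in_keys_iff subsetD)
      then show "Poly_Mapping.lookup (Abs_poly_mapping
        (\<lambda>j. if j \<le> m then map (Poly_Mapping.lookup a) [0..<m + 1] ! j else 0)) k
          = Poly_Mapping.lookup a k"
        by (auto simp: lk simp del: upt_Suc)
    qed
  qed
  show "\<forall>l\<in>{l. length l = m + 1 \<and> sum_list l = d}.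
      map (Poly_Mapping.lookup (Abs_poly_mapping (\<lambda>j. if j \<le> m then l ! j else 0))) [0..<m + 1] = l"
    by (auto simp: lk intro!: nth_equalityI simp del: upt_Suc)
  show "(\<lambda>a. map (Poly_Mapping.lookup a) [0..<m + 1]) ` simplex_vecs m d
      \<subseteq> {l. length l = m + 1 \<and> sum_list l = d}"
    by (auto simp: simplex_vecs_def vec_sum_def sum_list_sum_nth atLeast0LessThan
        lessThan_Suc_atMost atLeast0AtMost simp del: upt_Suc)
  show "(\<lambda>l. Abs_poly_mapping (\<lambda>j. if j \<le> m then l ! j else 0)) `
      {l. length l = m + 1 \<and> sum_list l = d} \<subseteq> simplex_vecs m d"
  proof (rule image_subsetI)
    fix l :: "nat list" assume l: "l \<in> {l. length l = m + 1 \<and> sum_list l = d}"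
    let ?a = "Abs_poly_mapping (\<lambda>j. if j \<le> m then l ! j else 0)"
    have "Poly_Mapping.keys ?a \<subseteq> {0..m}"
      by (auto simp: in_keys_iff lk split: if_splits)
    moreover have "(\<Sum>j=0..m. Poly_Mapping.lookup ?a j) = d"
      using l by (auto simp: lk sum_list_sum_nth atLeast0LessThan lessThan_Suc_atMost atLeast0AtMost)
    ultimately show "?a \<in> simplex_vecs m d"
      by (simp add: simplex_vecs_def nat_vecs_def vec_sum_def)
  qed
qed

lemma card_simplex_vecs: "card (simplex_vecs m d) = (d + m) choose m"
  using bij_betw_same_card[OF bij_betw_simplex_vecs, of m d]
    card_length_sum_list[of "m + 1" d] binomial_symmetric[of d "d + m"] by simp

lemma finite_simplex_vecs: "finite (simplex_vecs m d)"
proof (rule card_ge_0_finite)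
  show "0 < card (simplex_vecs m d)" by (simp add: card_simplex_vecs)
qed

lemma bij_betw_avec: "bij_betw (avec m d) {1..(d + m) choose m} (simplex_vecs m d)"
proof -
  let ?L = "rev (sorted_list_of_set (simplex_vecs m d))"
  have len: "length ?L = (d + m) choose m" by (simp add: card_simplex_vecs)
  have "bij_betw (\<lambda>i. i - 1) {1..(d + m) choose m} {..<length ?L}"
    unfolding len by (rule bij_betw_byWitness[where f' = Suc]) auto
  moreover have "bij_betw ((!) ?L) {..<length ?L} (simplex_vecs m d)"
    by (rule bij_betw_nth) (simp_all add: finite_simplex_vecs)
  ultimately have "bij_betw ((!) ?L \<circ> (\<lambda>i. i - 1)) {1..(d + m) choose m} (simplex_vecs m d)"
    by (rule bij_betw_trans)
  moreover have "(!) ?L \<circ> (\<lambda>i. i - 1) = avec m d"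
    by (simp add: fun_eq_iff avec_def)
  ultimately show ?thesis by simp
qed

lemma avec_decreasing:
  assumes "1 \<le> i" "i < j" "j \<le> (d + m) choose m"
  shows "avec m d j < avec m d i"
proof -
  let ?L = "sorted_list_of_set (simplex_vecs m d)"
  have len: "length ?L = (d + m) choose m" by (simp add: card_simplex_vecs)
  have "sorted_wrt (<) ?L" by simp
  moreover have "length ?L - Suc (j - 1) < length ?L - Suc (i - 1)"
    "length ?L - Suc (i - 1) < length ?L"
    using assms len by auto
  ultimately have "?L ! (length ?L - Suc (j - 1)) < ?L ! (length ?L - Suc (i - 1))"
    by (rule sorted_wrt_nth_less)
  then show ?thesis using assms len by (simp add: avec_def rev_nth)
qed


section \<open>The polynomial ring and graded modules over it\<close>

text \<open>
  A polynomial is a finitely supported function from exponents to coefficients, with the ring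
  operations of the library; the variables of \<open>S\<close> are indexed from \<open>1\<close> to \<open>n\<close>.
\<close>

type_synonym 'k mpoly = "(nat \<Rightarrow>\<^sub>0 nat) \<Rightarrow>\<^sub>0 'k"

definition S_carrier :: "nat \<Rightarrow> nat \<Rightarrow> 'k::field mpoly set" where
  "S_carrier m d = {s. \<forall>u\<in>Poly_Mapping.keys s. Poly_Mapping.keys u \<subseteq> {1..(d + m) choose m}}"

definition monom_deg :: "nat \<Rightarrow> nat \<Rightarrow> (nat \<Rightarrow>\<^sub>0 nat) \<Rightarrow> mdegree" where
  "monom_deg m d u = (\<lambda>j. \<Sum>i\<in>Poly_Mapping.keys u. int (Poly_Mapping.lookup u i) * to_mdegree (avec m d i) j)"

definition S_comp :: "nat \<Rightarrow> nat \<Rightarrow> mdegree \<Rightarrow> 'k::field mpoly set" where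
  "S_comp m d g = {s \<in> S_carrier m d. \<forall>u\<in>Poly_Mapping.keys s. monom_deg m d u = g}"

definition const :: "'k::field \<Rightarrow> 'k mpoly" where
  "const c = Poly_Mapping.single 0 c"

text \<open>The homomorphism \<open>x\<^sub>i \<mapsto> y\<^bsup>a\<^sup>i\<^esup>\<close>, where \<open>a i\<close> is \<open>avec m d i\<close>.\<close>

definition subst_hom :: "nat \<Rightarrow> nat \<Rightarrow> 'k::field mpoly \<Rightarrow> 'k mpoly" where
  "subst_hom m d s =
     (\<Sum>u\<in>Poly_Mapping.keys s. const (Poly_Mapping.lookup s u) *
        (\<Prod>i\<in>Poly_Mapping.keys u. Poly_Mapping.single (avec m d i) 1 ^ Poly_Mapping.lookup u i))"

text \<open>The data of a \<open>\<int>\<^sup>m\<^sup>+\<^sup>1\<close>-graded \<open>S\<close>-module; its addition is that of the type \<open>'x\<close>.\<close>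

record (overloaded) ('k, 'x) gmod =
  carrier :: "'x set"
  hcomp :: "mdegree \<Rightarrow> 'x set"
  act :: "'k mpoly \<Rightarrow> 'x \<Rightarrow> 'x"

definition semigroup_ring :: "nat \<Rightarrow> nat \<Rightarrow> ('k::field, 'k mpoly) gmod" where
  "semigroup_ring m d = \<lparr>
     carrier = {f. Poly_Mapping.keys f \<subseteq> semigroup_NA m d},
     hcomp = (\<lambda>g. {f. \<forall>b\<in>Poly_Mapping.keys f.
       b \<in> semigroup_NA m d \<and> to_mdegree b = g}),
     act = (\<lambda>s f. subst_hom m d s * f)\<rparr>"

text \<open>\<open>k = S / (x\<^sub>1, \<dots>, x\<^sub>n)\<close>, concentrated in degree \<open>0\<close>.\<close>

definition residue_field :: "('k::field, 'k) gmod" where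
  "residue_field = \<lparr>
     carrier = UNIV,
     hcomp = (\<lambda>g. if g = (\<lambda>_. 0) then UNIV else {0}),
     act = (\<lambda>s c. Poly_Mapping.lookup s 0 * c)\<rparr>"

definition graded_hom ::
    "nat \<Rightarrow> nat \<Rightarrow> ('k::field, 'x::ab_group_add) gmod \<Rightarrow> ('k, 'y::ab_group_add) gmod
      \<Rightarrow> ('x \<Rightarrow> 'y) \<Rightarrow> bool" where
  "graded_hom m d M N f \<longleftrightarrow>
     (\<forall>x\<in>carrier M. f x \<in> carrier N) \<and>
     (\<forall>x\<in>carrier M. \<forall>y\<in>carrier M. f (x + y) = f x + f y) \<and>
     (\<forall>s\<in>S_carrier m d. \<forall>x\<in>carrier M. f (act M s x) = act N s (f x)) \<and>
     (\<forall>g\<in>int_vecs m. \<forall>x\<in>hcomp M g. f x \<in> hcomp N g)"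


section \<open>Graded free resolutions\<close>

text \<open>
  The graded free module \<open>\<Oplus>\<^sub>j\<^sub>\<in>\<^sub>B S(-e j)\<close>, with basis vectors \<open>single j 1\<close> of degree \<open>e j\<close>. Index
  sets are subsets of \<open>nat\<close>; since \<open>S\<close> is Noetherian, every finitely generated graded module
  has a graded free resolution of this form.
\<close>

definition free_gmod ::
    "nat \<Rightarrow> nat \<Rightarrow> nat set \<Rightarrow> (nat \<Rightarrow> mdegree) \<Rightarrow> ('k::field, nat \<Rightarrow>\<^sub>0 'k mpoly) gmod" where
  "free_gmod m d B e = \<lparr>
     carrier = {v. Poly_Mapping.keys v \<subseteq> B \<and> (\<forall>j. Poly_Mapping.lookup v j \<in> S_carrier m d)},
     hcomp = (\<lambda>g. {v. Poly_Mapping.keys v \<subseteq> B \<and>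
       (\<forall>j\<in>B. Poly_Mapping.lookup v j \<in> S_comp m d (g - e j))}),
     act = (\<lambda>s. Poly_Mapping.map ((*) s))\<rparr>"

text \<open>
  \<open>bdry F p\<close> is the map from the \<open>p\<close>-th to the \<open>(p - 1)\<close>-st free module; \<open>bdry F 0\<close> is not used.
\<close>

record (overloaded) ('k, 'x) free_complex =
  basis :: "nat \<Rightarrow> nat set"
  basis_deg :: "nat \<Rightarrow> nat \<Rightarrow> mdegree"
  bdry :: "nat \<Rightarrow> (nat \<Rightarrow>\<^sub>0 'k mpoly) \<Rightarrow> (nat \<Rightarrow>\<^sub>0 'k mpoly)"
  aug :: "(nat \<Rightarrow>\<^sub>0 'k mpoly) \<Rightarrow> 'x"

definition term_mod ::
    "nat \<Rightarrow> nat \<Rightarrow> ('k::field, 'x) free_complex \<Rightarrow> nat \<Rightarrow> ('k, nat \<Rightarrow>\<^sub>0 'k mpoly) gmod" where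
  "term_mod m d F p = free_gmod m d (basis F p) (basis_deg F p)"

definition graded_free_resolution ::
    "nat \<Rightarrow> nat \<Rightarrow> ('k::field, 'x::ab_group_add) gmod \<Rightarrow> ('k, 'x) free_complex \<Rightarrow> bool" where
  "graded_free_resolution m d M F \<longleftrightarrow>
     (\<forall>p. \<forall>j\<in>basis F p. basis_deg F p j \<in> int_vecs m) \<and>
     (\<forall>p. graded_hom m d (term_mod m d F (Suc p)) (term_mod m d F p) (bdry F (Suc p))) \<and>
     graded_hom m d (term_mod m d F 0) M (aug F) \<and>
     aug F ` carrier (term_mod m d F 0) = carrier M \<and>
     {v \<in> carrier (term_mod m d F 0). aug F v = 0}
       = bdry F 1 ` carrier (term_mod m d F 1) \<and>
     (\<forall>p. {v \<in> carrier (term_mod m d F (Suc p)). bdry F (Suc p) v = 0}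
       = bdry F (Suc (Suc p)) ` carrier (term_mod m d F (Suc (Suc p))))"


section \<open>Tor and multigraded Betti numbers\<close>

text \<open>
  For \<open>F\<^sub>p = \<Oplus>\<^sub>j S(-e j)\<close> one has \<open>F\<^sub>p \<otimes>\<^sub>S N = \<Oplus>\<^sub>j N(-e j)\<close>, where \<open>single j x\<close> stands for
  \<open>(basis vector j) \<otimes> x\<close>. The induced differential sends it to
  \<open>bdry (basis vector j) \<otimes> x\<close>, whose \<open>i\<close>-th coordinate is the \<open>i\<close>-th coordinate
  of \<open>bdry (basis vector j)\<close> acting on \<open>x\<close>.
\<close>

definition tensor_comp ::
    "('k::field, 'x) free_complex \<Rightarrow> ('k, 'y::ab_group_add) gmod \<Rightarrow> nat \<Rightarrow> mdegree
      \<Rightarrow> (nat \<Rightarrow>\<^sub>0 'y) set" where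
  "tensor_comp F N p g =
     {v. Poly_Mapping.keys v \<subseteq> basis F p \<and>
       (\<forall>j\<in>basis F p. Poly_Mapping.lookup v j \<in> hcomp N (g - basis_deg F p j))}"

definition tensor_diff ::
    "('k::field, 'x) free_complex \<Rightarrow> ('k, 'y::ab_group_add) gmod \<Rightarrow> nat
      \<Rightarrow> (nat \<Rightarrow>\<^sub>0 'y) \<Rightarrow> (nat \<Rightarrow>\<^sub>0 'y)" where
  "tensor_diff F N p v =
     (\<Sum>j\<in>Poly_Mapping.keys v. Poly_Mapping.map (\<lambda>s. act N s (Poly_Mapping.lookup v j))
                    (bdry F p (Poly_Mapping.single j 1)))"

definition tensor_cycles ::
    "('k::field, 'x) free_complex \<Rightarrow> ('k, 'y::ab_group_add) gmod \<Rightarrow> nat \<Rightarrow> mdegree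
      \<Rightarrow> (nat \<Rightarrow>\<^sub>0 'y) set" where
  "tensor_cycles F N p g = {v \<in> tensor_comp F N p g. p = 0 \<or> tensor_diff F N p v = 0}"

definition tensor_boundaries ::
    "('k::field, 'x) free_complex \<Rightarrow> ('k, 'y::ab_group_add) gmod \<Rightarrow> nat \<Rightarrow> mdegree
      \<Rightarrow> (nat \<Rightarrow>\<^sub>0 'y) set" where
  "tensor_boundaries F N p g = tensor_diff F N (Suc p) ` tensor_comp F N (Suc p) g"

text \<open>
  The dimension of the quotient \<open>Z / B\<close> of vector spaces \<open>B \<subseteq> Z\<close> with scalar multiplication
  \<open>scale\<close>: the supremum of the sizes of finite subsets of \<open>Z\<close> that are linearly independent
  modulo \<open>B\<close>. It is \<open>\<infinity>\<close> if the quotient is infinite-dimensional.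
\<close>

definition quotient_dim ::
    "('k::field \<Rightarrow> 'v::ab_group_add \<Rightarrow> 'v) \<Rightarrow> 'v set \<Rightarrow> 'v set \<Rightarrow> enat" where
  "quotient_dim scale Z B =
     Sup {enat (card A) | A. finite A \<and> A \<subseteq> Z \<and>
            (\<forall>c. (\<Sum>a\<in>A. scale (c a) a) \<in> B \<longrightarrow> (\<forall>a\<in>A. c a = 0))}"

text \<open>
  The dimension over \<open>k\<close> of the component of degree \<open>g\<close> of \<open>Tor\<^sub>p\<^sup>S(M, N)\<close>. As usual, \<open>Tor\<close> is computed
  from a chosen graded free resolution of \<open>M\<close>; the result does not depend on the choice.
\<close>

definition tor_dim ::
    "nat \<Rightarrow> nat \<Rightarrow> ('k::field, 'x::ab_group_add) gmod \<Rightarrow> ('k, 'y::ab_group_add) gmod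
      \<Rightarrow> nat \<Rightarrow> mdegree \<Rightarrow> enat" where
  "tor_dim m d M N p g =
     (let F = (SOME F. graded_free_resolution m d M F) in
      quotient_dim (\<lambda>c. Poly_Mapping.map (act N (const c)))
        (tensor_cycles F N p g) (tensor_boundaries F N p g))"

definition betti :: "'k::field itself \<Rightarrow> nat \<Rightarrow> nat \<Rightarrow> nat \<Rightarrow> expo \<Rightarrow> enat" where
  "betti _ m d p b =
     tor_dim m d (semigroup_ring m d :: ('k, 'k mpoly) gmod) (residue_field :: ('k, 'k) gmod)
       p (to_mdegree b)"

end

theory Submission
  imports Defs "HOL-Library.Countable_Set"
begin

text \<open>
  Tor is compared with Koszul homology by dimension shifting. Let \<open>Z\<^sub>i\<close> be the syzygies of a graded free
  resolution \<open>F\<close> of \<open>M = k[\<nat>A]\<close>. The Koszul complex of a free module is exact in positive degrees, so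
  connecting maps carry a nonzero class in \<open>H\<^sub>p(K \<otimes> M)\<^sub>b\<close> through \<open>H\<^bsub>p-1\<^esub>(K \<otimes> Z\<^sub>0)\<^sub>b, \<dots>\<close> to a nonzero
  class in \<open>H\<^sub>0(K \<otimes> Z\<^bsub>p-1\<^esub>)\<^sub>b\<close> that dies in \<open>F\<^bsub>p-1\<^esub> \<otimes> k\<close>; a preimage in \<open>F\<^sub>p\<close> is a nonzero element of
  \<open>Tor\<^sub>p(M, k)\<^sub>b\<close>.

  The class is of Green--Lazarsfeld type for the decomposition \<open>O(d) = O(1) \<otimes> O(d - 1)\<close>. Let
  \<open>q = min (p + 1) N\<close>, where \<open>N\<close> is the number of vectors in \<open>A\<close> with nonzero entry \<open>0\<close>, so that
  \<open>a\<^sup>1, \<dots>, a\<^sup>q\<close> all have a nonzero entry \<open>0\<close>. Let \<open>V = {a\<^sup>1, \<dots>, a\<^bsup>q-1\<^esup>}\<close>, let \<open>W\<close> consist of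
  \<open>a\<^sup>q - e\<^sub>0 + e\<^sub>i\<close> for \<open>i = 1, \<dots>, p + 2 - q\<close>, and let \<open>b\<close> be the sum of \<open>V \<union> W\<close>. For \<open>v \<in> V\<close> and \<open>w \<in> W\<close> also
  \<open>v + w - a\<^sup>q \<in> A\<close>, so the sphere that is the join of the boundaries of the simplices on \<open>V\<close> and on
  \<open>W \<union> {a\<^sup>q}\<close> gives a Koszul \<open>p\<close>-cycle of degree \<open>b\<close>. It is not a boundary: in a chain with that boundary the
  simplex on \<open>V \<union> W\<close> would have to occur, because of the face \<open>(V - {v}) \<union> W\<close> of the sphere, and must not occur,
  because \<open>V \<union> (W - {w})\<close> is not a face.
\<close>

section \<open>Koszul complexes with coefficients\<close>

text \<open>\<open>tor_dim\<close> works with a resolution picked by \<open>SOME\<close>. Two tasks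
  follow: a graded free resolution must be shown to exist, and the comparison with Koszul homology
  must work for every one. A resolution is specified by exactness of whole modules, while the
  argument runs inside a single multidegree; projections onto graded components bridge this gap. For
  existence, all free modules get the basis \<open>nat\<close>, and each kernel is given a countable
  family of homogeneous generators.

  The numbers arise as follows. N is binom(d+m-1, m), and replacing a^q by a^q - e_0 + e_i lowers
  entry 0 by one. If q = p + 1, then W has one element, and entry 0 of b is the sum over a^1, ...,
  a^(p+1) minus 1. If q = N, then a^N has entry 0 equal to 1, while the elements of W and all a^i
  with i > N have entry 0 equal to 0, so the same formula results. Only e_1, ..., e_m are available
  for W; the condition p + 2 - N \<le> m is the upper bound on p.\<close>

definition alt :: "nat \<Rightarrow> 'x::ab_group_add \<Rightarrow> 'x" where
  "alt k v = (if even k then v else - v)"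

text \<open>The coefficient of e_J in the Koszul differential of the sum of all c_I e_I; the sign is
  the parity of the position of \<open>i\<close> in \<open>insert i J\<close>. Signs go through
  \<open>alt\<close> because the coefficients are only assumed to form an abelian group.\<close>

definition koszul :: "nat set \<Rightarrow> (nat \<Rightarrow> 'x \<Rightarrow> 'x::ab_group_add) \<Rightarrow> (nat set \<Rightarrow> 'x) \<Rightarrow> nat set \<Rightarrow> 'x" where
  "koszul N x c J = (\<Sum>i\<in>N - J. alt (card {j \<in> J. j < i}) (x i (c (insert i J))))"

text \<open>A Koszul \<open>j\<close>-chain assigns to a \<open>j\<close>-subset \<open>I\<close> the coefficient of \<open>e\<^sub>I\<close>, which has to lie in \<open>C I\<close>. For
  chains of degree \<open>b\<close> over a graded module, \<open>C I\<close> is its component of degree \<open>b - deg e\<^sub>I\<close>.\<close>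

definition kchain :: "nat set \<Rightarrow> (nat set \<Rightarrow> 'x::zero set) \<Rightarrow> nat \<Rightarrow> (nat set \<Rightarrow> 'x) set" where
  "kchain N C j = {c. \<forall>I. if I \<subseteq> N \<and> card I = j then c I \<in> C I else c I = 0}"

text \<open>Just enough of a graded module for \<open>koszul\<close> to map chains of degree b to
  chains of degree b. It covers M, the free modules and their syzygies alike.\<close>

definition ksystem :: "nat set \<Rightarrow> (nat \<Rightarrow> 'x \<Rightarrow> 'x::ab_group_add) \<Rightarrow> (nat set \<Rightarrow> 'x set) \<Rightarrow> bool" where
  "ksystem N x C \<longleftrightarrow> (\<forall>i. additive (x i)) \<and>
     (\<forall>I\<subseteq>N. 0 \<in> C I \<and> (\<forall>v\<in>C I. \<forall>w\<in>C I. v - w \<in> C I)) \<and>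
     (\<forall>I\<subseteq>N. \<forall>i\<in>N - I. \<forall>v\<in>C (insert i I). x i v \<in> C I)"

text \<open>A representative of a nonzero class in Koszul homology.\<close>

definition kclass :: "nat set \<Rightarrow> (nat \<Rightarrow> 'x \<Rightarrow> 'x::ab_group_add) \<Rightarrow> (nat set \<Rightarrow> 'x set) \<Rightarrow> nat
    \<Rightarrow> (nat set \<Rightarrow> 'x) \<Rightarrow> bool" where
  "kclass N x C j c \<longleftrightarrow> c \<in> kchain N C j \<and> (\<forall>J. koszul N x c J = 0)
     \<and> c \<notin> koszul N x ` kchain N C (Suc j)"

lemma alt_simps [simp]: "alt k 0 = 0" "alt k (v + w) = alt k v + alt k w"
    "alt k (v - w) = alt k v - alt k w" "alt k (- v) = - alt k v" "alt (Suc k) v = - alt k v" "alt 0 v = v"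
  by (simp_all add: alt_def)

lemma alt_alt: "alt k (alt l v) = alt (k + l) v"
  by (simp add: alt_def)

lemma alt_sum: "alt k (sum f A) = (\<Sum>a\<in>A. alt k (f a))"
  by (simp add: alt_def sum_negf)

lemma additive_alt: "additive f \<Longrightarrow> f (alt k v) = alt k (f v)"
  by (simp add: alt_def additive.minus)

lemma kchain_iff: "c \<in> kchain N C j \<longleftrightarrow>
    (\<forall>I. I \<subseteq> N \<longrightarrow> card I = j \<longrightarrow> c I \<in> C I) \<and> (\<forall>I. \<not> (I \<subseteq> N \<and> card I = j) \<longrightarrow> c I = 0)"
  by (auto simp: kchain_def)

lemma kchainD: "c \<in> kchain N C j \<Longrightarrow> I \<subseteq> N \<Longrightarrow> card I = j \<Longrightarrow> c I \<in> C I"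
  by (simp add: kchain_iff)

lemma kchain_zero: "c \<in> kchain N C j \<Longrightarrow> \<not> (I \<subseteq> N \<and> card I = j) \<Longrightarrow> c I = 0"
  by (simp add: kchain_iff)

lemma ksystem_closed:
  assumes "ksystem N x C" "I \<subseteq> N"
  shows "0 \<in> C I" "v \<in> C I \<Longrightarrow> w \<in> C I \<Longrightarrow> v - w \<in> C I" "v \<in> C I \<Longrightarrow> - v \<in> C I"
    "v \<in> C I \<Longrightarrow> w \<in> C I \<Longrightarrow> v + w \<in> C I" "v \<in> C I \<Longrightarrow> alt k v \<in> C I"
proof -
  show z: "0 \<in> C I" using assms by (simp add: ksystem_def)
  show d: "v - w \<in> C I" if "v \<in> C I" "w \<in> C I" for v w
    using assms that by (simp add: ksystem_def)
  show m: "- v \<in> C I" if "v \<in> C I" for v using d[OF z that] by simp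
  show "v + w \<in> C I" if "v \<in> C I" "w \<in> C I" using d[OF that(1) m[OF that(2)]] by simp
  show "alt k v \<in> C I" if "v \<in> C I" using m that by (simp add: alt_def)
qed

lemma ksystem_sum:
  assumes "ksystem N x C" "I \<subseteq> N" "\<And>a. a \<in> A \<Longrightarrow> f a \<in> C I"
  shows "sum f A \<in> C I"
  using assms(3) by (induction A rule: infinite_finite_induct) (auto intro: ksystem_closed[OF assms(1,2)])

lemma koszul_chain:
  assumes K: "ksystem N x C" and N: "finite N" and c: "c \<in> kchain N C (Suc j)"
  shows "koszul N x c \<in> kchain N C j"
proof -
  have add: "additive (x i)" for i using K by (simp add: ksystem_def)
  have "koszul N x c J \<in> C J" if J: "J \<subseteq> N" "card J = j" for J
    unfolding koszul_def
  proof (intro ksystem_sum[OF K J(1)] ksystem_closed(5)[OF K J(1)])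
    fix i assume i: "i \<in> N - J"
    have "finite J" using J N finite_subset by blast
    then have "c (insert i J) \<in> C (insert i J)" using c i J by (auto simp: kchain_iff)
    then show "x i (c (insert i J)) \<in> C J" using K i J by (auto simp: ksystem_def)
  qed
  moreover have "koszul N x c J = 0" if J: "\<not> (J \<subseteq> N \<and> card J = j)" for J
    unfolding koszul_def
  proof (rule sum.neutral, rule ballI)
    fix i assume i: "i \<in> N - J"
    have "\<not> (insert i J \<subseteq> N \<and> card (insert i J) = Suc j)"
    proof (rule notI)
      assume a: "insert i J \<subseteq> N \<and> card (insert i J) = Suc j"
      then have "finite J" using N by (meson finite_insert finite_subset)
      then have "card J = j" using a i by simp
      then show False using a J by blast
    qed
    then have "c (insert i J) = 0" by (rule kchain_zero[OF c])
    then show "alt (card {j \<in> J. j < i}) (x i (c (insert i J))) = 0" using add by (simp add: additive.zero)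
  qed
  ultimately show ?thesis by (auto simp: kchain_iff)
qed

lemma koszul_chain_0:
  assumes K: "ksystem N x C" and N: "finite N" and c: "c \<in> kchain N C 0"
  shows "koszul N x c J = 0"
  unfolding koszul_def
proof (rule sum.neutral, rule ballI)
  fix i assume i: "i \<in> N - J"
  have add: "additive (x i)" for i using K by (simp add: ksystem_def)
  have "\<not> (insert i J \<subseteq> N \<and> card (insert i J) = 0)"
    using N finite_subset by fastforce
  then have "c (insert i J) = 0" by (rule kchain_zero[OF c])
  then show "alt (card {j \<in> J. j < i}) (x i (c (insert i J))) = 0" using add by (simp add: additive.zero)
qed

lemma koszul_diff:
  assumes "\<And>i. additive (x i)"
  shows "koszul N x (\<lambda>I. c I - e I) J = koszul N x c J - koszul N x e J"
  by (simp add: koszul_def additive.diff[OF assms] sum_subtractf)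

text \<open>Adjoining i and l in either order gives the same coefficient x_i x_l c. Adjoining the
  smaller index first moves the larger one by one position, so the two signs are opposite.\<close>

lemma koszul_koszul:
  assumes add: "\<And>i. additive (x i)" and comm: "\<And>i l v. x i (x l v) = x l (x i v)"
    and N: "finite N" and J: "finite J"
  shows "koszul N x (koszul N x c) J = 0"
proof -
  let ?s = "\<lambda>i J. card {j \<in> J. j < i}"
  let ?g = "\<lambda>(i, l). alt (?s i J + ?s l (insert i J)) (x i (x l (c (insert l (insert i J)))))"
  let ?A = "{(i, l). i \<in> N - J \<and> l \<in> N - J \<and> i < l}"
  let ?B = "{(i, l). i \<in> N - J \<and> l \<in> N - J \<and> l < i}"
  have fin: "finite ?A" "finite ?B"
    by (rule finite_subset[of _ "N \<times> N"]; use N in auto)+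
  have "koszul N x (koszul N x c) J =
      (\<Sum>i\<in>N - J. \<Sum>l\<in>N - insert i J. ?g (i, l))"
    unfolding koszul_def
    by (simp add: additive.sum[OF add] alt_sum additive_alt[OF add] alt_alt)
  also have "\<dots> = sum ?g (Sigma (N - J) (\<lambda>i. N - insert i J))"
    using N by (subst sum.Sigma) auto
  also have "Sigma (N - J) (\<lambda>i. N - insert i J) = ?A \<union> ?B" by auto
  also have "sum ?g (?A \<union> ?B) = sum ?g ?A + sum ?g ?B"
    by (rule sum.union_disjoint) (use fin in auto)
  also have "sum ?g ?B = (\<Sum>a\<in>?A. - ?g a)"
  proof (rule sum.reindex_bij_witness[of _ "\<lambda>(i, l). (l, i)" "\<lambda>(i, l). (l, i)"])
    fix a assume "a \<in> ?B"
    then obtain i l where a: "a = (i, l)" "i \<in> N - J" "l \<in> N - J" "l < i" by auto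
    have 1: "{j. (j = i \<or> j \<in> J) \<and> j < l} = {j \<in> J. j < l}" using a by auto
    have "{j. (j = l \<or> j \<in> J) \<and> j < i} = insert l {j \<in> J. j < i}" using a by auto
    then have 2: "card {j. (j = l \<or> j \<in> J) \<and> j < i} = Suc (?s i J)" using J a by simp
    show "- ?g (case a of (i, l) \<Rightarrow> (l, i)) = ?g a"
      using 1 2 by (simp add: a comm[of i l] insert_commute add.commute)
  qed auto
  finally show ?thesis by (simp add: sum_negf)
qed

text \<open>The connecting map of the long exact Koszul homology sequence of \<open>0 \<rightarrow> Z \<rightarrow> F \<rightarrow> Y \<rightarrow> 0\<close>.\<close>

lemma koszul_connecting:
  assumes N: "finite N"
    and F: "ksystem N xF CF" and Y: "ksystem N xY CY"
    and comm: "\<And>i l v. xF i (xF l v) = xF l (xF i v)"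
    and surj: "\<And>I. I \<subseteq> N \<Longrightarrow> f ` CF I = CY I"
    and fadd: "\<And>I v w. I \<subseteq> N \<Longrightarrow> v \<in> CF I \<Longrightarrow> w \<in> CF I \<Longrightarrow> f (v + w) = f v + f w"
    and fx: "\<And>I i v. insert i I \<subseteq> N \<Longrightarrow> i \<notin> I \<Longrightarrow> v \<in> CF (insert i I) \<Longrightarrow> f (xF i v) = xY i (f v)"
    and exact: "\<And>j c. c \<in> kchain N CF (Suc j) \<Longrightarrow> (\<And>J. koszul N xF c J = 0)
        \<Longrightarrow> c \<in> koszul N xF ` kchain N CF (Suc (Suc j))"
    and c: "kclass N xY CY (Suc j) c"
  shows "\<exists>c'. kclass N xF (\<lambda>I. {v \<in> CF I. f v = 0}) j c' \<and> c' \<in> koszul N xF ` kchain N CF (Suc j)"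
proof -
  let ?Z = "\<lambda>I. {v \<in> CF I. f v = 0}"
  have addF: "additive (xF i)" and addY: "additive (xY i)" for i
    using F Y by (auto simp: ksystem_def)
  have fz: "f 0 = 0" if "I \<subseteq> N" for I
    using fadd[OF that ksystem_closed(1)[OF F that] ksystem_closed(1)[OF F that]] by simp
  have fz0: "f 0 = 0" using fz by blast
  have fm: "f (- v) = - f v" if "I \<subseteq> N" "v \<in> CF I" for I v
    using fadd[OF that(1) that(2) ksystem_closed(3)[OF F that]] fz0
    by (simp add: eq_neg_iff_add_eq_0 add.commute)
  have falt: "f (alt k v) = alt k (f v)" if "I \<subseteq> N" "v \<in> CF I" for I v k
    using fm[OF that] by (simp add: alt_def)
  have fsum: "f (sum g A) = (\<Sum>a\<in>A. f (g a))" if I: "I \<subseteq> N" and "\<And>a. a \<in> A \<Longrightarrow> g a \<in> CF I" for I A and g :: "nat \<Rightarrow> 'a"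
    using that(2)
    by (induction A rule: infinite_finite_induct)
      (auto simp: fz0 fadd[OF I _ ksystem_sum[OF F I]])
  have fk: "f (koszul N xF e J) = koszul N xY (\<lambda>I. f (e I)) J"
    if e: "e \<in> kchain N CF (Suc k)" and J: "J \<subseteq> N" "card J = k" for e J k
  proof -
    have *: "e (insert i J) \<in> CF (insert i J)" "xF i (e (insert i J)) \<in> CF J" if i: "i \<in> N - J" for i
    proof -
      have "finite J" using J N finite_subset by blast
      then show 1: "e (insert i J) \<in> CF (insert i J)" using e i J by (auto simp: kchain_iff)
      then show "xF i (e (insert i J)) \<in> CF J" using F i J by (auto simp: ksystem_def)
    qed
    show ?thesis unfolding koszul_def
      by (subst fsum[OF J(1)]) (use J * in \<open>auto simp: falt[OF J(1)] fx intro!: ksystem_closed(5)[OF F] sum.cong\<close>)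
  qed
  have fk0: "koszul N xY (\<lambda>I. f (e I)) J = f (koszul N xF e J)"
    if e: "e \<in> kchain N CF (Suc k)" for e J k
  proof (cases "J \<subseteq> N \<and> card J = k")
    case True then show ?thesis using fk[OF e] by simp
  next
    case False
    then have 1: "koszul N xF e J = 0" using koszul_chain[OF F N e] by (auto simp: kchain_iff)
    have "(\<lambda>I. f (e I)) \<in> kchain N CY (Suc k)"
      using e surj fz0 by (auto simp: kchain_iff)
    then have "koszul N xY (\<lambda>I. f (e I)) J = 0" using False kchain_zero[OF koszul_chain[OF Y N]] by blast
    with 1 fz0 show ?thesis by simp
  qed
  have cc: "c \<in> kchain N CY (Suc j)" "koszul N xY c J = 0" "c \<notin> koszul N xY ` kchain N CY (Suc (Suc j))" for J
    using c by (auto simp: kclass_def)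
  \<comment> \<open>Coefficientwise lift of \<open>c\<close> through \<open>f\<close>; the value 0
    elsewhere makes it a chain.\<close>
  define t where "t I = (if I \<subseteq> N \<and> card I = Suc j then SOME v. v \<in> CF I \<and> f v = c I else 0)" for I
  have t1: "t I \<in> CF I \<and> f (t I) = c I" if "I \<subseteq> N" "card I = Suc j" for I
  proof -
    have "c I \<in> f ` CF I" using cc(1) that surj by (auto simp: kchain_iff)
    then have "\<exists>v. v \<in> CF I \<and> f v = c I" by auto
    from someI_ex[OF this] show ?thesis using that by (simp add: t_def)
  qed
  have t: "t \<in> kchain N CF (Suc j)" using t1 by (auto simp: kchain_iff t_def)
  have ft: "(\<lambda>I. f (t I)) = c"
  proof
    fix I show "f (t I) = c I"
    proof (cases "I \<subseteq> N \<and> card I = Suc j")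
      case True then show ?thesis using t1 by blast
    next
      case False
      then have "c I = 0" by (rule kchain_zero[OF cc(1)])
      moreover have "t I = 0" using False by (auto simp: t_def)
      ultimately show ?thesis by (simp add: fz0)
    qed
  qed
  \<comment> \<open>As in the snake lemma: \<open>f\<close> maps the boundary of the lift to the
    boundary of \<open>c\<close>, which is 0, so \<open>?c'\<close> has its coefficients in the
    kernel.\<close>
  let ?c' = "koszul N xF t"
  have c'F: "?c' \<in> kchain N CF j" by (rule koszul_chain[OF F N t])
  have c'0: "f (?c' J) = 0" for J using fk0[OF t, of J] ft cc(2)[of J] by simp
  have c'Z: "?c' \<in> kchain N ?Z j" using c'F c'0 by (auto simp: kchain_iff)
  have dc': "koszul N xF ?c' J = 0" for J
  proof (cases "finite J")
    case True then show ?thesis by (rule koszul_koszul[OF addF comm N])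
  next
    case False
    show ?thesis
    proof (cases j)
      case 0 then show ?thesis using koszul_chain_0[OF F N] c'F by simp
    next
      case (Suc k)
      have "\<not> J \<subseteq> N" using False N finite_subset by blast
      then show ?thesis using koszul_chain[OF F N, of _ k] c'F Suc by (auto simp: kchain_iff)
    qed
  qed
  \<comment> \<open>If \<open>?c'\<close> were the boundary of a chain \<open>e\<close> over the
    kernel, then t - e would be a cycle over F, hence a boundary by exactness, and applying
    \<open>f\<close> would make \<open>c\<close> a boundary.\<close>
  have "?c' \<notin> koszul N xF ` kchain N ?Z (Suc j)"
  proof
    assume "?c' \<in> koszul N xF ` kchain N ?Z (Suc j)"
    then obtain e where e: "?c' = koszul N xF e" "e \<in> kchain N ?Z (Suc j)" by blast
    let ?u = "\<lambda>I. t I - e I"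
    have u: "?u \<in> kchain N CF (Suc j)"
      using t e(2) ksystem_closed(2)[OF F] by (auto simp: kchain_iff)
    have "koszul N xF ?u J = 0" for J using e(1) by (simp add: koszul_diff[OF addF])
    from exact[OF u this] obtain w where w: "w \<in> kchain N CF (Suc (Suc j))" "?u = koszul N xF w" by blast
    have "c = koszul N xY (\<lambda>I. f (w I))"
    proof
      fix I
      have fe: "f (- e I) = 0"
      proof (cases "I \<subseteq> N \<and> card I = Suc j")
        case True
        then have "e I \<in> CF I" "f (e I) = 0" using e(2) by (auto simp: kchain_iff)
        then show ?thesis using fm[of I "e I"] True by simp
      next
        case False
        then have "e I = 0" by (rule kchain_zero[OF e(2)])
        then show ?thesis by (simp add: fz0)
      qed
      have "koszul N xY (\<lambda>I. f (w I)) I = f (t I - e I)"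
        using fk0[OF w(1), of I] w(2) by metis
      also have "\<dots> = f (t I)"
      proof (cases "I \<subseteq> N \<and> card I = Suc j")
        case True
        then have "t I \<in> CF I" "- e I \<in> CF I"
          using t e(2) ksystem_closed(3)[OF F] by (auto simp: kchain_iff)
        then have "f (t I + - e I) = f (t I) + f (- e I)" using True fadd by blast
        then show ?thesis using fe by simp
      next
        case False
        then have "e I = 0" by (rule kchain_zero[OF e(2)])
        then show ?thesis by simp
      qed
      finally show "c I = koszul N xY (\<lambda>I. f (w I)) I" using ft by metis
    qed
    moreover have "(\<lambda>I. f (w I)) \<in> kchain N CY (Suc (Suc j))"
      using w(1) surj fz0 by (auto simp: kchain_iff)
    ultimately show False using cc(3) by blast
  qed
  then show ?thesis using c'Z dc' t by (auto simp: kclass_def)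
qed

text \<open>A partial inverse \<open>Q i\<close> of each \<open>x i\<close>, vanishing on the images of the earlier \<open>x l\<close>, gives the
  contracting homotopy \<open>v e\<^sub>I \<mapsto> Q\<^sub>i v e\<^sub>i \<and> e\<^sub>I\<close> (summed over \<open>i < min I\<close>).\<close>

lemma koszul_exact:
  fixes N :: "nat set"
  assumes N: "finite N" and C: "ksystem N x C" and Q: "\<And>i. additive (Q i)"
    and QC: "\<And>I i v. insert i I \<subseteq> N \<Longrightarrow> i \<notin> I \<Longrightarrow> v \<in> C I \<Longrightarrow> Q i v \<in> C (insert i I)"
    and Qlt: "\<And>i l v. l < i \<Longrightarrow> Q i (x l v) = 0"
    and Qgt: "\<And>i l v. i < l \<Longrightarrow> Q i (x l v) = x l (Q i v)"
    and Qeq: "\<And>I i v. I \<subseteq> N \<Longrightarrow> i \<in> N \<Longrightarrow> v \<in> C I \<Longrightarrow> (\<Sum>l\<in>{l\<in>N. l < i}. x l (Q l v)) + Q i (x i v) = v"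
    and c: "c \<in> kchain N C (Suc j)" and dc: "\<And>J. koszul N x c J = 0"
  shows "c \<in> koszul N x ` kchain N C (Suc (Suc j))"
proof -
  \<comment> \<open>The homotopy read coefficientwise: e_J arises from e_i and e_I with i < min I
    only for i = Min J.\<close>
  define e where "e J = (if J \<subseteq> N \<and> card J = Suc (Suc j) then Q (Min J) (c (J - {Min J})) else 0)" for J
  have e: "e \<in> kchain N C (Suc (Suc j))"
    unfolding kchain_iff
  proof (intro conjI allI impI)
    fix I assume I: "I \<subseteq> N" "card I = Suc (Suc j)"
    then have fin: "finite I" and ne: "I \<noteq> {}" using card.infinite by fastforce+
    have Min: "Min I \<in> I" using fin ne by simp
    have "Q (Min I) (c (I - {Min I})) \<in> C (insert (Min I) (I - {Min I}))"
    proof (rule QC)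
      show "c (I - {Min I}) \<in> C (I - {Min I})"
        by (rule kchainD[OF c]) (use I fin ne Min subsetD[OF I(1) Min] in auto)
    qed (use I fin ne Min subsetD[OF I(1) Min] in auto)
    then show "e I \<in> C I" using I fin ne by (simp add: e_def insert_absorb Min)
  qed (auto simp: e_def)
  have "c = koszul N x e"
  proof
    fix J
    show "c J = koszul N x e J"
    proof (cases "J \<subseteq> N \<and> card J = Suc j")
      case False
      then show ?thesis
        using kchain_zero[OF c False] kchain_zero[OF koszul_chain[OF C N e] False] by simp
    next
      case True
      then have J: "J \<subseteq> N" "card J = Suc j" and fin: "finite J" and ne: "J \<noteq> {}"
        using card.infinite by fastforce+
      define m where "m = Min J"
      define K where "K = J - {m}"
      have m: "m \<in> J" "\<And>k. k \<in> J \<Longrightarrow> m \<le> k" using fin ne by (auto simp: m_def)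
      have JK: "J = insert m K" "m \<notin> K" "finite K" and mK: "\<And>k. k \<in> K \<Longrightarrow> m < k"
        using m fin by (auto simp: K_def le_neq_implies_less)
      \<comment> \<open>An index below m becomes the new minimum of \<open>insert i J\<close>. One
        above m leaves m as the minimum, so \<open>e\<close> then takes its value from
        \<open>c\<close> at \<open>insert i K\<close>.\<close>
      let ?lo = "{l\<in>N. l < m}" and ?hi = "{l\<in>N. l \<notin> J \<and> m < l}"
      let ?s = "\<lambda>i. card {k\<in>K. k < i}"
      have 1: "N - J = ?lo \<union> ?hi" 
      proof (intro set_eqI iffI)
        fix i assume "i \<in> N - J"
        then have "i \<in> N" "i \<notin> J" "i \<noteq> m" using m(1) by auto
        then show "i \<in> ?lo \<union> ?hi" by auto
      next
        fix i assume "i \<in> ?lo \<union> ?hi"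
        moreover have "i \<notin> J" if "i < m" using m(2)[of i] that by auto
        ultimately show "i \<in> N - J" by auto
      qed
      have 2: "N - K = insert m (?lo \<union> ?hi)" unfolding 1[symmetric] using m(1) J(1) JK(1,2) by blast
      have lo: "alt (card {k\<in>J. k < i}) (x i (e (insert i J))) = x i (Q i (c J))" if "i \<in> ?lo" for i
      proof -
        have a: "i \<notin> J" using that m(2)[of i] by auto
        have a': "k \<notin> J" if "k < i" for k using that \<open>i \<in> ?lo\<close> m(2)[of k] by auto
        then have a'': "{k\<in>J. k < i} = {}" by auto
        have b: "Min (insert i J) = i"
        proof (rule Min_eqI)
          fix y assume "y \<in> insert i J"
          then show "i \<le> y" using m(2)[of y] that by auto
        qed (use fin in auto)
        have "insert i J \<subseteq> N" "card (insert i J) = Suc (Suc j)" using that J a fin by auto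
        then have "e (insert i J) = Q i (c J)" using a b by (simp add: e_def insert_Diff_if)
        then show ?thesis unfolding a'' by simp
      qed
      have hi: "alt (card {k\<in>J. k < i}) (x i (e (insert i J))) = - alt (?s i) (x i (Q m (c (insert i K))))"
        if "i \<in> ?hi" for i
      proof -
        have b: "Min (insert i J) = m"
        proof (rule Min_eqI)
          fix y assume "y \<in> insert i J"
          then show "m \<le> y" using m(2)[of y] that by auto
        qed (use fin m(1) in auto)
        have "insert i J \<subseteq> N" "card (insert i J) = Suc (Suc j)" using that J fin by auto
        moreover have "insert i J - {m} = insert i K" using that by (auto simp: K_def)
        ultimately have "e (insert i J) = Q m (c (insert i K))" using b by (simp add: e_def)
        moreover have "{k\<in>J. k < i} = insert m {k\<in>K. k < i}" using that JK by auto
        then have "card {k\<in>J. k < i} = Suc (?s i)" using JK by simp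
        ultimately show ?thesis by simp
      qed
      have dj: "?lo \<inter> ?hi = {}" "finite ?lo" "finite ?hi" "m \<notin> ?lo \<union> ?hi" using N by auto
      let ?w = "\<lambda>i. alt (?s i) (x i (Q m (c (insert i K))))"
      have "koszul N x e J = (\<Sum>l\<in>?lo. x l (Q l (c J))) + (\<Sum>i\<in>?hi. - ?w i)"
        unfolding koszul_def 1 sum.union_disjoint[OF dj(2,3,1)]
        by (intro arg_cong2[where f = "(+)"] sum.cong refl lo hi)
      then have A: "koszul N x e J = (\<Sum>l\<in>?lo. x l (Q l (c J))) - sum ?w ?hi"
        unfolding sum_negf by (simp only: diff_conv_add_uminus)
      have lo0: "Q m (alt (?s i) (x i (c (insert i K)))) = 0" if "i \<in> ?lo" for i
        unfolding additive_alt[OF Q] using that Qlt[of i m] by simp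
      have hi0: "Q m (alt (?s i) (x i (c (insert i K)))) = ?w i" if "i \<in> ?hi" for i
        unfolding additive_alt[OF Q] using that Qgt[of m i] by simp
      have e0: "{k\<in>K. k < m} = {}" using less_asym[OF mK] by blast
      have m0: "Q m (alt (?s m) (x m (c (insert m K)))) = Q m (x m (c J))"
        unfolding e0 JK(1)[symmetric] by simp
      \<comment> \<open>\<open>Q m\<close> is applied to the cycle condition at \<open>K\<close>:
        indices below m vanish by \<open>Qlt\<close>, and those above m reproduce the second sum in
        \<open>A\<close>.\<close>
      have "0 = Q m (koszul N x c K)" using dc[of K] by (simp add: additive.zero[OF Q])
      also have "\<dots> = (\<Sum>i\<in>insert m (?lo \<union> ?hi). Q m (alt (?s i) (x i (c (insert i K)))))"
        unfolding koszul_def 2 by (rule additive.sum[OF Q])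
      also have "\<dots> = Q m (alt (?s m) (x m (c (insert m K)))) +
          (\<Sum>i\<in>?lo \<union> ?hi. Q m (alt (?s i) (x i (c (insert i K)))))"
        by (rule sum.insert[OF finite_UnI[OF dj(2,3)] dj(4)])
      also have "\<dots> = Q m (x m (c J)) + ((\<Sum>i\<in>?lo. 0) + sum ?w ?hi)"
        unfolding sum.union_disjoint[OF dj(2,3,1)]
        by (intro arg_cong2[where f = "(+)"] m0 sum.cong refl lo0 hi0)
      finally have B: "sum ?w ?hi = - Q m (x m (c J))" by (simp add: eq_neg_iff_add_eq_0 add.commute)
      have "(\<Sum>l\<in>?lo. x l (Q l (c J))) + Q m (x m (c J)) = c J"
        by (rule Qeq[OF J(1) _ kchainD[OF c J]]) (use J m in auto)
      then show ?thesis unfolding A B by simp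
    qed
  qed
  then show ?thesis using e by blast
qed

section \<open>Koszul complexes of graded free modules\<close>

lemma lookup_map: "f 0 = 0 \<Longrightarrow> Poly_Mapping.lookup (Poly_Mapping.map f v) k = f (Poly_Mapping.lookup v k)"
  by (simp add: map.rep_eq when_def)

lemma lookup_single_mult:
  fixes s :: "'a::cancel_comm_monoid_add \<Rightarrow>\<^sub>0 'k::comm_ring_1"
  shows "Poly_Mapping.lookup (Poly_Mapping.single w c * s) (w + u) = c * Poly_Mapping.lookup s u"
    and "(\<And>u. k \<noteq> w + u) \<Longrightarrow> Poly_Mapping.lookup (Poly_Mapping.single w c * s) k = 0"
proof -
  have "Poly_Mapping.lookup (Poly_Mapping.single w c * s) k =
      c * (\<Sum>q. Poly_Mapping.lookup s q when k = w + q)" for k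
    by (simp add: lookup_mult lookup_single when_mult)
  then show "Poly_Mapping.lookup (Poly_Mapping.single w c * s) (w + u) = c * Poly_Mapping.lookup s u"
    "(\<And>u. k \<noteq> w + u) \<Longrightarrow> Poly_Mapping.lookup (Poly_Mapping.single w c * s) k = 0"
    by simp_all
qed

definition keep :: "('a \<Rightarrow> bool) \<Rightarrow> ('a \<Rightarrow>\<^sub>0 'b::zero) \<Rightarrow> 'a \<Rightarrow>\<^sub>0 'b" where
  "keep P = Poly_Mapping.mapp (\<lambda>u a. a when P u)"

lemma lookup_keep: "Poly_Mapping.lookup (keep P s) u = (if P u then Poly_Mapping.lookup s u else 0)"
  by (simp add: keep_def lookup_mapp when_def in_keys_iff)

abbreviation smul :: "'k::field mpoly \<Rightarrow> (nat \<Rightarrow>\<^sub>0 'k mpoly) \<Rightarrow> nat \<Rightarrow>\<^sub>0 'k mpoly" where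
  "smul s \<equiv> Poly_Mapping.map ((*) s)"

abbreviation coef :: "(nat \<Rightarrow>\<^sub>0 'k::field mpoly) \<Rightarrow> nat \<Rightarrow> (nat \<Rightarrow>\<^sub>0 nat) \<Rightarrow> 'k" where
  "coef v j u \<equiv> Poly_Mapping.lookup (Poly_Mapping.lookup v j) u"

section \<open>Multiplication and division by a variable\<close>

definition xvar :: "nat \<Rightarrow> 'k::field mpoly" where
  "xvar i = Poly_Mapping.single (Poly_Mapping.single i 1) 1"

text \<open>Divides by x_i the terms whose least variable is x_i and discards the rest. Every
  nonconstant monomial has exactly one least variable, so s minus its constant term is the sum of
  all x_i times \<open>qdiv i s\<close>.\<close>

definition qdiv :: "nat \<Rightarrow> 'k::field mpoly \<Rightarrow> 'k mpoly" where
  "qdiv i s = keep (\<lambda>u. Poly_Mapping.keys u \<subseteq> {i..})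
     (Poly_Mapping.map_key (\<lambda>u. u + Poly_Mapping.single i 1) s)"

lemma lookup_smul [simp]: "Poly_Mapping.lookup (smul s v) j = s * Poly_Mapping.lookup v j"
  by (simp add: lookup_map)

lemma smul_simps: "smul s (v + w) = smul s v + smul s w" "smul (s + t) v = smul s v + smul t v"
    "smul (s * t) v = smul s (smul t v)" "smul s 0 = 0" "smul 0 v = 0" "smul 1 v = v"
  by (rule poly_mapping_eqI, simp add: lookup_add algebra_simps)+

lemma additive_smul: "additive (smul s)"
  by (simp add: additive_def smul_simps)

lemma coef_eqI: "(\<And>j u. coef v j u = coef w j u) \<Longrightarrow> v = w"
  by (intro poly_mapping_eqI)

lemma lookup_xvar_mult: "Poly_Mapping.lookup (xvar i * s) u =
   (if Poly_Mapping.lookup u i = 0 then 0 else Poly_Mapping.lookup s (u - Poly_Mapping.single i 1))"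
proof (cases "Poly_Mapping.lookup u i = 0")
  case True
  have "u \<noteq> Poly_Mapping.single i 1 + w" for w
    using True by (metis add_is_0 lookup_add lookup_single_eq zero_neq_one)
  then show ?thesis using True by (simp add: xvar_def lookup_single_mult(2))
next
  case False
  have "u = Poly_Mapping.single i 1 + (u - Poly_Mapping.single i 1)"
    using False by (intro poly_mapping_eqI) (auto simp: lookup_add lookup_minus lookup_single when_def)
  then show ?thesis using False lookup_single_mult(1)[of "Poly_Mapping.single i 1" 1 s "u - Poly_Mapping.single i 1"]
    by (simp add: xvar_def)
qed

lemma lookup_qdiv: "Poly_Mapping.lookup (qdiv i s) u =
   (if Poly_Mapping.keys u \<subseteq> {i..} then Poly_Mapping.lookup s (u + Poly_Mapping.single i 1) else 0)"
  by (simp add: qdiv_def lookup_keep map_key.rep_eq inj_def)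

lemma qdiv_0 [simp]: "qdiv i 0 = 0"
  by (rule poly_mapping_eqI) (simp add: lookup_qdiv)

lemma coef_qdiv: "coef (Poly_Mapping.map (qdiv i) v) j u =
   (if Poly_Mapping.keys u \<subseteq> {i..} then coef v j (u + Poly_Mapping.single i 1) else 0)"
  by (simp add: lookup_map lookup_qdiv)

lemma coef_xvar: "coef (smul (xvar i) v) j u =
   (if Poly_Mapping.lookup u i = 0 then 0 else coef v j (u - Poly_Mapping.single i 1))"
  by (simp add: lookup_xvar_mult)

lemma additive_qdiv: "additive (Poly_Mapping.map (qdiv i) :: (nat \<Rightarrow>\<^sub>0 'k::field mpoly) \<Rightarrow> _)"
  by (rule additive.intro, rule coef_eqI) (simp add: coef_qdiv lookup_add)

lemma diff_single_add:
  fixes u :: "nat \<Rightarrow>\<^sub>0 nat"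
  assumes "Poly_Mapping.lookup u i \<noteq> 0"
  shows "u - Poly_Mapping.single i 1 + Poly_Mapping.single i 1 = u"
  using assms by (intro poly_mapping_eqI) (auto simp: lookup_add lookup_minus lookup_single when_def)

text \<open>A monomial divisible by x_l with l < i does not have x_i as its least variable.\<close>

lemma qdiv_xvar_less: "l < i \<Longrightarrow> Poly_Mapping.map (qdiv i) (smul (xvar l) v) = 0"
proof (rule coef_eqI)
  fix j u assume "l < i"
  show "coef (Poly_Mapping.map (qdiv i) (smul (xvar l) v)) j u = coef 0 j u"
  proof (cases "Poly_Mapping.keys u \<subseteq> {i..}")
    case True
    then have "l \<notin> Poly_Mapping.keys u" using \<open>l < i\<close> by fastforce
    then have "Poly_Mapping.lookup (u + Poly_Mapping.single i 1) l = 0"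
      using \<open>l < i\<close> by (simp add: lookup_add lookup_single in_keys_iff)
    then show ?thesis by (simp add: coef_qdiv coef_xvar del: lookup_smul)
  qed (simp add: coef_qdiv del: lookup_smul)
qed

text \<open>A factor x_l with l > i does not affect whether x_i is the least variable of a
  monomial.\<close>

lemma qdiv_xvar_greater: "i < l \<Longrightarrow> Poly_Mapping.map (qdiv i) (smul (xvar l) v) = smul (xvar l) (Poly_Mapping.map (qdiv i) v)"
proof (rule coef_eqI)
  fix j and u :: "nat \<Rightarrow>\<^sub>0 nat" assume il: "i < l"
  have 1: "Poly_Mapping.lookup (u + Poly_Mapping.single i 1) l = Poly_Mapping.lookup u l"
    using il by (simp add: lookup_add lookup_single)
  have 2: "u + Poly_Mapping.single i 1 - Poly_Mapping.single l 1 = u - Poly_Mapping.single l 1 + Poly_Mapping.single i 1"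
    using il by (intro poly_mapping_eqI) (auto simp: lookup_add lookup_minus lookup_single when_def)
  have 3: "Poly_Mapping.keys (u - Poly_Mapping.single l 1) \<subseteq> {i..} \<longleftrightarrow> Poly_Mapping.keys u \<subseteq> {i..}"
    if "Poly_Mapping.lookup u l \<noteq> 0"
  proof -
    have "Poly_Mapping.keys u = insert l (Poly_Mapping.keys (u - Poly_Mapping.single l 1))"
      using that by (auto simp: in_keys_iff lookup_minus lookup_single when_def split: if_splits)
    then show ?thesis using il by auto
  qed
  show "coef (Poly_Mapping.map (qdiv i) (smul (xvar l) v)) j u = coef (smul (xvar l) (Poly_Mapping.map (qdiv i) v)) j u"
    using 1 2 3 by (simp add: coef_qdiv coef_xvar del: lookup_smul)
qed

lemma xvar_qdiv: "coef (smul (xvar l) (Poly_Mapping.map (qdiv l) v)) j u =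
  (if l \<in> Poly_Mapping.keys u \<and> Poly_Mapping.keys u \<subseteq> {l..} then coef v j u else 0)"
proof (cases "l \<in> Poly_Mapping.keys u")
  case True
  then have 0: "Poly_Mapping.lookup u l \<noteq> 0" by (simp add: in_keys_iff)
  have "Poly_Mapping.keys u = insert l (Poly_Mapping.keys (u - Poly_Mapping.single l 1))"
    using 0 by (auto simp: in_keys_iff lookup_minus lookup_single when_def split: if_splits)
  then have "Poly_Mapping.keys (u - Poly_Mapping.single l 1) \<subseteq> {l..} \<longleftrightarrow> Poly_Mapping.keys u \<subseteq> {l..}" by auto
  then show ?thesis using 0 True diff_single_add[OF 0] by (simp add: coef_qdiv coef_xvar del: lookup_smul)
qed (simp add: coef_xvar in_keys_iff del: lookup_smul)

lemma qdiv_xvar: "coef (Poly_Mapping.map (qdiv i) (smul (xvar i) v)) j u =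
  (if Poly_Mapping.keys u \<subseteq> {i..} then coef v j u else 0)"
  by (simp add: coef_qdiv coef_xvar lookup_add lookup_single del: lookup_smul)

text \<open>The condition on \<open>l\<close> says that x_l is the least variable of u, so at most
  one summand survives.\<close>

lemma sum_min_keys:
  fixes u :: "nat \<Rightarrow>\<^sub>0 nat" and c :: "'k::comm_monoid_add"
  assumes "finite A"
  shows "(\<Sum>l\<in>A. if l \<in> Poly_Mapping.keys u \<and> Poly_Mapping.keys u \<subseteq> {l..} then c else 0) =
    (if u \<noteq> 0 \<and> Min (Poly_Mapping.keys u) \<in> A then c else 0)"
proof (cases "u = 0")
  case False
  then have ne: "Poly_Mapping.keys u \<noteq> {}" by (simp add: poly_mapping_eq_iff fun_eq_iff in_keys_iff set_eq_iff)
  have "l \<in> Poly_Mapping.keys u \<and> Poly_Mapping.keys u \<subseteq> {l..} \<longleftrightarrow> l = Min (Poly_Mapping.keys u)" for l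
    using ne Min_in[OF finite_keys ne] Min_le[OF finite_keys, of _ u] Min_eqI[OF finite_keys, of u l] by fastforce
  then show ?thesis using assms False by (simp add: sum.delta)
qed simp

text \<open>The degree b - deg e_I that the coefficient of e_I must have.\<close>

definition wdeg :: "nat \<Rightarrow> nat \<Rightarrow> mdegree \<Rightarrow> nat set \<Rightarrow> mdegree" where
  "wdeg m d b I = (\<lambda>t. b t - (\<Sum>i\<in>I. to_mdegree (avec m d i) t))"

lemma wdeg_insert: "finite I \<Longrightarrow> i \<notin> I \<Longrightarrow> wdeg m d b I t = wdeg m d b (insert i I) t + to_mdegree (avec m d i) t"
  by (simp add: wdeg_def)

lemma monom_deg_add: "monom_deg m d (u + v) t = monom_deg m d u t + monom_deg m d v t"
  unfolding monom_deg_def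
  by (rule setsum_keys_plus_distrib[of "\<lambda>i a. int a * to_mdegree (avec m d i) t"]) (simp_all add: distrib_right)

lemma monom_deg_single: "monom_deg m d (Poly_Mapping.single i 1) t = to_mdegree (avec m d i) t"
  by (simp add: monom_deg_def)

lemma monom_deg_0 [simp]: "monom_deg m d 0 t = 0"
  by (simp add: monom_deg_def)

text \<open>Membership is reduced to the exponents of nonzero coefficients; the closure properties
  below are checked in this form.\<close>

lemma free_hcomp_iff: "v \<in> hcomp (free_gmod m d B e) g \<longleftrightarrow>
   (\<forall>j u. coef v j u \<noteq> 0 \<longrightarrow> j \<in> B \<and> Poly_Mapping.keys u \<subseteq> {1..(d + m) choose m} \<and>
       (\<forall>t. monom_deg m d u t = g t - e j t))" (is "?L \<longleftrightarrow> ?R")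
proof
  assume L: ?L
  show ?R
  proof (intro allI impI)
    fix j u assume c: "coef v j u \<noteq> 0"
    then have "j \<in> Poly_Mapping.keys v" by (metis in_keys_iff lookup_zero)
    then have j: "j \<in> B" using L by (auto simp: free_gmod_def)
    then have "Poly_Mapping.lookup v j \<in> S_comp m d (g - e j)" using L by (simp add: free_gmod_def)
    moreover have "u \<in> Poly_Mapping.keys (Poly_Mapping.lookup v j)" using c by (simp add: in_keys_iff)
    ultimately have "Poly_Mapping.keys u \<subseteq> {1..(d + m) choose m}" "monom_deg m d u = g - e j"
      unfolding S_comp_def S_carrier_def by blast+
    with j show "j \<in> B \<and> Poly_Mapping.keys u \<subseteq> {1..(d + m) choose m} \<and> (\<forall>t. monom_deg m d u t = g t - e j t)"
      by simp
  qed
next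
  assume R: ?R
  have "Poly_Mapping.keys v \<subseteq> B"
  proof
    fix j assume "j \<in> Poly_Mapping.keys v"
    then have "\<exists>u. coef v j u \<noteq> 0" by (metis in_keys_iff lookup_zero poly_mapping_eqI)
    then show "j \<in> B" using R by blast
  qed
  moreover have "Poly_Mapping.lookup v j \<in> S_comp m d (g - e j)" for j
    unfolding S_comp_def S_carrier_def using R by (simp add: in_keys_iff fun_eq_iff)
  ultimately show ?L by (simp add: free_gmod_def)
qed

lemma free_carrier_iff: "v \<in> carrier (free_gmod m d B e) \<longleftrightarrow>
   (\<forall>j u. coef v j u \<noteq> 0 \<longrightarrow> j \<in> B \<and> Poly_Mapping.keys u \<subseteq> {1..(d + m) choose m})" (is "?L \<longleftrightarrow> ?R")
proof
  assume L: ?L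
  show ?R
  proof (intro allI impI)
    fix j u assume c: "coef v j u \<noteq> 0"
    then have "j \<in> Poly_Mapping.keys v" by (metis in_keys_iff lookup_zero)
    then have j: "j \<in> B" using L by (auto simp: free_gmod_def)
    moreover have "u \<in> Poly_Mapping.keys (Poly_Mapping.lookup v j)" using c by (simp add: in_keys_iff)
    moreover have "Poly_Mapping.lookup v j \<in> S_carrier m d" using L by (simp add: free_gmod_def)
    ultimately show "j \<in> B \<and> Poly_Mapping.keys u \<subseteq> {1..(d + m) choose m}"
      unfolding S_carrier_def by blast
  qed
next
  assume R: ?R
  have "Poly_Mapping.keys v \<subseteq> B"
  proof
    fix j assume "j \<in> Poly_Mapping.keys v"
    then have "\<exists>u. coef v j u \<noteq> 0" by (metis in_keys_iff lookup_zero poly_mapping_eqI)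
    then show "j \<in> B" using R by blast
  qed
  moreover have "Poly_Mapping.lookup v j \<in> S_carrier m d" for j
    unfolding S_carrier_def using R by (simp add: in_keys_iff)
  ultimately show ?L by (simp add: free_gmod_def)
qed

lemma free_hcomp_carrier: "v \<in> hcomp (free_gmod m d B e) g \<Longrightarrow> v \<in> carrier (free_gmod m d B e)"
  unfolding free_hcomp_iff free_carrier_iff by blast

lemma free_hcomp_diff:
  assumes "v \<in> hcomp (free_gmod m d B e) g" "w \<in> hcomp (free_gmod m d B e) g"
  shows "v - w \<in> hcomp (free_gmod m d B e) g"
  unfolding free_hcomp_iff
proof (intro allI impI)
  fix j u assume "coef (v - w) j u \<noteq> 0"
  then have "coef v j u \<noteq> 0 \<or> coef w j u \<noteq> 0" by (auto simp: lookup_minus)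
  then show "j \<in> B \<and> Poly_Mapping.keys u \<subseteq> {1..(d + m) choose m} \<and> (\<forall>t. monom_deg m d u t = g t - e j t)"
    using assms unfolding free_hcomp_iff by blast
qed

lemma free_hcomp_xvar:
  assumes v: "v \<in> hcomp (free_gmod m d B e) g'" and i: "i \<in> {1..(d + m) choose m}"
    and g: "\<And>t. g t = g' t + to_mdegree (avec m d i) t"
  shows "smul (xvar i) v \<in> hcomp (free_gmod m d B e) g"
  unfolding free_hcomp_iff
proof (intro allI impI)
  fix j u assume "coef (smul (xvar i) v) j u \<noteq> 0"
  then have 0: "Poly_Mapping.lookup u i \<noteq> 0" and 1: "coef v j (u - Poly_Mapping.single i 1) \<noteq> 0"
    by (auto simp: coef_xvar simp del: lookup_smul split: if_splits)
  let ?u = "u - Poly_Mapping.single i 1"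
  have u: "u = ?u + Poly_Mapping.single i 1" using diff_single_add[OF 0] by simp
  have 2: "j \<in> B" "Poly_Mapping.keys ?u \<subseteq> {1..(d + m) choose m}" "\<And>t. monom_deg m d ?u t = g' t - e j t"
    using v 1 unfolding free_hcomp_iff by blast+
  have "monom_deg m d u t = g t - e j t" for t
  proof -
    have "monom_deg m d u t = monom_deg m d (?u + Poly_Mapping.single i 1) t" by (metis u)
    then show ?thesis unfolding monom_deg_add monom_deg_single 2(3) g by simp
  qed
  moreover have "Poly_Mapping.keys u \<subseteq> {1..(d + m) choose m}"
  proof -
    have "Poly_Mapping.keys (?u + Poly_Mapping.single i 1) \<subseteq> Poly_Mapping.keys ?u \<union> {i}"
      using keys_add[of ?u "Poly_Mapping.single i 1"] by simp
    then have "Poly_Mapping.keys u \<subseteq> Poly_Mapping.keys ?u \<union> {i}" by (metis u)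
    then show ?thesis using 2(2) i by blast
  qed
  ultimately show "j \<in> B \<and> Poly_Mapping.keys u \<subseteq> {1..(d + m) choose m} \<and> (\<forall>t. monom_deg m d u t = g t - e j t)"
    using 2 by blast
qed

lemma free_hcomp_qdiv:
  assumes v: "v \<in> hcomp (free_gmod m d B e) g"
    and g: "\<And>t. g t = g' t + to_mdegree (avec m d i) t"
  shows "Poly_Mapping.map (qdiv i) v \<in> hcomp (free_gmod m d B e) g'"
  unfolding free_hcomp_iff
proof (intro allI impI)
  fix j u assume "coef (Poly_Mapping.map (qdiv i) v) j u \<noteq> 0"
  then have "coef v j (u + Poly_Mapping.single i 1) \<noteq> 0" by (auto simp: coef_qdiv split: if_splits)
  then have 2: "j \<in> B" "Poly_Mapping.keys (u + Poly_Mapping.single i 1) \<subseteq> {1..(d + m) choose m}"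
      "\<And>t. monom_deg m d (u + Poly_Mapping.single i 1) t = g t - e j t"
    using v unfolding free_hcomp_iff by blast+
  have "Poly_Mapping.keys u \<subseteq> Poly_Mapping.keys (u + Poly_Mapping.single i 1)"
    by (auto simp: in_keys_iff lookup_add)
  then show "j \<in> B \<and> Poly_Mapping.keys u \<subseteq> {1..(d + m) choose m} \<and> (\<forall>t. monom_deg m d u t = g' t - e j t)"
    using 2 unfolding monom_deg_add monom_deg_single g by fastforce
qed

lemma free_ksystem:
  "ksystem {1..(d + m) choose m} (\<lambda>i. smul (xvar i)) (\<lambda>I. hcomp (free_gmod m d B e) (wdeg m d b I))"
  unfolding ksystem_def
proof (intro conjI allI impI ballI)
  fix I i v assume I: "I \<subseteq> {1..(d + m) choose m}" "i \<in> {1..(d + m) choose m} - I"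
    and v: "v \<in> hcomp (free_gmod m d B e) (wdeg m d b (insert i I))"
  have "finite I" using I(1) finite_subset by blast
  then show "smul (xvar i) v \<in> hcomp (free_gmod m d B e) (wdeg m d b I)"
    using I by (intro free_hcomp_xvar[OF v]) (auto intro: wdeg_insert)
qed (auto simp: additive_smul free_hcomp_diff, simp add: free_hcomp_iff)

text \<open>The terms are sorted by their least variable; without constant terms, every term has
  one. The quotients are homogeneous by \<open>free_hcomp_qdiv\<close>, so a homogeneous element of
  (x_1,...,x_n)F becomes a sum of variables times homogeneous elements.\<close>

lemma free_hcomp_decompose:
  assumes v: "v \<in> hcomp (free_gmod m d B e) g" and 0: "\<And>j. coef v j 0 = 0"
  shows "v = (\<Sum>l\<in>{1..(d + m) choose m}. smul (xvar l) (Poly_Mapping.map (qdiv l) v))"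
proof (rule coef_eqI)
  fix j u
  have "Min (Poly_Mapping.keys u) \<in> {1..(d + m) choose m}" if "u \<noteq> 0" "coef v j u \<noteq> 0"
  proof -
    have "Poly_Mapping.keys u \<noteq> {}" using that(1) by (simp add: poly_mapping_eq_iff fun_eq_iff in_keys_iff set_eq_iff)
    then have "Min (Poly_Mapping.keys u) \<in> Poly_Mapping.keys u" by simp
    then show ?thesis using v that(2) unfolding free_hcomp_iff by blast
  qed
  then show "coef v j u = coef (\<Sum>l\<in>{1..(d + m) choose m}. smul (xvar l) (Poly_Mapping.map (qdiv l) v)) j u"
    using 0[of j]
    by (cases "coef v j u = 0"; cases "u = 0") (simp_all add: lookup_sum xvar_qdiv sum_min_keys del: lookup_smul)
qed

lemma free_koszul_exact:
  assumes c: "c \<in> kchain {1..(d + m) choose m} (\<lambda>I. hcomp (free_gmod m d B e) (wdeg m d b I)) (Suc j)"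
    and dc: "\<And>J. koszul {1..(d + m) choose m} (\<lambda>i. smul (xvar i)) c J = 0"
  shows "c \<in> koszul {1..(d + m) choose m} (\<lambda>i. smul (xvar i)) `
    kchain {1..(d + m) choose m} (\<lambda>I. hcomp (free_gmod m d B e) (wdeg m d b I)) (Suc (Suc j))"
proof -
  let ?N = "{1..(d + m) choose m}" and ?C = "\<lambda>I. hcomp (free_gmod m d B e) (wdeg m d b I)"
    and ?Q = "\<lambda>i. Poly_Mapping.map (qdiv i)"
  have 1: "?Q i v \<in> ?C (insert i I)" if I: "insert i I \<subseteq> ?N" "i \<notin> I" and v: "v \<in> ?C I" for I i v
  proof -
    have "finite I" using I(1) by (meson finite_atLeastAtMost finite_insert finite_subset)
    from free_hcomp_qdiv[OF v wdeg_insert[OF this I(2)]] show ?thesis .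
  qed
  \<comment> \<open>The sum restores the terms that involve a variable below i, each through its
    least variable. The last summand keeps exactly the others, constants included.\<close>
  have 2: "(\<Sum>l\<in>{l\<in>?N. l < i}. smul (xvar l) (?Q l v)) + ?Q i (smul (xvar i) v) = v"
    if I: "I \<subseteq> ?N" "i \<in> ?N" and v: "v \<in> ?C I" for I i v
  proof (rule coef_eqI)
    fix j u
    have *: "u \<noteq> 0 \<and> Min (Poly_Mapping.keys u) \<in> {l\<in>?N. l < i} \<longleftrightarrow> \<not> Poly_Mapping.keys u \<subseteq> {i..}"
      if "coef v j u \<noteq> 0"
    proof (cases "u = 0")
      case False
      then have ne: "Poly_Mapping.keys u \<noteq> {}" by simp
      have M: "Min (Poly_Mapping.keys u) \<in> Poly_Mapping.keys u" using ne by simp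
      have "Poly_Mapping.keys u \<subseteq> ?N" using v that unfolding free_hcomp_iff by blast
      then have "Min (Poly_Mapping.keys u) \<in> ?N" using M by blast
      moreover have "Min (Poly_Mapping.keys u) < i \<longleftrightarrow> \<not> Poly_Mapping.keys u \<subseteq> {i..}"
        unfolding Min_less_iff[OF finite_keys ne] by (auto simp: subset_iff not_le)
      ultimately show ?thesis using False by blast
    qed simp
    have fin: "finite {l\<in>?N. l < i}" by simp
    show "coef ((\<Sum>l\<in>{l\<in>?N. l < i}. smul (xvar l) (?Q l v)) + ?Q i (smul (xvar i) v)) j u = coef v j u"
      unfolding lookup_add lookup_sum xvar_qdiv qdiv_xvar sum_min_keys[OF fin]
      using * by (cases "coef v j u = 0") auto
  qed
  show ?thesis
    by (rule koszul_exact[where N = ?N and x = "\<lambda>i. smul (xvar i)" and Q = ?Q and C = ?C,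
        OF finite_atLeastAtMost free_ksystem additive_qdiv 1 qdiv_xvar_less qdiv_xvar_greater 2 c dc])
qed

section \<open>Splitting modules into graded components\<close>

lemma avec_in_simplex: "i \<in> {1..(d + m) choose m} \<Longrightarrow> avec m d i \<in> simplex_vecs m d"
  using bij_betw_avec[of m d] by (rule bij_betwE[THEN bspec])

lemma to_mdegree_int_vecs: "a \<in> nat_vecs m \<Longrightarrow> to_mdegree a \<in> int_vecs m"
  by (force simp: nat_vecs_def int_vecs_def to_mdegree_def in_keys_iff subset_iff)

lemma to_mdegree_avec_beyond: "i \<in> {1..(d + m) choose m} \<Longrightarrow> t > m \<Longrightarrow> to_mdegree (avec m d i) t = 0"
  using to_mdegree_int_vecs[of "avec m d i" m] avec_in_simplex[of i d m]
  by (simp add: simplex_vecs_def int_vecs_def)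

lemma monom_deg_beyond: "Poly_Mapping.keys u \<subseteq> {1..(d + m) choose m} \<Longrightarrow> t > m \<Longrightarrow> monom_deg m d u t = 0"
  unfolding monom_deg_def by (rule sum.neutral) (use to_mdegree_avec_beyond in \<open>simp add: subset_iff\<close>)

lemma wdeg_int_vecs: "b \<in> int_vecs m \<Longrightarrow> I \<subseteq> {1..(d + m) choose m} \<Longrightarrow> wdeg m d b I \<in> int_vecs m"
  unfolding int_vecs_def wdeg_def using to_mdegree_avec_beyond by (auto intro!: sum.neutral)

lemma semigroup_NA_nat_vecs: "b \<in> semigroup_NA m d \<Longrightarrow> b \<in> nat_vecs m"
proof (induction rule: semigroup_NA.induct)
  case (add a b)
  then show ?case using keys_add[of a b] by (auto simp: nat_vecs_def simplex_vecs_def)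
qed (simp add: nat_vecs_def)

text \<open>\<open>gmod\<close> merely lists the components; that the carrier is their direct sum is
  recorded here through the projections. It matters because exactness of a resolution is stated for
  carriers but used in single degrees.\<close>

definition splits :: "nat \<Rightarrow> ('k::field, 'x::ab_group_add) gmod \<Rightarrow> (mdegree \<Rightarrow> 'x \<Rightarrow> 'x) \<Rightarrow> bool" where
  "splits m M \<pi> \<longleftrightarrow> (\<forall>g. additive (\<pi> g)) \<and>
     0 \<in> carrier M \<and> (\<forall>x\<in>carrier M. \<forall>y\<in>carrier M. x + y \<in> carrier M) \<and>
     (\<forall>g\<in>int_vecs m. \<forall>x\<in>hcomp M g. x \<in> carrier M \<and> (\<forall>g'\<in>int_vecs m. \<pi> g' x = (if g' = g then x else 0))) \<and>
     (\<forall>x\<in>carrier M. (\<forall>g\<in>int_vecs m. \<pi> g x \<in> hcomp M g) \<and>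
        (\<exists>G. finite G \<and> G \<subseteq> int_vecs m \<and> x = (\<Sum>g\<in>G. \<pi> g x)))"

text \<open>\<open>f\<close> respects each component and \<open>x\<close> is a finite sum of
  homogeneous parts, so only the part of degree g contributes.\<close>

lemma splits_hom:
  assumes M: "splits m M \<pi>" and N: "splits m N \<rho>" and f: "graded_hom m d M N f"
    and x: "x \<in> carrier M" and g: "g \<in> int_vecs m"
  shows "\<rho> g (f x) = f (\<pi> g x)"
proof -
  obtain G where G: "finite G" "G \<subseteq> int_vecs m" "x = (\<Sum>h\<in>G. \<pi> h x)"
    using M x unfolding splits_def by blast
  have zc: "0 \<in> carrier M" and ac: "\<And>x y. x \<in> carrier M \<Longrightarrow> y \<in> carrier M \<Longrightarrow> x + y \<in> carrier M"
    using M unfolding splits_def by blast+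
  have fadd: "f (x + y) = f x + f y" if "x \<in> carrier M" "y \<in> carrier M" for x y
    using f that unfolding graded_hom_def by blast
  have f0: "f 0 = 0" using fadd[OF zc zc] by simp
  have pc: "\<pi> h x \<in> hcomp M h" if "h \<in> int_vecs m" for h
    using M x that unfolding splits_def by blast
  then have pcar: "\<pi> h x \<in> carrier M" if "h \<in> int_vecs m" for h
    using M that unfolding splits_def by blast
  have fs: "f (\<Sum>h\<in>H. \<pi> h x) = (\<Sum>h\<in>H. f (\<pi> h x)) \<and> (\<Sum>h\<in>H. \<pi> h x) \<in> carrier M"
    if "finite H" "H \<subseteq> int_vecs m" for H
    using that by (induction H rule: finite_induct) (auto simp: f0 zc fadd ac pcar)
  have addr: "additive (\<rho> g)" and addp: "additive (\<pi> g)" using M N unfolding splits_def by blast+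
  have pp: "\<pi> g (\<pi> h x) = (if g = h then \<pi> h x else 0)" if "h \<in> int_vecs m" for h
    using M pc[OF that] that g unfolding splits_def by blast
  have rp: "\<rho> g (f (\<pi> h x)) = (if g = h then f (\<pi> h x) else 0)" if "h \<in> int_vecs m" for h
  proof -
    have "f (\<pi> h x) \<in> hcomp N h" using f pc[OF that] that unfolding graded_hom_def by blast
    then show ?thesis using N that g unfolding splits_def by blast
  qed
  have "f x = (\<Sum>h\<in>G. f (\<pi> h x))" using fs[OF G(1,2)] G(3) by simp
  then have "\<rho> g (f x) = (\<Sum>h\<in>G. \<rho> g (f (\<pi> h x)))" by (simp add: additive.sum[OF addr])
  also have "\<dots> = (\<Sum>h\<in>G. if g = h then f (\<pi> h x) else 0)"
    by (intro sum.cong refl rp) (use G in auto)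
  also have "\<dots> = (if g \<in> G then f (\<pi> g x) else 0)" using G(1) by (simp add: sum.delta)
  also have "\<dots> = f (\<pi> g x)"
  proof (cases "g \<in> G")
    case False
    have "\<pi> g x = \<pi> g (\<Sum>h\<in>G. \<pi> h x)" using G(3) by simp
    also have "\<dots> = (\<Sum>h\<in>G. \<pi> g (\<pi> h x))" by (rule additive.sum[OF addp])
    also have "\<dots> = 0" by (rule sum.neutral) (use pp G False in auto)
    finally show ?thesis using False f0 by simp
  qed simp
  finally show ?thesis .
qed

text \<open>The degree g part of any preimage of a homogeneous \<open>y\<close> is again a
  preimage.\<close>

lemma splits_lift:
  assumes M: "splits m M \<pi>" and N: "splits m N \<rho>" and f: "graded_hom m d M N f"
    and g: "g \<in> int_vecs m" and y: "y \<in> hcomp N g" "y \<in> f ` carrier M"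
  shows "\<exists>x\<in>hcomp M g. f x = y"
proof -
  obtain x where x: "x \<in> carrier M" "y = f x" using y(2) by blast
  have "\<pi> g x \<in> hcomp M g" using M x(1) g unfolding splits_def by blast
  moreover have "f (\<pi> g x) = \<rho> g y" using splits_hom[OF M N f x(1) g] x(2) by simp
  moreover have "\<rho> g y = y" using N g y(1) unfolding splits_def by simp
  ultimately show ?thesis by auto
qed

definition proj_ring :: "mdegree \<Rightarrow> 'k::field mpoly \<Rightarrow> 'k mpoly" where
  "proj_ring g = keep (\<lambda>b. to_mdegree b = g)"

definition proj_free :: "nat \<Rightarrow> nat \<Rightarrow> (nat \<Rightarrow> mdegree) \<Rightarrow> mdegree \<Rightarrow> (nat \<Rightarrow>\<^sub>0 'k::field mpoly) \<Rightarrow> nat \<Rightarrow>\<^sub>0 'k mpoly" where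
  "proj_free m d e g = Poly_Mapping.mapp (\<lambda>j. keep (\<lambda>u. monom_deg m d u = g - e j))"

lemma splits_ring: "splits m (semigroup_ring m d) proj_ring"
  unfolding splits_def
proof (intro conjI allI ballI)
  show "additive (proj_ring g)" for g
    by (rule additive.intro, rule poly_mapping_eqI) (simp add: proj_ring_def lookup_keep lookup_add)
  show "0 \<in> carrier (semigroup_ring m d)" by (simp add: semigroup_ring_def)
next
  fix x y :: "'a mpoly" assume "x \<in> carrier (semigroup_ring m d)" "y \<in> carrier (semigroup_ring m d)"
  then show "x + y \<in> carrier (semigroup_ring m d)"
    using keys_add[of x y] by (auto simp: semigroup_ring_def)
next
  fix g and x :: "'a mpoly" assume x: "x \<in> hcomp (semigroup_ring m d) g"
  then show "x \<in> carrier (semigroup_ring m d)" by (auto simp: semigroup_ring_def)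
  show "proj_ring g' x = (if g' = g then x else 0)" for g'
    using x by (intro poly_mapping_eqI) (auto simp: proj_ring_def lookup_keep semigroup_ring_def in_keys_iff)
next
  fix x :: "'a mpoly" assume x: "x \<in> carrier (semigroup_ring m d)"
  show "proj_ring g x \<in> hcomp (semigroup_ring m d) g" for g
    using x by (auto simp: proj_ring_def lookup_keep semigroup_ring_def in_keys_iff subset_iff split: if_splits)
  let ?G = "to_mdegree ` Poly_Mapping.keys x"
  have G: "?G \<subseteq> int_vecs m"
    using x semigroup_NA_nat_vecs to_mdegree_int_vecs unfolding semigroup_ring_def by fastforce
  have "x = (\<Sum>g\<in>?G. proj_ring g x)"
    by (rule poly_mapping_eqI) (auto simp: lookup_sum proj_ring_def lookup_keep sum.delta in_keys_iff)
  then show "\<exists>G. finite G \<and> G \<subseteq> int_vecs m \<and> x = (\<Sum>g\<in>G. proj_ring g x)"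
    by (intro exI[of _ ?G] conjI finite_imageI finite_keys G)
qed

lemma coef_proj_free: "coef (proj_free m d e g v) j u = (if \<forall>t. monom_deg m d u t = g t - e j t then coef v j u else 0)"
proof -
  have "Poly_Mapping.lookup (proj_free m d e g v) j = keep (\<lambda>u. monom_deg m d u = g - e j) (Poly_Mapping.lookup v j)"
    unfolding proj_free_def lookup_mapp when_def by (rule poly_mapping_eqI) (simp add: lookup_keep in_keys_iff)
  then show ?thesis by (simp add: lookup_keep fun_eq_iff)
qed

lemma free_carrier_add:
  "x \<in> carrier (free_gmod m d B e) \<Longrightarrow> y \<in> carrier (free_gmod m d B e) \<Longrightarrow> x + y \<in> carrier (free_gmod m d B e)"
  unfolding free_carrier_iff lookup_add by (metis add.right_neutral)

lemma splits_free:
  assumes e: "\<And>j. j \<in> B \<Longrightarrow> e j \<in> int_vecs m"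
  shows "splits m (free_gmod m d B e) (proj_free m d e)"
  unfolding splits_def
proof (intro conjI allI ballI)
  show "additive (proj_free m d e g)" for g
    by (rule additive.intro, rule coef_eqI) (simp add: coef_proj_free lookup_add)
  show "0 \<in> carrier (free_gmod m d B e)" by (simp add: free_carrier_iff)
next
  fix x y :: "nat \<Rightarrow>\<^sub>0 'a mpoly" assume "x \<in> carrier (free_gmod m d B e)" "y \<in> carrier (free_gmod m d B e)"
  then show "x + y \<in> carrier (free_gmod m d B e)" by (rule free_carrier_add)
next
  fix g and x :: "nat \<Rightarrow>\<^sub>0 'a mpoly" assume x: "x \<in> hcomp (free_gmod m d B e) g"
  then show "x \<in> carrier (free_gmod m d B e)" by (rule free_hcomp_carrier)
  show "proj_free m d e g' x = (if g' = g then x else 0)" for g'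
  proof (rule coef_eqI)
    fix j u
    show "coef (proj_free m d e g' x) j u = coef (if g' = g then x else 0) j u"
    proof (cases "coef x j u = 0")
      case False
      then have "\<forall>t. monom_deg m d u t = g t - e j t" using x unfolding free_hcomp_iff by blast
      then show ?thesis by (auto simp: coef_proj_free fun_eq_iff)
    qed (simp add: coef_proj_free)
  qed
next
  fix x :: "nat \<Rightarrow>\<^sub>0 'a mpoly" assume x: "x \<in> carrier (free_gmod m d B e)"
  show "proj_free m d e g x \<in> hcomp (free_gmod m d B e) g" for g
    using x unfolding free_hcomp_iff free_carrier_iff coef_proj_free by (metis (full_types))
  let ?P = "Sigma (Poly_Mapping.keys x) (\<lambda>j. Poly_Mapping.keys (Poly_Mapping.lookup x j))"
  \<comment> \<open>The degree of x^u times the basis vector j. Only the finitely many degrees of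
    terms of \<open>x\<close> enter its decomposition.\<close>
  let ?h = "\<lambda>(j, u) t. e j t + monom_deg m d u t"
  have P: "(j, u) \<in> ?P \<longleftrightarrow> coef x j u \<noteq> 0" for j u by (auto simp: in_keys_iff)
  have "?h a \<in> int_vecs m" if "a \<in> ?P" for a
  proof -
    obtain j u where a: "a = (j, u)" by fastforce
    then have "j \<in> B" "Poly_Mapping.keys u \<subseteq> {1..(d + m) choose m}"
      using that P x unfolding free_carrier_iff by blast+
    then show ?thesis using e[of j] monom_deg_beyond[of u d m] by (simp add: a int_vecs_def)
  qed
  then have "?h ` ?P \<subseteq> int_vecs m" by blast
  moreover have fin: "finite (?h ` ?P)" by simp
  moreover have "x = (\<Sum>g\<in>?h ` ?P. proj_free m d e g x)"
  proof (rule coef_eqI)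
    fix j u
    have *: "(\<forall>t. monom_deg m d u t = g t - e j t) \<longleftrightarrow> g = ?h (j, u)" for g
      by (auto simp: fun_eq_iff algebra_simps)
    show "coef x j u = coef (\<Sum>g\<in>?h ` ?P. proj_free m d e g x) j u"
    proof (cases "coef x j u = 0")
      case False
      then have "?h (j, u) \<in> ?h ` ?P" using P by blast
      then show ?thesis unfolding lookup_sum coef_proj_free * sum.delta[OF fin] by simp
    qed (simp add: lookup_sum coef_proj_free cong: if_cong)
  qed
  ultimately show "\<exists>G. finite G \<and> G \<subseteq> int_vecs m \<and> x = (\<Sum>g\<in>G. proj_free m d e g x)" by blast
qed

section \<open>Syzygies of a graded free resolution, degree by degree\<close>

definition syz :: "nat \<Rightarrow> nat \<Rightarrow> ('k::field, 'x::ab_group_add) free_complex \<Rightarrow> nat \<Rightarrow> mdegree \<Rightarrow> (nat \<Rightarrow>\<^sub>0 'k mpoly) set" where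
  "syz m d F i g = {v \<in> hcomp (term_mod m d F i) g. if i = 0 then aug F v = 0 else bdry F i v = 0}"

lemma res_hom: "graded_free_resolution m d M F \<Longrightarrow>
    graded_hom m d (term_mod m d F (Suc p)) (term_mod m d F p) (bdry F (Suc p))"
  "graded_free_resolution m d M F \<Longrightarrow> graded_hom m d (term_mod m d F 0) M (aug F)"
  by (simp_all add: graded_free_resolution_def)

lemma res_splits: "graded_free_resolution m d M F \<Longrightarrow>
    splits m (term_mod m d F p) (proj_free m d (basis_deg F p))"
  unfolding term_mod_def by (rule splits_free) (simp add: graded_free_resolution_def)

text \<open>Exactness of the whole modules, made homogeneous by \<open>splits_lift\<close>.\<close>

lemma res_bdry_hcomp:
  assumes F: "graded_free_resolution m d M F" and g: "g \<in> int_vecs m"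
  shows "bdry F (Suc i) ` hcomp (term_mod m d F (Suc i)) g = syz m d F i g"
proof (intro equalityI subsetI)
  fix y assume "y \<in> bdry F (Suc i) ` hcomp (term_mod m d F (Suc i)) g"
  then obtain x where x: "x \<in> hcomp (term_mod m d F (Suc i)) g" "y = bdry F (Suc i) x" by blast
  have xc: "x \<in> carrier (term_mod m d F (Suc i))" using x(1) unfolding term_mod_def by (rule free_hcomp_carrier)
  have "y \<in> hcomp (term_mod m d F i) g"
    using res_hom(1)[OF F] x g unfolding graded_hom_def by blast
  moreover have "if i = 0 then aug F y = 0 else bdry F i y = 0"
  proof (cases i)
    case 0 then show ?thesis using F xc x(2) unfolding graded_free_resolution_def by auto
  next
    case (Suc k)
    have "{v \<in> carrier (term_mod m d F (Suc k)). bdry F (Suc k) v = 0} = bdry F (Suc (Suc k)) ` carrier (term_mod m d F (Suc (Suc k)))"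
      using F unfolding graded_free_resolution_def by blast
    then have "bdry F (Suc k) y = 0" using xc x(2) Suc by blast
    then show ?thesis using Suc by simp
  qed
  ultimately show "y \<in> syz m d F i g" by (simp add: syz_def)
next
  fix y assume y: "y \<in> syz m d F i g"
  then have yh: "y \<in> hcomp (term_mod m d F i) g" by (simp add: syz_def)
  then have yc: "y \<in> carrier (term_mod m d F i)" unfolding term_mod_def by (rule free_hcomp_carrier)
  have "y \<in> bdry F (Suc i) ` carrier (term_mod m d F (Suc i))"
  proof (cases i)
    case 0
    have "{v \<in> carrier (term_mod m d F 0). aug F v = 0} = bdry F 1 ` carrier (term_mod m d F 1)"
      using F unfolding graded_free_resolution_def by blast
    then show ?thesis using y yc 0 by (auto simp: syz_def)
  next
    case (Suc k)
    have "{v \<in> carrier (term_mod m d F (Suc k)). bdry F (Suc k) v = 0} = bdry F (Suc (Suc k)) ` carrier (term_mod m d F (Suc (Suc k)))"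
      using F unfolding graded_free_resolution_def by blast
    then show ?thesis using y yc Suc by (auto simp: syz_def)
  qed
  from splits_lift[OF res_splits[OF F] res_splits[OF F] res_hom(1)[OF F] g yh this]
  show "y \<in> bdry F (Suc i) ` hcomp (term_mod m d F (Suc i)) g" by blast
qed

lemma xvar_in_S_carrier: "i \<in> {1..(d + m) choose m} \<Longrightarrow> xvar i \<in> S_carrier m d"
  by (simp add: xvar_def S_carrier_def)

lemma subst_hom_xvar: "subst_hom m d (xvar i :: 'k::field mpoly) = Poly_Mapping.single (avec m d i) 1"
  by (simp add: subst_hom_def xvar_def const_def)

lemma ring_xvar_hcomp:
  assumes f: "f \<in> hcomp (semigroup_ring m d) g'" and i: "i \<in> {1..(d + m) choose m}"
    and g: "\<And>t. g t = g' t + to_mdegree (avec m d i) t"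
  shows "subst_hom m d (xvar i) * f \<in> hcomp (semigroup_ring m d) g"
proof -
  have "b \<in> semigroup_NA m d \<and> to_mdegree b = g" if "b \<in> Poly_Mapping.keys (subst_hom m d (xvar i) * f)" for b
  proof -
    have "b \<in> {a + c | a c. a \<in> Poly_Mapping.keys (Poly_Mapping.single (avec m d i) (1::'a)) \<and> c \<in> Poly_Mapping.keys f}"
      using that unfolding subst_hom_xvar by (rule subsetD[OF keys_mult])
    then obtain c where c: "c \<in> Poly_Mapping.keys f" "b = avec m d i + c" by auto
    have "c \<in> semigroup_NA m d" "to_mdegree c = g'" using f c(1) by (auto simp: semigroup_ring_def)
    then show ?thesis using c(2) avec_in_simplex[OF i] g
      by (auto intro: semigroup_NA.add simp: to_mdegree_def lookup_add fun_eq_iff)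
  qed
  then show ?thesis by (simp add: semigroup_ring_def)
qed

lemma ring_ksystem:
  "ksystem {1..(d + m) choose m} (\<lambda>i f. subst_hom m d (xvar i) * f :: 'k::field mpoly)
    (\<lambda>I. hcomp (semigroup_ring m d) (wdeg m d b I))"
  unfolding ksystem_def
proof (intro conjI allI impI ballI)
  fix I i v assume I: "I \<subseteq> {1..(d + m) choose m}" "i \<in> {1..(d + m) choose m} - I"
    and v: "v \<in> hcomp (semigroup_ring m d) (wdeg m d b (insert i I))"
  have "finite I" using I(1) by (meson finite_atLeastAtMost finite_subset)
  then show "subst_hom m d (xvar i) * v \<in> hcomp (semigroup_ring m d) (wdeg m d b I)"
    using I by (intro ring_xvar_hcomp[OF v]) (auto intro: wdeg_insert)
next
  fix v w :: "'k mpoly" and g assume "v \<in> hcomp (semigroup_ring m d) g" "w \<in> hcomp (semigroup_ring m d) g"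
  then show "v - w \<in> hcomp (semigroup_ring m d) g"
    using keys_diff[of v w] by (auto simp: semigroup_ring_def)
next
  show "additive ((*) (subst_hom m d (xvar i :: 'k mpoly)))" for i
    by (rule additive.intro) (rule distrib_left)
qed (simp add: semigroup_ring_def)

section \<open>From Koszul classes to Tor\<close>

text \<open>The reduction F_p -> F_p / (x_1,...,x_n)F_p, which is F_p tensor k.\<close>

definition eps :: "(nat \<Rightarrow>\<^sub>0 'k::field mpoly) \<Rightarrow> nat \<Rightarrow>\<^sub>0 'k" where
  "eps = Poly_Mapping.map (\<lambda>s. Poly_Mapping.lookup s 0)"

lemma lookup_eps [simp]: "Poly_Mapping.lookup (eps v) j = coef v j 0"
  by (simp add: eps_def lookup_map)

lemma lookup_mult_0:
  fixes s t :: "'k::field mpoly"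
  shows "Poly_Mapping.lookup (s * t) 0 = Poly_Mapping.lookup s 0 * Poly_Mapping.lookup t 0"
proof -
  have *: "(0::nat \<Rightarrow>\<^sub>0 nat) = l + q \<longleftrightarrow> l = 0 \<and> q = 0" for l q
    by (auto simp: poly_mapping_eq_iff fun_eq_iff lookup_add)
  have "Poly_Mapping.lookup (s * t) 0 = (\<Sum>l. Poly_Mapping.lookup s l * (\<Sum>q. Poly_Mapping.lookup t q when l = 0 \<and> q = 0))"
    by (simp add: lookup_mult *)
  also have "\<dots> = (\<Sum>l. Poly_Mapping.lookup s l * Poly_Mapping.lookup t 0 when l = 0)"
  proof (rule Sum_any.cong)
    fix l
    show "Poly_Mapping.lookup s l * (\<Sum>q. Poly_Mapping.lookup t q when l = 0 \<and> q = 0) =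
        (Poly_Mapping.lookup s l * Poly_Mapping.lookup t 0 when l = 0)"
      by (cases "l = 0") simp_all
  qed
  finally show ?thesis by simp
qed

text \<open>\<open>tensor_diff\<close> knows \<open>bdry\<close> only through the images of basis
  vectors, so linearity has to be spelled out before the two can be compared.\<close>

lemma free_expand:
  assumes f: "graded_hom m d (free_gmod m d B e) N f" and w: "w \<in> carrier (free_gmod m d B e)"
  shows "f w = (\<Sum>j\<in>Poly_Mapping.keys w. act N (Poly_Mapping.lookup w j) (f (Poly_Mapping.single j 1)))"
proof -
  have keysB: "Poly_Mapping.keys w \<subseteq> B" and S: "Poly_Mapping.lookup w j \<in> S_carrier m d" for j
    using w by (auto simp: free_gmod_def)
  have single: "Poly_Mapping.single j 1 \<in> carrier (free_gmod m d B e)" if "j \<in> B" for j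
    using that by (auto simp: free_gmod_def S_carrier_def lookup_single when_def)
  have fadd: "f (x + y) = f x + f y" if "x \<in> carrier (free_gmod m d B e)" "y \<in> carrier (free_gmod m d B e)" for x y
    using f that unfolding graded_hom_def by blast
  have 0: "0 \<in> carrier (free_gmod m d B e)" by (simp add: free_carrier_iff)
  have f0: "f 0 = 0" using fadd[OF 0 0] by simp
  let ?g = "\<lambda>j. Poly_Mapping.single j (Poly_Mapping.lookup w j)"
  have gc: "?g j \<in> carrier (free_gmod m d B e)" if "j \<in> B" for j
    using w that unfolding free_carrier_iff by (auto simp: lookup_single when_def split: if_splits)
  have "f (sum ?g A) = (\<Sum>j\<in>A. f (?g j)) \<and> sum ?g A \<in> carrier (free_gmod m d B e)"
    if "finite A" "A \<subseteq> B" for A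
    using that by (induction A rule: finite_induct) (auto simp: f0 0 fadd gc free_carrier_add)
  from this[OF finite_keys keysB]
  have 1: "f (sum ?g (Poly_Mapping.keys w)) = (\<Sum>j\<in>Poly_Mapping.keys w. f (?g j))" by blast
  have 2: "sum ?g (Poly_Mapping.keys w) = w"
    by (rule poly_mapping_eqI) (auto simp: lookup_sum lookup_single when_def in_keys_iff sum.delta' if_distrib cong: if_cong)
  have "f (?g j) = act N (Poly_Mapping.lookup w j) (f (Poly_Mapping.single j 1))" if "j \<in> B" for j
  proof -
    have "f (act (free_gmod m d B e) (Poly_Mapping.lookup w j) (Poly_Mapping.single j 1)) =
        act N (Poly_Mapping.lookup w j) (f (Poly_Mapping.single j 1))"
      using f S[of j] single[OF that] unfolding graded_hom_def by blast
    then show ?thesis by (simp add: free_gmod_def)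
  qed
  then show ?thesis using 1 2 keysB by (auto intro!: sum.cong)
qed

text \<open>Taking constant terms is multiplicative, so \<open>eps\<close> is a map of complexes
  from F to F tensor k.\<close>

lemma tensor_diff_eps:
  assumes F: "graded_free_resolution m d M F" and w: "w \<in> carrier (term_mod m d F (Suc p))"
  shows "tensor_diff F residue_field (Suc p) (eps w) = eps (bdry F (Suc p) w)"
proof (rule poly_mapping_eqI)
  fix i
  let ?d = "\<lambda>j. bdry F (Suc p) (Poly_Mapping.single j 1)"
  have "Poly_Mapping.lookup (tensor_diff F residue_field (Suc p) (eps w)) i =
      (\<Sum>j\<in>Poly_Mapping.keys (eps w). coef (?d j) i 0 * coef w j 0)"
    by (simp add: tensor_diff_def lookup_sum lookup_map residue_field_def)
  also have "\<dots> = (\<Sum>j\<in>Poly_Mapping.keys w. coef (?d j) i 0 * coef w j 0)"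
  proof (rule sum.mono_neutral_left)
    show "Poly_Mapping.keys (eps w) \<subseteq> Poly_Mapping.keys w"
      by (auto simp: in_keys_iff)
    show "\<forall>j\<in>Poly_Mapping.keys w - Poly_Mapping.keys (eps w). coef (?d j) i 0 * coef w j 0 = 0"
      by (auto simp: in_keys_iff)
  qed simp
  also have "\<dots> = coef (bdry F (Suc p) w) i 0"
    using free_expand[OF res_hom(1)[OF F, of p, unfolded term_mod_def[of m d F "Suc p"]] w[unfolded term_mod_def]]
    by (simp add: lookup_sum term_mod_def free_gmod_def lookup_mult_0 mult.commute)
  finally show "Poly_Mapping.lookup (tensor_diff F residue_field (Suc p) (eps w)) i =
      Poly_Mapping.lookup (eps (bdry F (Suc p) w)) i" by simp
qed

lemma ksystem_x: "ksystem N x C \<Longrightarrow> I \<subseteq> N \<Longrightarrow> i \<in> N - I \<Longrightarrow> v \<in> C (insert i I) \<Longrightarrow> x i v \<in> C I"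
  by (simp add: ksystem_def)

abbreviation dS :: "nat \<Rightarrow> nat \<Rightarrow> (nat set \<Rightarrow> nat \<Rightarrow>\<^sub>0 'k::field mpoly) \<Rightarrow> nat set \<Rightarrow> nat \<Rightarrow>\<^sub>0 'k mpoly" where
  "dS m d \<equiv> koszul {1..(d + m) choose m} (\<lambda>i. smul (xvar i))"

lemma smul_commute: "smul s (smul t v) = smul t (smul s v)"
  by (simp only: smul_simps(3)[symmetric] mult.commute)

text \<open>The hypothesis on \<open>act M\<close> provides x_l 0 = 0 in M, which closes the kernel
  of \<open>aug\<close> under multiplication by variables; \<open>gmod\<close> itself imposes no
  module axioms.\<close>

lemma syz_ksystem:
  fixes h :: "'k::field mpoly \<Rightarrow> 'k mpoly"
  assumes F: "graded_free_resolution m d M F" and b: "b \<in> int_vecs m"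
    and M: "act M = (\<lambda>s. (*) (h s))"
  shows "ksystem {1..(d + m) choose m} (\<lambda>i. smul (xvar i)) (\<lambda>I. syz m d F i (wdeg m d b I))"
proof -
  let ?N = "{1..(d + m) choose m}"
  let ?C = "\<lambda>I. hcomp (term_mod m d F i) (wdeg m d b I)"
  have C: "ksystem ?N (\<lambda>i. smul (xvar i)) ?C" unfolding term_mod_def by (rule free_ksystem)
  have car: "v \<in> carrier (term_mod m d F i)" if "v \<in> ?C I" for v I
    using that unfolding term_mod_def by (rule free_hcomp_carrier)
  have act: "act (term_mod m d F i) = smul" for i by (simp add: term_mod_def free_gmod_def)
  have z0: "v - w \<in> syz m d F i g"
    if v: "v \<in> syz m d F i g" and w: "w \<in> syz m d F i g" for v w g
  proof -
    have vw: "v \<in> hcomp (term_mod m d F i) g" "w \<in> hcomp (term_mod m d F i) g" "v - w \<in> hcomp (term_mod m d F i) g"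
      using v w free_hcomp_diff[of v m d "basis F i" "basis_deg F i" g w] by (auto simp: syz_def term_mod_def)
    then have c: "w \<in> carrier (term_mod m d F i)" "v - w \<in> carrier (term_mod m d F i)"
      unfolding term_mod_def by (auto intro: free_hcomp_carrier)
    show ?thesis
    proof (cases i)
      case 0
      have "aug F ((v - w) + w) = aug F (v - w) + aug F w"
        using res_hom(2)[OF F] c 0 unfolding graded_hom_def by blast
      then show ?thesis using vw v w 0 by (simp add: syz_def)
    next
      case (Suc k)
      have "bdry F (Suc k) ((v - w) + w) = bdry F (Suc k) (v - w) + bdry F (Suc k) w"
        using res_hom(1)[OF F] c Suc unfolding graded_hom_def by blast
      then show ?thesis using vw v w Suc by (simp add: syz_def)
    qed
  qed
  have z1: "smul (xvar l) v \<in> syz m d F i (wdeg m d b I)"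
    if I: "I \<subseteq> ?N" "l \<in> ?N - I" and v: "v \<in> syz m d F i (wdeg m d b (insert l I))" for I l v
  proof -
    have vh: "v \<in> ?C (insert l I)" using v by (simp add: syz_def)
    then have h: "smul (xvar l) v \<in> ?C I" by (rule ksystem_x[OF C I])
    have l: "(xvar l :: 'k mpoly) \<in> S_carrier m d" using xvar_in_S_carrier I by blast
    show ?thesis
    proof (cases i)
      case 0
      have "aug F (smul (xvar l) v) = act M (xvar l) (aug F v)"
        using res_hom(2)[OF F] l car[OF vh] 0 unfolding graded_hom_def act by blast
      then show ?thesis using h v 0 M by (simp add: syz_def)
    next
      case (Suc k)
      have "bdry F (Suc k) (smul (xvar l) v) = smul (xvar l) (bdry F (Suc k) v)"
        using res_hom(1)[OF F] l car[OF vh] Suc unfolding graded_hom_def act by blast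
      then show ?thesis using h v Suc by (simp add: syz_def smul_simps)
    qed
  qed
  have z2: "0 \<in> syz m d F i (wdeg m d b I)" if I: "I \<subseteq> ?N" for I
  proof -
    have 0: "0 \<in> ?C I" by (rule ksystem_closed(1)[OF C I])
    show ?thesis
    proof (cases i)
      case i: 0
      have "aug F (0 + 0) = aug F 0 + aug F 0" using res_hom(2)[OF F] car[OF 0] i unfolding graded_hom_def by blast
      then have "aug F 0 = 0" by (metis add.right_neutral add_left_imp_eq)
      then show ?thesis using i 0 by (simp add: syz_def)
    next
      case (Suc k)
      have "bdry F (Suc k) (0 + 0) = bdry F (Suc k) 0 + bdry F (Suc k) 0"
        using res_hom(1)[OF F] car[OF 0] Suc unfolding graded_hom_def by blast
      then have "bdry F (Suc k) 0 = 0" by (metis add.right_neutral add_left_imp_eq)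
      then show ?thesis using Suc 0 by (simp add: syz_def)
    qed
  qed
  show ?thesis unfolding ksystem_def by (intro conjI allI impI ballI additive_smul z0 z1 z2)
qed

text \<open>Step i uses 0 -> Z_i -> F_i -> Z_(i-1) -> 0, with M in place of Z_(-1), and lowers the
  Koszul degree by one. That the new class bounds over F_i is recorded because for i = q it yields
  the cycle condition in \<open>tor_nonzero\<close>.\<close>

lemma syz_class:
  fixes F :: "('k::field, 'k mpoly) free_complex" and c :: "nat set \<Rightarrow> 'k mpoly"
  assumes F: "graded_free_resolution m d (semigroup_ring m d) F" and b: "b \<in> int_vecs m"
    and c: "kclass {1..(d + m) choose m} (\<lambda>i f. subst_hom m d (xvar i) * f)
      (\<lambda>I. hcomp (semigroup_ring m d) (wdeg m d b I)) (Suc q) c"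
  shows "i \<le> q \<Longrightarrow> \<exists>c'. kclass {1..(d + m) choose m} (\<lambda>i. smul (xvar i)) (\<lambda>I. syz m d F i (wdeg m d b I)) (q - i) c' \<and>
     c' \<in> dS m d ` kchain {1..(d + m) choose m} (\<lambda>I. hcomp (term_mod m d F i) (wdeg m d b I)) (Suc (q - i))"
proof (induction i)
  case 0
  let ?N = "{1..(d + m) choose m}"
  have act: "act (term_mod m d F i) = smul" for i by (simp add: term_mod_def free_gmod_def)
  have car: "v \<in> carrier (term_mod m d F i)" if "v \<in> hcomp (term_mod m d F i) g" for v g i
    using that unfolding term_mod_def by (rule free_hcomp_carrier)
  note hom = res_hom(2)[OF F]
  have surj: "aug F ` hcomp (term_mod m d F 0) (wdeg m d b I) = hcomp (semigroup_ring m d) (wdeg m d b I)"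
    if I: "I \<subseteq> ?N" for I
  proof (intro equalityI subsetI)
    have g: "wdeg m d b I \<in> int_vecs m" by (rule wdeg_int_vecs[OF b I])
    fix y :: "'k mpoly"
    assume "y \<in> aug F ` hcomp (term_mod m d F 0) (wdeg m d b I)"
    then show "y \<in> hcomp (semigroup_ring m d) (wdeg m d b I)" using hom g unfolding graded_hom_def by blast
  next
    have g: "wdeg m d b I \<in> int_vecs m" by (rule wdeg_int_vecs[OF b I])
    fix y :: "'k mpoly"
    assume y: "y \<in> hcomp (semigroup_ring m d) (wdeg m d b I)"
    then have "y \<in> carrier (semigroup_ring m d)" by (auto simp: semigroup_ring_def)
    then have "y \<in> aug F ` carrier (term_mod m d F 0)" using F unfolding graded_free_resolution_def by blast
    from splits_lift[OF res_splits[OF F] splits_ring hom g y this]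
    show "y \<in> aug F ` hcomp (term_mod m d F 0) (wdeg m d b I)" by blast
  qed
  have "\<exists>c'. kclass ?N (\<lambda>i. smul (xvar i)) (\<lambda>I. {v \<in> hcomp (term_mod m d F 0) (wdeg m d b I). aug F v = 0}) q c' \<and>
     c' \<in> dS m d ` kchain ?N (\<lambda>I. hcomp (term_mod m d F 0) (wdeg m d b I)) (Suc q)"
  proof (rule koszul_connecting[where N = ?N and xF = "\<lambda>i. smul (xvar i :: 'k mpoly)" and f = "aug F"
        and CF = "\<lambda>I. hcomp (term_mod m d F 0) (wdeg m d b I)"
        and CY = "\<lambda>I. hcomp (semigroup_ring m d) (wdeg m d b I) :: 'k mpoly set" and xY = "\<lambda>i f. subst_hom m d (xvar i) * f :: 'k mpoly" and j = q and c = c])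
    show "finite ?N" by simp
    show "ksystem ?N (\<lambda>i f. subst_hom m d (xvar i) * f :: 'k mpoly) (\<lambda>I. hcomp (semigroup_ring m d) (wdeg m d b I))"
      by (rule ring_ksystem)
    show "smul (xvar i) (smul (xvar l) v) = smul (xvar l) (smul (xvar i) v)" for i l and v :: "nat \<Rightarrow>\<^sub>0 'k mpoly"
      by (rule smul_commute)
    show "aug F ` hcomp (term_mod m d F 0) (wdeg m d b I) = hcomp (semigroup_ring m d) (wdeg m d b I)"
      if I: "I \<subseteq> ?N" for I by (rule surj[OF I])
    show "kclass ?N (\<lambda>i f. subst_hom m d (xvar i) * f) (\<lambda>I. hcomp (semigroup_ring m d) (wdeg m d b I)) (Suc q) c"
      by (rule c)
    show "ksystem ?N (\<lambda>i. smul (xvar i :: 'k mpoly)) (\<lambda>I. hcomp (term_mod m d F 0) (wdeg m d b I))"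
      unfolding term_mod_def by (rule free_ksystem)
    show "aug F (v + w) = aug F v + aug F w"
      if "v \<in> hcomp (term_mod m d F 0) (wdeg m d b I)" "w \<in> hcomp (term_mod m d F 0) (wdeg m d b I)" for I v w
      using hom car[OF that(1)] car[OF that(2)] unfolding graded_hom_def by blast
    show "aug F (smul (xvar i) v) = subst_hom m d (xvar i) * aug F v"
      if "insert i I \<subseteq> ?N" "v \<in> hcomp (term_mod m d F 0) (wdeg m d b (insert i I))" for i I v
    proof -
      have "xvar i \<in> S_carrier m d" using that(1) xvar_in_S_carrier by blast
      then have "aug F (act (term_mod m d F 0) (xvar i) v) = act (semigroup_ring m d) (xvar i) (aug F v)"
        using hom car[OF that(2)] unfolding graded_hom_def by blast
      then show ?thesis unfolding act by (simp add: semigroup_ring_def)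
    qed
    show "c \<in> dS m d ` kchain ?N (\<lambda>I. hcomp (term_mod m d F 0) (wdeg m d b I)) (Suc (Suc j))"
      if "c \<in> kchain ?N (\<lambda>I. hcomp (term_mod m d F 0) (wdeg m d b I)) (Suc j)" "\<And>J. dS m d c J = 0" for j c
      using that unfolding term_mod_def by (rule free_koszul_exact)
  qed
  then show ?case by (simp add: syz_def)
next
  case (Suc i)
  let ?N = "{1..(d + m) choose m}"
  have act: "act (term_mod m d F i) = smul" for i by (simp add: term_mod_def free_gmod_def)
  have car: "v \<in> carrier (term_mod m d F i)" if "v \<in> hcomp (term_mod m d F i) g" for v g i
    using that unfolding term_mod_def by (rule free_hcomp_carrier)
  note hom = res_hom(1)[OF F, of i]
  obtain c' where c': "kclass ?N (\<lambda>i. smul (xvar i)) (\<lambda>I. syz m d F i (wdeg m d b I)) (Suc (q - Suc i)) c'"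
    using Suc by (auto simp: Suc_diff_Suc)
  have surj: "bdry F (Suc i) ` hcomp (term_mod m d F (Suc i)) (wdeg m d b I) = syz m d F i (wdeg m d b I)"
    if I: "I \<subseteq> ?N" for I
    by (rule res_bdry_hcomp[OF F wdeg_int_vecs[OF b I]])
  have sys: "ksystem ?N (\<lambda>i. smul (xvar i)) (\<lambda>I. syz m d F i (wdeg m d b I))"
    by (rule syz_ksystem[OF F b, where h = "subst_hom m d"]) (simp add: semigroup_ring_def)
  have "\<exists>c'. kclass ?N (\<lambda>i. smul (xvar i)) (\<lambda>I. {v \<in> hcomp (term_mod m d F (Suc i)) (wdeg m d b I). bdry F (Suc i) v = 0}) (q - Suc i) c' \<and>
     c' \<in> dS m d ` kchain ?N (\<lambda>I. hcomp (term_mod m d F (Suc i)) (wdeg m d b I)) (Suc (q - Suc i))"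
  proof (rule koszul_connecting[where N = ?N and xF = "\<lambda>i. smul (xvar i :: 'k mpoly)" and f = "bdry F (Suc i)"
        and CF = "\<lambda>I. hcomp (term_mod m d F (Suc i)) (wdeg m d b I)"
        and CY = "\<lambda>I. syz m d F i (wdeg m d b I)" and xY = "\<lambda>i. smul (xvar i :: 'k mpoly)" and j = "q - Suc i" and c = c'])
    show "finite ?N" by simp
    show "ksystem ?N (\<lambda>i. smul (xvar i)) (\<lambda>I. syz m d F i (wdeg m d b I))" by (rule sys)
    show "smul (xvar i) (smul (xvar l) v) = smul (xvar l) (smul (xvar i) v)" for i l and v :: "nat \<Rightarrow>\<^sub>0 'k mpoly"
      by (rule smul_commute)
    show "bdry F (Suc i) ` hcomp (term_mod m d F (Suc i)) (wdeg m d b I) = syz m d F i (wdeg m d b I)"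
      if I: "I \<subseteq> ?N" for I by (rule surj[OF I])
    show "kclass ?N (\<lambda>i. smul (xvar i)) (\<lambda>I. syz m d F i (wdeg m d b I)) (Suc (q - Suc i)) c'" by (rule c')
    show "ksystem ?N (\<lambda>i. smul (xvar i :: 'k mpoly)) (\<lambda>I. hcomp (term_mod m d F (Suc i)) (wdeg m d b I))"
      unfolding term_mod_def by (rule free_ksystem)
    show "bdry F (Suc i) (v + w) = bdry F (Suc i) v + bdry F (Suc i) w"
      if "v \<in> hcomp (term_mod m d F (Suc i)) (wdeg m d b I)" "w \<in> hcomp (term_mod m d F (Suc i)) (wdeg m d b I)" for I v w
      using hom car[OF that(1)] car[OF that(2)] unfolding graded_hom_def by blast
    show "bdry F (Suc i) (smul (xvar l) v) = smul (xvar l) (bdry F (Suc i) v)"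
      if "insert l I \<subseteq> ?N" "v \<in> hcomp (term_mod m d F (Suc i)) (wdeg m d b (insert l I))" for l I v
    proof -
      have "xvar l \<in> S_carrier m d" using that(1) xvar_in_S_carrier by blast
      then have "bdry F (Suc i) (act (term_mod m d F (Suc i)) (xvar l) v) = act (term_mod m d F i) (xvar l) (bdry F (Suc i) v)"
        using hom car[OF that(2)] unfolding graded_hom_def by blast
      then show ?thesis unfolding act .
    qed
    show "c \<in> dS m d ` kchain ?N (\<lambda>I. hcomp (term_mod m d F (Suc i)) (wdeg m d b I)) (Suc (Suc j))"
      if "c \<in> kchain ?N (\<lambda>I. hcomp (term_mod m d F (Suc i)) (wdeg m d b I)) (Suc j)" "\<And>J. dS m d c J = 0" for j c
      using that unfolding term_mod_def by (rule free_koszul_exact)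
  qed
  then show ?case by (simp add: syz_def)
qed

lemma quotient_dim_nonzero:
  assumes "v \<in> Z" and "\<And>a. scale a v \<in> B \<Longrightarrow> a = 0"
  shows "quotient_dim scale Z B \<noteq> 0"
proof -
  have "enat (card {v}) \<le> quotient_dim scale Z B"
    unfolding quotient_dim_def
    by (rule Sup_upper, rule CollectI, rule exI[of _ "{v}"]) (use assms in auto)
  then show ?thesis by (auto simp: enat_0_iff zero_enat_def)
qed

lemma residue_scale: "Poly_Mapping.lookup (Poly_Mapping.map (act residue_field (const a)) v) j = a * Poly_Mapping.lookup v j"
  by (subst lookup_map) (simp_all add: residue_field_def const_def)

text \<open>Lifts an element of F_p tensor k to constants. A nonzero coordinate \<open>j\<close>
  forces the basis vector j to have degree g, so the lift is homogeneous; \<open>r\<close> allows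
  for rescaling.\<close>

lemma const_embed_hcomp:
  assumes v: "v \<in> tensor_comp F residue_field p g"
  shows "Poly_Mapping.map (\<lambda>a. const (a * r)) v \<in> hcomp (term_mod m d F p) g"
  unfolding term_mod_def free_hcomp_iff
proof (intro allI impI)
  fix j u assume "coef (Poly_Mapping.map (\<lambda>a. const (a * r)) v) j u \<noteq> 0"
  moreover have "Poly_Mapping.lookup (Poly_Mapping.map (\<lambda>a. const (a * r)) v) j = const (Poly_Mapping.lookup v j * r)"
    by (rule lookup_map) (simp add: const_def)
  ultimately have c: "Poly_Mapping.lookup v j \<noteq> 0" "u = 0"
    by (auto simp: const_def lookup_single when_def split: if_splits)
  then have j: "j \<in> basis F p" using v by (auto simp: tensor_comp_def in_keys_iff)
  then have "Poly_Mapping.lookup v j \<in> hcomp residue_field (g - basis_deg F p j)"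
    using v by (simp add: tensor_comp_def)
  then have "g - basis_deg F p j = (\<lambda>_. 0)" using c(1) by (auto simp: residue_field_def split: if_splits)
  then have "g t - basis_deg F p j t = 0" for t by (metis fun_diff_def)
  then show "j \<in> basis F p \<and> Poly_Mapping.keys u \<subseteq> {1..(d + m) choose m} \<and> (\<forall>t. monom_deg m d u t = g t - basis_deg F p j t)"
    using j c(2) by simp
qed

lemma eps_tensor_comp:
  assumes w: "w \<in> hcomp (term_mod m d F p) g"
  shows "eps w \<in> tensor_comp F residue_field p g"
proof -
  have *: "j \<in> basis F p \<and> g - basis_deg F p j = (\<lambda>_. 0)" if "coef w j 0 \<noteq> 0" for j
  proof -
    have "j \<in> basis F p" "\<And>t. monom_deg m d 0 t = g t - basis_deg F p j t"
      using w that unfolding term_mod_def free_hcomp_iff by blast+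
    then show ?thesis by (simp add: fun_eq_iff)
  qed
  then show ?thesis by (auto simp: tensor_comp_def residue_field_def in_keys_iff)
qed

lemma tor_nonzero:
  fixes F :: "('k::field, 'k mpoly) free_complex" and c :: "nat set \<Rightarrow> 'k mpoly"
  assumes F: "graded_free_resolution m d (semigroup_ring m d) F" and b: "b \<in> int_vecs m"
    and c: "kclass {1..(d + m) choose m} (\<lambda>i f. subst_hom m d (xvar i) * f)
      (\<lambda>I. hcomp (semigroup_ring m d) (wdeg m d b I)) (Suc q) c"
  shows "quotient_dim (\<lambda>a. Poly_Mapping.map (act residue_field (const a)))
        (tensor_cycles F (residue_field :: ('k, 'k) gmod) (Suc q) b) (tensor_boundaries F residue_field (Suc q) b) \<noteq> 0"
proof -
  let ?N = "{1..(d + m) choose m}"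
  let ?Z = "\<lambda>I. syz m d F q (wdeg m d b I)"
  let ?bd = "bdry F (Suc q)"
  have w0: "wdeg m d b {} = b" by (simp add: wdeg_def)
  have car: "v \<in> carrier (term_mod m d F i)" if "v \<in> hcomp (term_mod m d F i) g" for v g i
    using that unfolding term_mod_def by (rule free_hcomp_carrier)
  have act: "act (term_mod m d F i) = smul" for i by (simp add: term_mod_def free_gmod_def)
  note hom = res_hom(1)[OF F, of q]
  \<comment> \<open>In Koszul degree 0, \<open>z\<close> amounts to the element \<open>z {}\<close>
    of Z_q in degree b. Not being a boundary means that it is no sum of x_l times homogeneous
    elements of Z_q.\<close>
  obtain z t where z: "kclass ?N (\<lambda>i. smul (xvar i)) ?Z 0 z"
    and t: "t \<in> kchain ?N (\<lambda>I. hcomp (term_mod m d F q) (wdeg m d b I)) (Suc 0)" "z = dS m d t"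
    using syz_class[OF F b c, of q] by auto
  have zZ: "z {} \<in> syz m d F q b" and zk: "z \<in> kchain ?N ?Z 0"
    using z kchainD[of z ?N ?Z 0 "{}"] by (auto simp: kclass_def w0)
  have "z {} \<in> ?bd ` hcomp (term_mod m d F (Suc q)) b" unfolding res_bdry_hcomp[OF F b] by (rule zZ)
  then obtain w where w: "w \<in> hcomp (term_mod m d F (Suc q)) b" "?bd w = z {}" by (metis imageE)
  have coef_alt: "coef (alt k v) j 0 = alt k (coef v j 0)" for k v j by (simp add: alt_def)
  \<comment> \<open>As a boundary over F_q, \<open>z {}\<close> lies in (x_1,...,x_n)F_q, so the
    image of \<open>w\<close> in F tensor k is a cycle.\<close>
  have z0: "coef (z {}) j 0 = 0" for j
    unfolding t(2) koszul_def lookup_sum by (rule sum.neutral) (simp add: coef_alt coef_xvar del: lookup_smul)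
  have cyc: "eps w \<in> tensor_cycles F residue_field (Suc q) b"
  proof -
    have "tensor_diff F residue_field (Suc q) (eps w) = 0"
      unfolding tensor_diff_eps[OF F car[OF w(1)]] w(2) by (rule poly_mapping_eqI) (simp add: z0)
    then show ?thesis using eps_tensor_comp[OF w(1)] by (simp add: tensor_cycles_def)
  qed
  \<comment> \<open>Otherwise a lift of the bounding element, divided by a, changes \<open>w\<close>
    by a boundary into an element without constant terms. Writing that element as the sum of x_l Q_l
    shows that \<open>z {}\<close> is the sum of x_l times the images of the Q_l, hence a Koszul
    boundary over Z_q.\<close>
  have "a = 0" if a: "Poly_Mapping.map (act residue_field (const a)) (eps w) \<in> tensor_boundaries F residue_field (Suc q) b" for a
  proof (rule ccontr)
    assume a0: "a \<noteq> 0"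
    obtain v where v: "v \<in> tensor_comp F (residue_field :: ('k, 'k) gmod) (Suc (Suc q)) b"
      "Poly_Mapping.map (act residue_field (const a)) (eps w) = tensor_diff F residue_field (Suc (Suc q)) v"
      using a by (auto simp: tensor_boundaries_def)
    let ?bd2 = "bdry F (Suc (Suc q))"
    define E where "E r = Poly_Mapping.map (\<lambda>a. const (a * r)) v" for r
    have e: "E r \<in> hcomp (term_mod m d F (Suc (Suc q))) b" for r unfolding E_def by (rule const_embed_hcomp[OF v(1)])
    have lk: "Poly_Mapping.lookup (E r) j = const (Poly_Mapping.lookup v j * r)" for j r
      unfolding E_def by (rule lookup_map) (simp add: const_def)
    have "eps (E 1) = v"
      by (rule poly_mapping_eqI) (unfold lookup_eps lk, simp add: const_def)
    then have v2: "tensor_diff F residue_field (Suc (Suc q)) v = eps (?bd2 (E 1))"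
      using tensor_diff_eps[OF F car[OF e[of 1]]] by simp
    have sm: "E (1 / a) = smul (const (1 / a)) (E 1)"
      by (rule poly_mapping_eqI) (unfold lookup_smul lk, simp add: const_def mult_single)
    have cS: "const (1 / a) \<in> S_carrier m d" by (simp add: const_def S_carrier_def)
    have "?bd2 (E (1 / a)) = smul (const (1 / a)) (?bd2 (E 1))"
      using res_hom(1)[OF F, of "Suc q"] cS car[OF e[of 1]] unfolding sm graded_hom_def act by blast
    then have "coef (?bd2 (E (1 / a))) j 0 = 1 / a * coef (?bd2 (E 1)) j 0" for j
      by (simp add: lookup_mult_0 const_def)
    moreover have "coef (?bd2 (E 1)) j 0 = a * coef w j 0" for j
      using v(2) residue_scale[of a "eps w" j] unfolding v2 by simp
    ultimately have eq: "coef (?bd2 (E (1 / a))) j 0 = coef w j 0" for j using a0 by simp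
    let ?y = "w - ?bd2 (E (1 / a))"
    have bh: "?bd2 (E (1 / a)) \<in> syz m d F (Suc q) b"
      unfolding res_bdry_hcomp[OF F b, symmetric] by (rule imageI[OF e])
    then have bh': "?bd2 (E (1 / a)) \<in> hcomp (term_mod m d F (Suc q)) b" and bh0: "?bd (?bd2 (E (1 / a))) = 0"
      by (simp_all add: syz_def)
    have y: "?y \<in> hcomp (term_mod m d F (Suc q)) b"
      using w(1) bh' unfolding term_mod_def by (rule free_hcomp_diff)
    have "?bd (?y + ?bd2 (E (1 / a))) = ?bd ?y + ?bd (?bd2 (E (1 / a)))"
      using hom car[OF y] car[OF bh'] unfolding graded_hom_def by blast
    then have bdy: "?bd ?y = z {}" using w(2) bh0 by simp
    let ?Q = "\<lambda>l. Poly_Mapping.map (qdiv l) ?y"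
    have Qh: "?Q l \<in> hcomp (term_mod m d F (Suc q)) (wdeg m d b {l})" for l
      using y unfolding term_mod_def by (rule free_hcomp_qdiv) (simp add: wdeg_def)
    have l1: "{l} \<subseteq> ?N" if "l \<in> ?N" for l using that by simp
    have dec: "?y = (\<Sum>l\<in>?N. smul (xvar l) (?Q l))"
      by (rule free_hcomp_decompose[OF y[unfolded term_mod_def]]) (simp add: lookup_minus eq)
    have bz: "?bd (?Q l) \<in> ?Z {l}" if "l \<in> ?N" for l
      unfolding res_bdry_hcomp[OF F wdeg_int_vecs[OF b l1[OF that]], symmetric] by (rule imageI[OF Qh])
    have XQ: "smul (xvar l) (?Q l) \<in> carrier (term_mod m d F (Suc q)) \<and> ?bd (smul (xvar l) (?Q l)) = smul (xvar l) (?bd (?Q l))" if "l \<in> ?N" for l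
    proof -
      have "smul (xvar l) (?Q l) \<in> hcomp (term_mod m d F (Suc q)) b"
        using Qh[of l] that unfolding term_mod_def by (rule free_hcomp_xvar) (simp add: wdeg_def)
      moreover have "?bd (smul (xvar l) (?Q l)) = smul (xvar l) (?bd (?Q l))"
        using hom xvar_in_S_carrier[OF that] car[OF Qh[of l]] unfolding graded_hom_def act by blast
      ultimately show ?thesis using car by blast
    qed
    have zero: "0 \<in> carrier (term_mod m d F (Suc q))" by (simp add: term_mod_def free_carrier_iff)
    have badd: "?bd (u + v) = ?bd u + ?bd v" if "u \<in> carrier (term_mod m d F (Suc q))" "v \<in> carrier (term_mod m d F (Suc q))" for u v
      using hom that unfolding graded_hom_def by blast
    have bd0: "?bd 0 = 0" using badd[OF zero zero] by (metis add.right_neutral add_left_imp_eq)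
    have cadd: "u + v \<in> carrier (term_mod m d F (Suc q))" if "u \<in> carrier (term_mod m d F (Suc q))" "v \<in> carrier (term_mod m d F (Suc q))" for u v
      using that unfolding term_mod_def by (rule free_carrier_add)
    have "?bd (\<Sum>l\<in>A. smul (xvar l) (?Q l)) = (\<Sum>l\<in>A. smul (xvar l) (?bd (?Q l))) \<and>
        (\<Sum>l\<in>A. smul (xvar l) (?Q l)) \<in> carrier (term_mod m d F (Suc q))" if "finite A" "A \<subseteq> ?N" for A
      using that
    proof (induction A rule: finite_induct)
      case empty then show ?case by (simp only: sum.empty bd0 zero simp_thms)
    next
      case (insert l A)
      then have "l \<in> ?N" by simp
      note XQ[OF this]
      moreover have IH: "?bd (\<Sum>l\<in>A. smul (xvar l) (?Q l)) = (\<Sum>l\<in>A. smul (xvar l) (?bd (?Q l)))"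
        "(\<Sum>l\<in>A. smul (xvar l) (?Q l)) \<in> carrier (term_mod m d F (Suc q))" using insert by simp_all
      ultimately show ?case
        unfolding sum.insert[OF insert(1,2)] using badd[of "smul (xvar l) (?Q l)" "\<Sum>l\<in>A. smul (xvar l) (?Q l)"] cadd by presburger
    qed
    from this[of ?N] have zs: "z {} = (\<Sum>l\<in>?N. smul (xvar l) (?bd (?Q l)))"
      using bdy dec by (metis finite_atLeastAtMost order_refl)
    \<comment> \<open>The Koszul 1-chain whose coefficient at e_l is the image of
      \<open>?Q l\<close> in Z_q.\<close>
    define s where "s I = (if \<exists>l\<in>?N. I = {l} then ?bd (?Q (the_elem I)) else 0)" for I
    have s1: "s {l} = ?bd (?Q l)" if "l \<in> ?N" for l using that by (simp add: s_def)
    have sk: "s \<in> kchain ?N ?Z (Suc 0)"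
      unfolding kchain_iff
    proof (intro conjI allI impI)
      fix I assume "I \<subseteq> ?N" "card I = Suc 0"
      then obtain l where "I = {l}" "l \<in> ?N" by (metis card_1_singletonE One_nat_def insert_subset)
      then show "s I \<in> ?Z I" using bz s1 by metis
    next
      fix I assume "\<not> (I \<subseteq> ?N \<and> card I = Suc 0)"
      then have "\<not> (\<exists>l\<in>?N. I = {l})" by auto
      then show "s I = 0" unfolding s_def by (rule if_not_P)
    qed
    have sys: "ksystem ?N (\<lambda>i. smul (xvar i)) ?Z"
      by (rule syz_ksystem[OF F b, where h = "subst_hom m d"]) (simp add: semigroup_ring_def)
    have "z = dS m d s"
    proof
      fix J
      show "z J = dS m d s J"
      proof (cases "J = {}")
        case True
        have "dS m d s {} = (\<Sum>l\<in>?N. smul (xvar l) (?bd (?Q l)))"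
          unfolding koszul_def by (rule sum.cong) (use s1 in auto)
        then show ?thesis using zs True by simp
      next
        case False
        then have J: "\<not> (J \<subseteq> ?N \<and> card J = 0)"
          by (metis card_0_eq finite_atLeastAtMost finite_subset)
        show ?thesis
          using kchain_zero[OF zk J] kchain_zero[OF koszul_chain[OF sys finite_atLeastAtMost sk] J] by simp
      qed
    qed
    then show False using z sk unfolding kclass_def by blast
  qed
  with cyc show ?thesis by (rule quotient_dim_nonzero)
qed

section \<open>Existence of graded free resolutions\<close>

definition lin :: "(nat \<Rightarrow> nat \<Rightarrow>\<^sub>0 'k::field mpoly) \<Rightarrow> (nat \<Rightarrow>\<^sub>0 'k mpoly) \<Rightarrow> nat \<Rightarrow>\<^sub>0 'k mpoly" where
  "lin \<gamma> v = (\<Sum>j\<in>Poly_Mapping.keys v. smul (Poly_Mapping.lookup v j) (\<gamma> j))"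

lemma lin_add: "lin \<gamma> (v + w) = lin \<gamma> v + lin \<gamma> w"
  unfolding lin_def
  by (rule setsum_keys_plus_distrib[of "\<lambda>j s. smul s (\<gamma> j)"]) (simp_all add: smul_simps)

lemma lin_smul: "lin \<gamma> (smul s v) = smul s (lin \<gamma> v)"
proof -
  have "lin \<gamma> (smul s v) = (\<Sum>j\<in>Poly_Mapping.keys v. smul (Poly_Mapping.lookup (smul s v) j) (\<gamma> j))"
    unfolding lin_def by (rule sum.mono_neutral_left) (auto simp: in_keys_iff smul_simps)
  then show ?thesis by (simp add: lin_def smul_simps additive.sum[OF additive_smul])
qed

lemma lin_single: "lin \<gamma> (Poly_Mapping.single j s) = smul s (\<gamma> j)"
  by (simp add: lin_def smul_simps)

text \<open>The common carrier of all free modules with basis \<open>nat\<close>, whatever the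
  degrees of the basis vectors are.\<close>

definition S_vecs :: "nat \<Rightarrow> nat \<Rightarrow> (nat \<Rightarrow>\<^sub>0 'k::field mpoly) set" where
  "S_vecs m d = {v. \<forall>j. Poly_Mapping.lookup v j \<in> S_carrier m d}"

lemma carrier_UNIV: "carrier (free_gmod m d UNIV e) = S_vecs m d"
  by (simp add: free_gmod_def S_vecs_def)

lemma act_free [simp]: "act (free_gmod m d B e) = smul"
  by (simp add: free_gmod_def)

lemma S_carrier_mult: "s \<in> S_carrier m d \<Longrightarrow> t \<in> S_carrier m d \<Longrightarrow> s * t \<in> S_carrier m d"
proof -
  assume s: "s \<in> S_carrier m d" and t: "t \<in> S_carrier m d"
  have "Poly_Mapping.keys u \<subseteq> {1..(d + m) choose m}" if uu: "u \<in> Poly_Mapping.keys (s * t)" for u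
  proof -
    obtain a c where ac: "u = a + c" "a \<in> Poly_Mapping.keys s" "c \<in> Poly_Mapping.keys t"
      using subsetD[OF keys_mult uu] by blast
    then have "Poly_Mapping.keys a \<subseteq> {1..(d + m) choose m}" "Poly_Mapping.keys c \<subseteq> {1..(d + m) choose m}"
      using s t unfolding S_carrier_def by blast+
    then show ?thesis using keys_add[of a c] ac(1) by blast
  qed
  then show ?thesis by (simp add: S_carrier_def)
qed

lemma S_carrier_add: "s \<in> S_carrier m d \<Longrightarrow> t \<in> S_carrier m d \<Longrightarrow> s + t \<in> S_carrier m d"
  using keys_add[of s t] unfolding S_carrier_def by blast

lemma S_vecs_closed:
  "0 \<in> S_vecs m d" "v \<in> S_vecs m d \<Longrightarrow> w \<in> S_vecs m d \<Longrightarrow> v + w \<in> S_vecs m d"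
  "s \<in> S_carrier m d \<Longrightarrow> v \<in> S_vecs m d \<Longrightarrow> smul s v \<in> S_vecs m d"
  "s \<in> S_carrier m d \<Longrightarrow> Poly_Mapping.single j s \<in> S_vecs m d"
  by (auto simp: S_vecs_def lookup_add S_carrier_mult S_carrier_add lookup_single when_def)
    (simp_all add: S_carrier_def)

lemma free_hcomp_smul:
  assumes s: "s \<in> S_comp m d h" and x: "x \<in> hcomp (free_gmod m d B e) g'" and g: "\<And>t. g t = h t + g' t"
  shows "smul s x \<in> hcomp (free_gmod m d B e) g"
  unfolding free_hcomp_iff
proof (intro allI impI)
  fix j u assume "coef (smul s x) j u \<noteq> 0"
  then have "u \<in> Poly_Mapping.keys (s * Poly_Mapping.lookup x j)" by (simp add: in_keys_iff)
  then obtain a c where ac: "u = a + c" "a \<in> Poly_Mapping.keys s" "c \<in> Poly_Mapping.keys (Poly_Mapping.lookup x j)"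
    using keys_mult by blast
  have a: "Poly_Mapping.keys a \<subseteq> {1..(d + m) choose m}" "monom_deg m d a = h"
    using s ac(2) unfolding S_comp_def S_carrier_def by blast+
  have "coef x j c \<noteq> 0" using ac(3) by (simp add: in_keys_iff)
  then have c: "j \<in> B" "Poly_Mapping.keys c \<subseteq> {1..(d + m) choose m}" "\<And>t. monom_deg m d c t = g' t - e j t"
    using x unfolding free_hcomp_iff by blast+
  have "Poly_Mapping.keys u \<subseteq> {1..(d + m) choose m}" using keys_add[of a c] a(1) c(2) ac(1) by blast
  then show "j \<in> B \<and> Poly_Mapping.keys u \<subseteq> {1..(d + m) choose m} \<and> (\<forall>t. monom_deg m d u t = g t - e j t)"
    using c a(2) g by (simp add: ac(1) monom_deg_add)
qed

lemma free_hcomp_0: "0 \<in> hcomp (free_gmod m d B e) g"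
  by (simp add: free_hcomp_iff)

lemma free_hcomp_add: "v \<in> hcomp (free_gmod m d B e) g \<Longrightarrow> w \<in> hcomp (free_gmod m d B e) g \<Longrightarrow>
    v + w \<in> hcomp (free_gmod m d B e) g"
  using free_hcomp_diff[OF _ free_hcomp_diff[OF free_hcomp_0], of v m d B e g w] by simp

lemma lin_graded_hom:
  assumes \<gamma>: "\<And>j. \<gamma> j \<in> hcomp (free_gmod m d UNIV e) (e' j)"
  shows "graded_hom m d (free_gmod m d UNIV e') (free_gmod m d UNIV e) (lin \<gamma>)"
  unfolding graded_hom_def carrier_UNIV act_free
proof (intro conjI ballI)
  have \<gamma>S: "\<gamma> j \<in> S_vecs m d" for j using free_hcomp_carrier[OF \<gamma>[of j]] by (simp add: carrier_UNIV)
  fix v :: "nat \<Rightarrow>\<^sub>0 'a mpoly" assume v: "v \<in> S_vecs m d"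
  have "(\<Sum>j\<in>A. smul (Poly_Mapping.lookup v j) (\<gamma> j)) \<in> S_vecs m d" for A
    using v by (induction A rule: infinite_finite_induct)
      (auto simp: S_vecs_closed(1) intro!: S_vecs_closed \<gamma>S, simp add: S_vecs_def)
  then show "lin \<gamma> v \<in> S_vecs m d" unfolding lin_def .
next
  fix g and v :: "nat \<Rightarrow>\<^sub>0 'a mpoly" assume v: "v \<in> hcomp (free_gmod m d UNIV e') g"
  have "smul (Poly_Mapping.lookup v j) (\<gamma> j) \<in> hcomp (free_gmod m d UNIV e) g" for j
    by (rule free_hcomp_smul[of _ m d "g - e' j", OF _ \<gamma>]) (use v in \<open>auto simp: free_gmod_def\<close>)
  then have "(\<Sum>j\<in>A. smul (Poly_Mapping.lookup v j) (\<gamma> j)) \<in> hcomp (free_gmod m d UNIV e) g" for A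
    by (induction A rule: infinite_finite_induct) (simp_all add: free_hcomp_0 free_hcomp_add)
  then show "lin \<gamma> v \<in> hcomp (free_gmod m d UNIV e) g" unfolding lin_def .
qed (simp_all add: lin_add lin_smul)

text \<open>A graded submodule: closure under the projections says that it is generated by
  homogeneous elements.\<close>

definition graded_sub :: "nat \<Rightarrow> nat \<Rightarrow> (nat \<Rightarrow> mdegree) \<Rightarrow> (nat \<Rightarrow>\<^sub>0 'k::field mpoly) set \<Rightarrow> bool" where
  "graded_sub m d e K \<longleftrightarrow> K \<subseteq> S_vecs m d \<and> 0 \<in> K \<and> (\<forall>v\<in>K. \<forall>w\<in>K. v + w \<in> K) \<and>
     (\<forall>s\<in>S_carrier m d. \<forall>v\<in>K. smul s v \<in> K) \<and> (\<forall>g\<in>int_vecs m. \<forall>v\<in>K. proj_free m d e g v \<in> K)"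

text \<open>The kernel is graded because \<open>f\<close> commutes with the projections, by
  \<open>splits_hom\<close>.\<close>

lemma graded_sub_ker:
  fixes f :: "(nat \<Rightarrow>\<^sub>0 'k::field mpoly) \<Rightarrow> 'x::ab_group_add"
  assumes f: "graded_hom m d (free_gmod m d UNIV e) N f" and e: "\<And>j. e j \<in> int_vecs m"
    and N: "splits m N \<rho>" and act0: "\<And>s. act N s 0 = 0"
  shows "graded_sub m d e {v \<in> S_vecs m d. f v = 0}"
proof -
  have fadd: "f (v + w) = f v + f w" if "v \<in> S_vecs m d" "w \<in> S_vecs m d" for v w
    using f that unfolding graded_hom_def carrier_UNIV by blast
  have f0: "f 0 = 0" using fadd[OF S_vecs_closed(1) S_vecs_closed(1)] by (metis add.right_neutral add_left_imp_eq)
  have fs: "f (smul s v) = act N s (f v)" if "s \<in> S_carrier m d" "v \<in> S_vecs m d" for s v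
    using f that unfolding graded_hom_def carrier_UNIV act_free by blast
  have sp: "splits m (free_gmod m d UNIV e) (proj_free m d e)" by (rule splits_free) (rule e)
  have addr: "additive (\<rho> g)" for g using N unfolding splits_def by blast
  have pr: "proj_free m d e g v \<in> S_vecs m d \<and> f (proj_free m d e g v) = 0"
    if g: "g \<in> int_vecs m" and v: "v \<in> S_vecs m d" "f v = 0" for g v
  proof -
    have vc: "v \<in> carrier (free_gmod m d UNIV e)" using v(1) by (simp add: carrier_UNIV)
    then have "proj_free m d e g v \<in> hcomp (free_gmod m d UNIV e) g" using sp g unfolding splits_def by blast
    from free_hcomp_carrier[OF this] have "proj_free m d e g v \<in> S_vecs m d" by (simp add: carrier_UNIV)
    moreover have "f (proj_free m d e g v) = \<rho> g (f v)" using splits_hom[OF sp N f vc g] by simp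
    ultimately show ?thesis using v(2) by (simp add: additive.zero[OF addr])
  qed
  show ?thesis
    unfolding graded_sub_def
    by (intro conjI ballI) (auto simp: S_vecs_closed f0 fadd fs act0 pr)
qed

lemma countable_int_vecs: "countable (int_vecs m)"
proof -
  have "int_vecs m \<subseteq> range (\<lambda>(l::int list) t. if t < length l then l ! t else 0)"
  proof
    fix g assume g: "g \<in> int_vecs m"
    have "g = (\<lambda>t. if t < length (map g [0..<Suc m]) then map g [0..<Suc m] ! t else 0)"
      using g by (auto simp: int_vecs_def fun_eq_iff simp del: upt_Suc)
    then show "g \<in> range (\<lambda>(l::int list) t. if t < length l then l ! t else 0)" by blast
  qed
  then show ?thesis by (rule countable_subset) simp
qed

lemma countable_monomials: "countable {u :: nat \<Rightarrow>\<^sub>0 nat. Poly_Mapping.keys u \<subseteq> {1..n}}"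
proof (rule countable_image_inj_on)
  show "countable ((\<lambda>u :: nat \<Rightarrow>\<^sub>0 nat. map (Poly_Mapping.lookup u) [1..<Suc n]) ` {u. Poly_Mapping.keys u \<subseteq> {1..n}})"
    by (rule countable_subset[OF subset_UNIV countableI_type])
  show "inj_on (\<lambda>u::nat \<Rightarrow>\<^sub>0 nat. map (Poly_Mapping.lookup u) [1..<Suc n]) {u. Poly_Mapping.keys u \<subseteq> {1..n}}"
  proof (rule inj_onI)
    fix u v :: "nat \<Rightarrow>\<^sub>0 nat"
    assume uv: "u \<in> {u. Poly_Mapping.keys u \<subseteq> {1..n}}" "v \<in> {u. Poly_Mapping.keys u \<subseteq> {1..n}}"
      and eq: "map (Poly_Mapping.lookup u) [1..<Suc n] = map (Poly_Mapping.lookup v) [1..<Suc n]"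
    show "u = v"
    proof (rule poly_mapping_eqI)
      fix i
      show "Poly_Mapping.lookup u i = Poly_Mapping.lookup v i"
      proof (cases "i \<in> {1..n}")
        case True
        then have "i \<in> set [1..<Suc n]" by auto
        then show ?thesis using eq by (meson map_eq_conv)
      next
        case False
        then have "i \<notin> Poly_Mapping.keys u" "i \<notin> Poly_Mapping.keys v" using uv by blast+
        then show ?thesis by (simp add: in_keys_iff)
      qed
    qed
  qed
qed

lemma lookup_const_mult: "Poly_Mapping.lookup (const c * s) u = c * Poly_Mapping.lookup s u"
  using lookup_single_mult(1)[of 0 c s u] by (simp add: const_def)

lemma const_S_comp: "const c \<in> S_comp m d (\<lambda>_. 0)"
  by (auto simp: S_comp_def S_carrier_def const_def fun_eq_iff)

text \<open>Each graded component of \<open>K\<close> has countable dimension: for every possible leading position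
  choose one element of the component with that leading position, if there is one.\<close>

lemma graded_sub_generators:
  fixes K :: "(nat \<Rightarrow>\<^sub>0 'k::field mpoly) set"
  assumes K: "graded_sub m d e K" and e: "\<And>j. e j \<in> int_vecs m"
  shows "\<exists>e' \<gamma>. (\<forall>j. e' j \<in> int_vecs m) \<and> (\<forall>j. \<gamma> j \<in> K \<inter> hcomp (free_gmod m d UNIV e) (e' j)) \<and>
    lin \<gamma> ` S_vecs m d = K"
proof -
  let ?H = "\<lambda>g. hcomp (free_gmod m d UNIV e) g"
  let ?U = "{u :: nat \<Rightarrow>\<^sub>0 nat. Poly_Mapping.keys u \<subseteq> {1..(d + m) choose m}}"
  have "infinite ((UNIV :: nat set) \<times> ?U)"
  proof
    assume "finite ((UNIV :: nat set) \<times> ?U)"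
    then have "finite (fst ` ((UNIV :: nat set) \<times> ?U))" by (rule finite_imageI)
    moreover have "0 \<in> ?U" by simp
    then have "fst ` ((UNIV :: nat set) \<times> ?U) = UNIV" by (metis fst_image_times empty_iff)
    ultimately show False by simp
  qed
  then have "bij_betw (from_nat_into ((UNIV :: nat set) \<times> ?U)) UNIV (UNIV \<times> ?U)"
    by (intro bij_betw_from_nat_into countable_SIGMA countable_monomials) auto
  \<comment> \<open>Numbers the monomials x^u times basis vector j, which form a k-basis of the free
    module; a leading position is the last number with nonzero coefficient.\<close>
  then obtain pos :: "nat \<Rightarrow> nat \<times> (nat \<Rightarrow>\<^sub>0 nat)" where pos: "bij_betw pos UNIV (UNIV \<times> ?U)" by blast
  define \<psi> :: "nat \<Rightarrow> (nat \<Rightarrow>\<^sub>0 'k mpoly) \<Rightarrow> 'k" where "\<psi> k v = coef v (fst (pos k)) (snd (pos k))" for k v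
  \<comment> \<open>A filtration of the degree g part of K: only positions below i occur.\<close>
  define T where "T g i = {v \<in> K \<inter> ?H g. \<forall>k\<ge>i. \<psi> k v = 0}" for g i
  \<comment> \<open>If no element of degree g leads at position i, the generator is 0, which lies in
    K and in every component and so does no harm.\<close>
  define G where "G g i = (if \<exists>v\<in>T g (Suc i). \<psi> i v \<noteq> 0 then SOME v. v \<in> T g (Suc i) \<and> \<psi> i v \<noteq> 0 else 0)" for g i
  define dg where "dg = from_nat_into (int_vecs m)"
  have ne: "int_vecs m \<noteq> {}" by (auto simp: int_vecs_def)
  have dg: "dg a \<in> int_vecs m" for a unfolding dg_def by (rule from_nat_into[OF ne])
  have dgs: "\<exists>a. dg a = g" if "g \<in> int_vecs m" for g
    using from_nat_into_surj[OF countable_int_vecs that] by (simp add: dg_def)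
  \<comment> \<open>Generators are numbered by pairs of a degree and a leading position.\<close>
  define \<gamma> where "\<gamma> n = G (dg (fst (prod_decode n))) (snd (prod_decode n))" for n
  define e' where "e' n = dg (fst (prod_decode n))" for n
  have K0: "0 \<in> K" and KS: "K \<subseteq> S_vecs m d" and Kadd: "\<And>v w. v \<in> K \<Longrightarrow> w \<in> K \<Longrightarrow> v + w \<in> K"
    and Ksm: "\<And>s v. s \<in> S_carrier m d \<Longrightarrow> v \<in> K \<Longrightarrow> smul s v \<in> K"
    and Kpr: "\<And>g v. g \<in> int_vecs m \<Longrightarrow> v \<in> K \<Longrightarrow> proj_free m d e g v \<in> K"
    using K unfolding graded_sub_def by blast+
  have G1: "G g i \<in> T g (Suc i) \<and> \<psi> i (G g i) \<noteq> 0" if "\<exists>v\<in>T g (Suc i). \<psi> i v \<noteq> 0" for g i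
  proof -
    have "\<exists>v. v \<in> T g (Suc i) \<and> \<psi> i v \<noteq> 0" using that by blast
    from someI_ex[OF this] show ?thesis using that by (simp add: G_def)
  qed
  have GK: "G g i \<in> K \<inter> ?H g" for g i
  proof (cases "\<exists>v\<in>T g (Suc i). \<psi> i v \<noteq> 0")
    case True
    then show ?thesis using G1[OF True] by (simp add: T_def)
  next
    case False
    then have "G g i = 0" unfolding G_def by (rule if_not_P)
    then show ?thesis using K0 free_hcomp_0 by simp
  qed
  let ?R = "lin \<gamma> ` S_vecs m d"
  have one: "(1::'k mpoly) \<in> S_carrier m d" by (simp add: S_carrier_def)
  have R0: "0 \<in> ?R"
    by (rule image_eqI[of _ _ 0]) (simp_all add: lin_def S_vecs_closed)
  have Radd: "v + w \<in> ?R" if "v \<in> ?R" "w \<in> ?R" for v w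
  proof -
    obtain v' w' where "v = lin \<gamma> v'" "w = lin \<gamma> w'" "v' \<in> S_vecs m d" "w' \<in> S_vecs m d" using \<open>v \<in> ?R\<close> \<open>w \<in> ?R\<close> by blast
    then have "v + w = lin \<gamma> (v' + w')" "v' + w' \<in> S_vecs m d" by (simp_all add: lin_add S_vecs_closed)
    then show ?thesis by blast
  qed
  have RG: "smul s (G g i) \<in> ?R" if g: "g \<in> int_vecs m" and s: "s \<in> S_carrier m d" for s g i
  proof -
    obtain a where "dg a = g" using dgs g by blast
    then have "G g i = \<gamma> (prod_encode (a, i))" by (simp add: \<gamma>_def)
    then have "smul s (G g i) = lin \<gamma> (Poly_Mapping.single (prod_encode (a, i)) s)" by (simp add: lin_single)
    then show ?thesis using S_vecs_closed(4)[OF s] by blast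
  qed
  \<comment> \<open>Induction along the filtration: a scalar multiple of \<open>G g i\<close>
    cancels the coefficient at position i.\<close>
  have span: "v \<in> ?R" if "v \<in> T g i" "g \<in> int_vecs m" for v g i
    using that(1)
  proof (induction i arbitrary: v)
    case 0
    have "v = 0"
    proof (rule coef_eqI)
      fix j u
      have False if "coef v j u \<noteq> 0"
      proof -
        have "v \<in> ?H g" using 0 by (simp add: T_def)
        then have "(j, u) \<in> UNIV \<times> ?U" using that unfolding free_hcomp_iff by blast
        then obtain k where "pos k = (j, u)" using bij_betw_imp_surj_on[OF pos] by (metis imageE)
        then have "\<psi> k v \<noteq> 0" using that by (simp add: \<psi>_def)
        then show False using 0 by (simp add: T_def)
      qed
      then show "coef v j u = coef 0 j u" by auto
    qed
    then show ?case using R0 by simp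
  next
    case (Suc i)
    show ?case
    proof (cases "\<psi> i v = 0")
      case True
      have "\<psi> k v = 0" if "k \<ge> i" for k
        using that True Suc.prems by (cases "k = i") (auto simp: T_def)
      then have "v \<in> T g i" using Suc.prems by (simp add: T_def)
      then show ?thesis by (rule Suc.IH)
    next
      case False
      then have g: "G g i \<in> T g (Suc i)" "\<psi> i (G g i) \<noteq> 0" using G1[of g i] Suc.prems by blast+
      define c where "c = \<psi> i v / \<psi> i (G g i)"
      let ?w = "smul (const (- c)) (G g i)"
      have psi: "\<psi> k (v + ?w) = \<psi> k v - c * \<psi> k (G g i)" for k
        by (simp add: \<psi>_def lookup_add lookup_const_mult)
      have cS: "const r \<in> S_carrier m d" for r :: 'k by (simp add: const_def S_carrier_def)
      have "?w \<in> ?H g"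
        by (rule free_hcomp_smul[OF const_S_comp]) (use g in \<open>auto simp: T_def\<close>)
      then have 1: "v + ?w \<in> K \<inter> ?H g"
        using Suc.prems g(1) by (auto simp: T_def intro: Kadd free_hcomp_add Ksm[OF cS])
      have "\<psi> k (v + ?w) = 0" if "k \<ge> i" for k
      proof (cases "k = i")
        case True then show ?thesis unfolding psi using g(2) by (simp add: c_def)
      next
        case False
        then have "\<psi> k v = 0" "\<psi> k (G g i) = 0" using that Suc.prems g(1) by (auto simp: T_def)
        then show ?thesis unfolding psi by simp
      qed
      then have "v + ?w \<in> T g i" using 1 by (simp add: T_def)
      then have "v + ?w \<in> ?R" by (rule Suc.IH)
      moreover have "smul (const c) (G g i) \<in> ?R" by (rule RG[OF \<open>g \<in> int_vecs m\<close> cS])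
      ultimately have "v + ?w + smul (const c) (G g i) \<in> ?R" by (rule Radd)
      moreover have "v + ?w + smul (const c) (G g i) = v"
        by (rule coef_eqI) (simp add: lookup_add lookup_const_mult)
      ultimately show ?thesis by simp
    qed
  qed
  have hom: "v \<in> ?R" if v: "v \<in> K" "v \<in> ?H g" and g: "g \<in> int_vecs m" for v g
  proof -
    let ?P = "Sigma (Poly_Mapping.keys v) (\<lambda>j. Poly_Mapping.keys (Poly_Mapping.lookup v j))"
    have "{k. \<psi> k v \<noteq> 0} \<subseteq> pos -` ?P"
    proof
      fix k assume "k \<in> {k. \<psi> k v \<noteq> 0}"
      then have c: "coef v (fst (pos k)) (snd (pos k)) \<noteq> 0" by (simp add: \<psi>_def)
      then have "fst (pos k) \<in> Poly_Mapping.keys v" by (metis in_keys_iff lookup_zero)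
      then show "k \<in> pos -` ?P" using c by (simp add: in_keys_iff mem_Times_iff split_beta Sigma_def prod_eq_iff)
    qed
    moreover have "finite (pos -` ?P)"
      by (rule finite_vimageI) (use bij_betw_imp_inj_on[OF pos] in simp_all)
    ultimately have "finite {k. \<psi> k v \<noteq> 0}" by (rule finite_subset)
    then obtain i where "\<forall>k\<in>{k. \<psi> k v \<noteq> 0}. k < i" by (meson finite_nat_set_iff_bounded)
    then have "v \<in> T g i" using v by (auto simp: T_def)
    then show ?thesis using g by (rule span)
  qed
  have "K \<subseteq> ?R"
  proof
    fix v assume v: "v \<in> K"
    have sp: "splits m (free_gmod m d UNIV e) (proj_free m d e :: mdegree \<Rightarrow> (nat \<Rightarrow>\<^sub>0 'k mpoly) \<Rightarrow> _)"
      by (rule splits_free) (rule e)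
    have vc: "v \<in> carrier (free_gmod m d UNIV e)" using v KS by (auto simp: carrier_UNIV)
    then obtain D where D: "finite D" "D \<subseteq> int_vecs m" "v = (\<Sum>g\<in>D. proj_free m d e g v)"
      using sp unfolding splits_def by blast
    have "proj_free m d e g v \<in> ?R" if "g \<in> int_vecs m" for g
    proof (rule hom[OF _ _ that])
      show "proj_free m d e g v \<in> K" by (rule Kpr[OF that v])
      show "proj_free m d e g v \<in> ?H g" using sp vc that unfolding splits_def by blast
    qed
    then have "(\<Sum>g\<in>D. proj_free m d e g v) \<in> ?R"
      using D(2) by (induction D rule: infinite_finite_induct) (simp_all add: R0 Radd)
    then show "v \<in> ?R" using D(3) by simp
  qed
  moreover have "?R \<subseteq> K"
  proof
    fix y assume "y \<in> ?R"
    then obtain v where v: "v \<in> S_vecs m d" "y = lin \<gamma> v" by blast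
    have "smul (Poly_Mapping.lookup v j) (\<gamma> j) \<in> K" for j
      by (rule Ksm) (use v(1) GK in \<open>auto simp: S_vecs_def \<gamma>_def\<close>)
    then have "(\<Sum>j\<in>A. smul (Poly_Mapping.lookup v j) (\<gamma> j)) \<in> K" for A
      by (induction A rule: infinite_finite_induct) (simp_all add: K0 Kadd)
    then show "y \<in> K" unfolding v(2) lin_def .
  qed
  ultimately have "?R = K" by blast
  moreover have "\<gamma> j \<in> K \<inter> ?H (e' j)" for j using GK by (simp add: \<gamma>_def e'_def)
  moreover have "e' j \<in> int_vecs m" for j using dg by (simp add: e'_def)
  ultimately show ?thesis by blast
qed

section \<open>The homomorphism from S onto k[NA], on monomials and in general\<close>

definition mono_img :: "nat \<Rightarrow> nat \<Rightarrow> (nat \<Rightarrow>\<^sub>0 nat) \<Rightarrow> 'k::field mpoly" where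
  "mono_img m d u = (\<Prod>i\<in>Poly_Mapping.keys u. Poly_Mapping.single (avec m d i) 1 ^ Poly_Mapping.lookup u i)"

lemma mono_img_superset: "finite A \<Longrightarrow> Poly_Mapping.keys u \<subseteq> A \<Longrightarrow>
    mono_img m d u = (\<Prod>i\<in>A. Poly_Mapping.single (avec m d i) 1 ^ Poly_Mapping.lookup u i)"
  unfolding mono_img_def by (rule prod.mono_neutral_left) (auto simp: in_keys_iff)

lemma mono_img_add: "mono_img m d (u + v) = mono_img m d u * mono_img m d v"
proof -
  let ?A = "Poly_Mapping.keys u \<union> Poly_Mapping.keys v"
  show ?thesis
    using keys_add[of u v]
    by (simp add: mono_img_superset[of ?A] lookup_add power_add prod.distrib)
qed

lemma mono_img_single: "mono_img m d (Poly_Mapping.single i 1) = Poly_Mapping.single (avec m d i) 1"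
  by (simp add: mono_img_def)

lemma const_simps: "const (a + b) = const a + const b" "const (a * b) = const a * const b" "const 0 = 0" "const 1 = 1"
  by (simp_all add: const_def single_add mult_single)

lemma subst_hom_eq: "subst_hom m d s = (\<Sum>u\<in>Poly_Mapping.keys s. const (Poly_Mapping.lookup s u) * mono_img m d u)"
  by (simp add: subst_hom_def mono_img_def)

lemma subst_hom_add: "subst_hom m d (s + t) = subst_hom m d s + subst_hom m d t"
  unfolding subst_hom_eq
  by (rule setsum_keys_plus_distrib[of "\<lambda>u a. const a * mono_img m d u"]) (simp_all add: const_simps distrib_right)

lemma additive_subst_hom: "additive (subst_hom m d)"
  by (rule additive.intro) (rule subst_hom_add)

lemma subst_hom_single: "subst_hom m d (Poly_Mapping.single u c) = const c * mono_img m d u"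
  by (simp add: subst_hom_eq const_simps)

lemma sum_singles: "(\<Sum>u\<in>Poly_Mapping.keys s. Poly_Mapping.single u (Poly_Mapping.lookup s u)) = s"
  by (rule poly_mapping_eqI) (auto simp: lookup_sum lookup_single when_def in_keys_iff)

lemma subst_hom_mult: "subst_hom m d (s * t) = subst_hom m d s * subst_hom m d t"
proof -
  have "s * t = (\<Sum>u\<in>Poly_Mapping.keys s. \<Sum>v\<in>Poly_Mapping.keys t.
      Poly_Mapping.single (u + v) (Poly_Mapping.lookup s u * Poly_Mapping.lookup t v))"
    by (simp only: mult_single[symmetric] sum_product[symmetric] sum_singles)
  then have "subst_hom m d (s * t) = (\<Sum>u\<in>Poly_Mapping.keys s. \<Sum>v\<in>Poly_Mapping.keys t.
      (const (Poly_Mapping.lookup s u) * mono_img m d u) * (const (Poly_Mapping.lookup t v) * mono_img m d v))"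
    by (simp add: additive.sum[OF additive_subst_hom] subst_hom_single mono_img_add const_simps mult_ac)
  then show ?thesis by (simp add: subst_hom_eq sum_product)
qed

lemma semigroup_NA_closed: "a \<in> semigroup_NA m d \<Longrightarrow> b \<in> semigroup_NA m d \<Longrightarrow> a + b \<in> semigroup_NA m d"
proof (induction rule: semigroup_NA.induct)
  case (add a c)
  have "a + (c + b) \<in> semigroup_NA m d" by (rule semigroup_NA.add[OF add(1) add.IH[OF add.prems]])
  then show ?case by (simp only: add.assoc)
qed simp

lemma mono_img_single_NA:
  assumes "Poly_Mapping.keys u \<subseteq> {1..(d + m) choose m}"
  shows "\<exists>a\<in>semigroup_NA m d. (mono_img m d u :: 'k::field mpoly) = Poly_Mapping.single a 1 \<and> to_mdegree a = monom_deg m d u"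
proof -
  have pw: "\<exists>a\<in>semigroup_NA m d. Poly_Mapping.single (avec m d i) (1::'k) ^ k = Poly_Mapping.single a 1 \<and>
      (\<forall>t. to_mdegree a t = int k * to_mdegree (avec m d i) t)" if i: "i \<in> {1..(d + m) choose m}" for i k
  proof (induction k)
    case 0
    show ?case by (rule bexI[OF _ semigroup_NA.zero]) (simp add: to_mdegree_def)
  next
    case (Suc k)
    then obtain a where a: "a \<in> semigroup_NA m d" "Poly_Mapping.single (avec m d i) (1::'k) ^ k = Poly_Mapping.single a 1"
      "\<And>t. to_mdegree a t = int k * to_mdegree (avec m d i) t" by blast
    have "Poly_Mapping.single (avec m d i) (1::'k) ^ Suc k = Poly_Mapping.single (avec m d i + a) 1"
      by (simp add: a(2) mult_single)
    moreover have "to_mdegree (avec m d i + a) t = int (Suc k) * to_mdegree (avec m d i) t" for t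
      using a(3)[of t] by (simp add: to_mdegree_def lookup_add algebra_simps)
    ultimately show ?case using semigroup_NA.add[OF avec_in_simplex[OF i] a(1)] by blast
  qed
  have "\<exists>a\<in>semigroup_NA m d. (\<Prod>i\<in>A. Poly_Mapping.single (avec m d i) (1::'k) ^ Poly_Mapping.lookup u i) = Poly_Mapping.single a 1 \<and>
      (\<forall>t. to_mdegree a t = (\<Sum>i\<in>A. int (Poly_Mapping.lookup u i) * to_mdegree (avec m d i) t))"
    if "finite A" "A \<subseteq> {1..(d + m) choose m}" for A
    using that
  proof (induction A rule: finite_induct)
    case empty
    show ?case by (rule bexI[OF _ semigroup_NA.zero]) (simp add: to_mdegree_def)
  next
    case (insert i A)
    then obtain a where a: "a \<in> semigroup_NA m d"
      "(\<Prod>i\<in>A. Poly_Mapping.single (avec m d i) (1::'k) ^ Poly_Mapping.lookup u i) = Poly_Mapping.single a 1"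
      "\<And>t. to_mdegree a t = (\<Sum>i\<in>A. int (Poly_Mapping.lookup u i) * to_mdegree (avec m d i) t)" by auto
    have "i \<in> {1..(d + m) choose m}" using insert.prems by simp
    then obtain c where c: "c \<in> semigroup_NA m d"
      "Poly_Mapping.single (avec m d i) (1::'k) ^ Poly_Mapping.lookup u i = Poly_Mapping.single c 1"
      "\<And>t. to_mdegree c t = int (Poly_Mapping.lookup u i) * to_mdegree (avec m d i) t" using pw by blast
    have "to_mdegree (c + a) t = to_mdegree c t + to_mdegree a t" for t by (simp add: to_mdegree_def lookup_add)
    then show ?case
      using insert(1,2) by (intro bexI[OF _ semigroup_NA_closed[OF c(1) a(1)]]) (simp add: a(2,3) c(2,3) mult_single)
  qed
  from this[OF finite_keys assms] show ?thesis
    unfolding mono_img_def monom_deg_def fun_eq_iff .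
qed

lemma mono_img_surj:
  assumes "a \<in> semigroup_NA m d"
  shows "\<exists>u. Poly_Mapping.keys u \<subseteq> {1..(d + m) choose m} \<and> (mono_img m d u :: 'k::field mpoly) = Poly_Mapping.single a 1"
  using assms
proof (induction rule: semigroup_NA.induct)
  case zero
  show ?case by (rule exI[of _ 0]) (simp add: mono_img_def)
next
  case (add a b)
  then obtain u where u: "Poly_Mapping.keys u \<subseteq> {1..(d + m) choose m}" "(mono_img m d u :: 'k mpoly) = Poly_Mapping.single b 1" by blast
  have "a \<in> avec m d ` {1..(d + m) choose m}"
    unfolding bij_betw_imp_surj_on[OF bij_betw_avec] by (rule add(1))
  then obtain i where i: "i \<in> {1..(d + m) choose m}" "avec m d i = a" by (metis imageE)
  have "Poly_Mapping.keys (Poly_Mapping.single i 1 + u) \<subseteq> {1..(d + m) choose m}"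
    using keys_add[of "Poly_Mapping.single i 1" u] u(1) i(1) by fastforce
  moreover have "(mono_img m d (Poly_Mapping.single i 1 + u) :: 'k mpoly) = Poly_Mapping.single (a + b) 1"
    unfolding mono_img_add mono_img_single u(2) i(2) by (simp add: mult_single)
  ultimately show ?case by blast
qed

text \<open>Basis vector 0 goes to 1 and all others to 0. The others give F_0 the basis
  \<open>nat\<close> like every later term; they lie in the kernel, which is the image of
  F_1.\<close>

definition aug0 :: "nat \<Rightarrow> nat \<Rightarrow> (nat \<Rightarrow>\<^sub>0 'k::field mpoly) \<Rightarrow> 'k mpoly" where
  "aug0 m d v = subst_hom m d (Poly_Mapping.lookup v 0)"

lemma subst_hom_hcomp:
  assumes s: "s \<in> S_carrier m d"
  shows "Poly_Mapping.keys (subst_hom m d s) \<subseteq> {a \<in> semigroup_NA m d. \<exists>u\<in>Poly_Mapping.keys s. to_mdegree a = monom_deg m d u}"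
proof
  fix a assume "a \<in> Poly_Mapping.keys (subst_hom m d s)"
  then obtain u where u: "u \<in> Poly_Mapping.keys s" "a \<in> Poly_Mapping.keys (const (Poly_Mapping.lookup s u) * mono_img m d u)"
    using keys_sum[of "\<lambda>u. const (Poly_Mapping.lookup s u) * mono_img m d u" "Poly_Mapping.keys s"]
    unfolding subst_hom_eq by blast
  have "Poly_Mapping.keys u \<subseteq> {1..(d + m) choose m}" using u(1) s unfolding S_carrier_def by blast
  from mono_img_single_NA[OF this] obtain c where c: "c \<in> semigroup_NA m d" "(mono_img m d u :: 'a mpoly) = Poly_Mapping.single c 1"
     "to_mdegree c = monom_deg m d u" by blast
  have "a = c" using u(2) by (simp add: c(2) const_def mult_single split: if_splits)
  then show "a \<in> {a \<in> semigroup_NA m d. \<exists>u\<in>Poly_Mapping.keys s. to_mdegree a = monom_deg m d u}" using c u(1) by blast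
qed

lemma aug0_graded_hom:
  "graded_hom m d (free_gmod m d UNIV (\<lambda>_ _. 0)) (semigroup_ring m d) (aug0 m d)"
  unfolding graded_hom_def carrier_UNIV act_free
proof (intro conjI ballI)
  fix v :: "nat \<Rightarrow>\<^sub>0 'a mpoly" assume "v \<in> S_vecs m d"
  then show "aug0 m d v \<in> carrier (semigroup_ring m d)"
    using subst_hom_hcomp[of "Poly_Mapping.lookup v 0" m d] by (auto simp: S_vecs_def aug0_def semigroup_ring_def)
next
  fix g and v :: "nat \<Rightarrow>\<^sub>0 'a mpoly" assume "v \<in> hcomp (free_gmod m d UNIV (\<lambda>_ _. 0)) g"
  then have "Poly_Mapping.lookup v 0 \<in> S_carrier m d" "\<And>u. u \<in> Poly_Mapping.keys (Poly_Mapping.lookup v 0) \<Longrightarrow> monom_deg m d u = g"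
    by (auto simp: free_gmod_def S_comp_def fun_diff_def)
  then show "aug0 m d v \<in> hcomp (semigroup_ring m d) g"
    using subst_hom_hcomp[of "Poly_Mapping.lookup v 0" m d] by (fastforce simp: aug0_def semigroup_ring_def)
next
  fix v w :: "nat \<Rightarrow>\<^sub>0 'a mpoly"
  show "aug0 m d (v + w) = aug0 m d v + aug0 m d w" unfolding aug0_def lookup_add by (rule subst_hom_add)
next
  fix s and v :: "nat \<Rightarrow>\<^sub>0 'a mpoly"
  show "aug0 m d (smul s v) = act (semigroup_ring m d) s (aug0 m d v)"
    unfolding aug0_def lookup_smul subst_hom_mult by (simp add: semigroup_ring_def)
qed

lemma aug0_surj: "aug0 m d ` S_vecs m d = carrier (semigroup_ring m d :: ('k::field, 'k mpoly) gmod)"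
proof (intro equalityI subsetI)
  fix y :: "'k mpoly" assume "y \<in> aug0 m d ` S_vecs m d"
  then show "y \<in> carrier (semigroup_ring m d)"
    using aug0_graded_hom[of m d] unfolding graded_hom_def carrier_UNIV by blast
next
  fix y :: "'k mpoly" assume "y \<in> carrier (semigroup_ring m d)"
  then have y: "Poly_Mapping.keys y \<subseteq> semigroup_NA m d" by (simp add: semigroup_ring_def)
  have "\<forall>a\<in>Poly_Mapping.keys y. \<exists>u. Poly_Mapping.keys u \<subseteq> {1..(d + m) choose m} \<and> (mono_img m d u :: 'k mpoly) = Poly_Mapping.single a 1"
    using mono_img_surj y by blast
  from bchoice[OF this] obtain U where U: "\<And>a. a \<in> Poly_Mapping.keys y \<Longrightarrow> Poly_Mapping.keys (U a) \<subseteq> {1..(d + m) choose m}"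
    "\<And>a. a \<in> Poly_Mapping.keys y \<Longrightarrow> (mono_img m d (U a) :: 'k mpoly) = Poly_Mapping.single a 1" by blast
  let ?s = "\<Sum>a\<in>Poly_Mapping.keys y. Poly_Mapping.single (U a) (Poly_Mapping.lookup y a)"
  have "subst_hom m d ?s = (\<Sum>a\<in>Poly_Mapping.keys y. const (Poly_Mapping.lookup y a) * mono_img m d (U a))"
    by (simp add: additive.sum[OF additive_subst_hom] subst_hom_single)
  also have "\<dots> = (\<Sum>a\<in>Poly_Mapping.keys y. Poly_Mapping.single a (Poly_Mapping.lookup y a))"
    by (rule sum.cong) (simp_all add: U(2) const_def mult_single)
  finally have "subst_hom m d ?s = y" by (simp only: sum_singles)
  then have A1: "aug0 m d (Poly_Mapping.single 0 ?s) = y" by (simp add: aug0_def)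
  have "Poly_Mapping.single (U a) (Poly_Mapping.lookup y a) \<in> S_carrier m d" if "a \<in> Poly_Mapping.keys y" for a
    using U(1)[OF that] unfolding S_carrier_def by simp
  then have "(\<Sum>a\<in>A. Poly_Mapping.single (U a) (Poly_Mapping.lookup y a)) \<in> S_carrier m d" if "A \<subseteq> Poly_Mapping.keys y" for A
    using that by (induction A rule: infinite_finite_induct) (simp_all add: S_carrier_add, simp_all add: S_carrier_def)
  then have "Poly_Mapping.single 0 ?s \<in> S_vecs m d" by (intro S_vecs_closed(4)) simp
  from imageI[OF this, of "aug0 m d"] show "y \<in> aug0 m d ` S_vecs m d" unfolding A1 .
qed

text \<open>Each kernel is a graded submodule, hence the image of a free module with basis
  \<open>nat\<close>; iterating this by dependent choice produces the resolution.\<close>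

lemma resolution_exists:
  "\<exists>F :: ('k::field, 'k mpoly) free_complex. graded_free_resolution m d (semigroup_ring m d) F"
proof -
  let ?K0 = "{v \<in> S_vecs m d. aug0 m d (v :: nat \<Rightarrow>\<^sub>0 'k mpoly) = 0}"
  let ?e0 = "\<lambda>_ _. 0 :: int"
  let ?S = "S_vecs m d :: (nat \<Rightarrow>\<^sub>0 'k mpoly) set"
  \<comment> \<open>The state at stage n consists of the degrees of the basis of F_n and the kernel
    of the map out of F_n; the start is pinned down for n = 0.\<close>
  let ?P = "\<lambda>n (e, K :: (nat \<Rightarrow>\<^sub>0 'k mpoly) set). (\<forall>j. e j \<in> int_vecs m) \<and> graded_sub m d e K \<and> (n = (0::nat) \<longrightarrow> e = ?e0 \<and> K = ?K0)"
  let ?Q = "\<lambda>n::nat. \<lambda>(e, K) (e', K'). \<exists>\<gamma>. (\<forall>j. \<gamma> j \<in> hcomp (free_gmod m d UNIV e) (e' j)) \<and> lin \<gamma> ` ?S = K \<and>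
      K' = {v \<in> ?S. lin \<gamma> v = 0}"
  have e0: "?e0 j \<in> int_vecs m" for j :: nat by (simp add: int_vecs_def)
  have "\<exists>f. \<forall>n. ?P n (f n) \<and> ?Q n (f n) (f (Suc n))"
  proof (rule dependent_nat_choice)
    have "graded_sub m d ?e0 ?K0"
      by (rule graded_sub_ker[OF aug0_graded_hom e0 splits_ring]) (simp add: semigroup_ring_def)
    then show "\<exists>x. ?P 0 x" using e0 by (intro exI[of _ "(?e0, ?K0)"]) simp
  next
    fix x n assume "?P n x"
    then obtain e K where x: "x = (e, K)" and e: "\<And>j. e j \<in> int_vecs m" and K: "graded_sub m d e K" by (cases x) auto
    from graded_sub_generators[OF K e] obtain e' \<gamma> where e': "\<And>j. e' j \<in> int_vecs m"
      and \<gamma>: "\<And>j. \<gamma> j \<in> K \<inter> hcomp (free_gmod m d UNIV e) (e' j)" and im: "lin \<gamma> ` ?S = K" by blast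
    have sp: "splits m (free_gmod m d UNIV e) (proj_free m d e :: mdegree \<Rightarrow> (nat \<Rightarrow>\<^sub>0 'k mpoly) \<Rightarrow> _)"
      by (rule splits_free) (rule e)
    have hom: "graded_hom m d (free_gmod m d UNIV e') (free_gmod m d UNIV e) (lin \<gamma>)"
      by (rule lin_graded_hom) (use \<gamma> in blast)
    have "graded_sub m d e' {v \<in> ?S. lin \<gamma> v = 0}"
      by (rule graded_sub_ker[OF hom e' sp]) (simp add: smul_simps)
    then show "\<exists>y. ?P (Suc n) y \<and> ?Q n x y"
      using e' \<gamma> im by (intro exI[of _ "(e', {v \<in> ?S. lin \<gamma> v = 0})"]) (auto simp: x)
  qed
  then obtain f where f': "\<forall>n. ?P n (f n) \<and> ?Q n (f n) (f (Suc n))" by (rule exE)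
  have f: "?P n (f n)" "?Q n (f n) (f (Suc n))" for n
    using f'[rule_format, of n] by (rule conjunct1, rule conjunct2)
  define e where "e n = fst (f n)" for n
  define K where "K n = snd (f n)" for n
  have fe: "f n = (e n, K n)" for n by (simp add: e_def K_def)
  have e: "e n j \<in> int_vecs m" for n j using f(1)[of n] by (simp add: fe)
  have init: "e 0 = ?e0" "K 0 = ?K0" using f(1)[of 0] by (simp_all add: fe)
  have "\<forall>n. \<exists>\<gamma>. (\<forall>j. \<gamma> j \<in> hcomp (free_gmod m d UNIV (e n)) (e (Suc n) j)) \<and> lin \<gamma> ` ?S = K n \<and> K (Suc n) = {v \<in> ?S. lin \<gamma> v = 0}"
    using f(2) by (simp add: fe)
  then obtain \<gamma> where \<gamma>': "\<forall>n. (\<forall>j. \<gamma> n j \<in> hcomp (free_gmod m d UNIV (e n)) (e (Suc n) j)) \<and>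
      lin (\<gamma> n) ` ?S = K n \<and> K (Suc n) = {v \<in> ?S. lin (\<gamma> n) v = 0}" by (rule choice[THEN exE])
  have \<gamma>: "\<gamma> n j \<in> hcomp (free_gmod m d UNIV (e n)) (e (Suc n) j)"
    "lin (\<gamma> n) ` ?S = K n" "K (Suc n) = {v \<in> ?S. lin (\<gamma> n) v = 0}" for n j
    using \<gamma>'[rule_format, of n] by simp_all
  \<comment> \<open>\<open>\<gamma> n\<close> describes the map from F_(n+1) to F_n, hence the shift
    in \<open>bdry\<close>.\<close>
  define F :: "('k, 'k mpoly) free_complex" where
    "F = \<lparr>basis = (\<lambda>_. UNIV), basis_deg = e, bdry = (\<lambda>p. lin (\<gamma> (p - 1))), aug = aug0 m d\<rparr>"
  have tm: "term_mod m d F p = free_gmod m d UNIV (e p)" for p by (simp add: term_mod_def F_def)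
  have "graded_free_resolution m d (semigroup_ring m d) F"
    unfolding graded_free_resolution_def tm carrier_UNIV
  proof (intro conjI allI ballI)
    show "basis_deg F p j \<in> int_vecs m" for p j by (simp add: F_def e)
    show "graded_hom m d (free_gmod m d UNIV (e (Suc p))) (free_gmod m d UNIV (e p)) (bdry F (Suc p))" for p
      unfolding F_def by simp (rule lin_graded_hom, rule \<gamma>(1))
    show "graded_hom m d (free_gmod m d UNIV (e 0)) (semigroup_ring m d) (aug F)"
      unfolding init F_def by simp (rule aug0_graded_hom)
    show "aug F ` S_vecs m d = carrier (semigroup_ring m d)" unfolding F_def by simp (rule aug0_surj)
    show "{v \<in> S_vecs m d. aug F v = 0} = bdry F 1 ` S_vecs m d"
      using \<gamma>(2)[of 0] init(2) by (simp add: F_def)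
    show "{v \<in> S_vecs m d. bdry F (Suc p) v = 0} = bdry F (Suc (Suc p)) ` S_vecs m d" for p
      using \<gamma>(2)[of "Suc p"] \<gamma>(3)[of p] by (simp add: F_def)
  qed
  then show ?thesis by (rule exI)
qed

text \<open>\<open>tor_nonzero\<close> holds for every graded free resolution, in particular for the
  one chosen in \<open>tor_dim\<close>.\<close>

lemma betti_nonzero:
  fixes c :: "nat set \<Rightarrow> 'k::field mpoly"
  assumes b: "b \<in> nat_vecs m"
    and c: "kclass {1..(d + m) choose m} (\<lambda>i f. subst_hom m d (xvar i) * f)
      (\<lambda>I. hcomp (semigroup_ring m d) (wdeg m d (to_mdegree b) I)) (Suc q) c"
  shows "betti TYPE('k) m d (Suc q) b \<noteq> 0"
proof -
  have "graded_free_resolution m d (semigroup_ring m d)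
      (SOME F :: ('k, 'k mpoly) free_complex. graded_free_resolution m d (semigroup_ring m d) F)"
    by (rule someI_ex) (rule resolution_exists)
  from tor_nonzero[OF this to_mdegree_int_vecs[OF b] c] show ?thesis
    unfolding betti_def tor_dim_def Let_def .
qed

section \<open>The Koszul class\<close>

lemma koszul_single_term:
  assumes N: "finite N" and i: "i \<in> N - F" and 0: "\<And>l. l \<in> N - F \<Longrightarrow> l \<noteq> i \<Longrightarrow> x l (y (insert l F)) = 0"
  shows "koszul N x y F = alt (card {j \<in> F. j < i}) (x i (y (insert i F)))"
proof -
  have "koszul N x y F = (\<Sum>l\<in>{i}. alt (card {j \<in> F. j < l}) (x l (y (insert l F))))"
    unfolding koszul_def by (rule sum.mono_neutral_right) (use N i 0 in auto)
  then show ?thesis by simp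
qed

lemma alt_eq_0_iff [simp]: "alt k v = 0 \<longleftrightarrow> v = 0"
  by (simp add: alt_def)

text \<open>The cycle \<open>\<zeta>\<close> is, up to sign, the fundamental class of the sphere that is the join of the boundaries
  of the simplices on \<open>W\<close> and on \<open>U - W\<close>.\<close>

lemma join_sphere:
  assumes N: "finite N" and U: "U \<subseteq> N" and W: "W \<subseteq> U"
  shows "\<exists>\<zeta> :: nat set \<Rightarrow> 'k::field. (\<forall>J. koszul N (\<lambda>_ v. v) \<zeta> J = 0) \<and>
    (\<forall>F. \<zeta> F \<noteq> 0 \<longrightarrow> (\<exists>j\<in>W. \<exists>l\<in>U - W. F = U - {j, l})) \<and> (\<forall>j\<in>W. \<forall>l\<in>U - W. \<zeta> (U - {j, l}) \<noteq> 0)"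
proof -
  let ?D = "koszul N (\<lambda>_ v. v) :: (nat set \<Rightarrow> 'k) \<Rightarrow> nat set \<Rightarrow> 'k"
  \<comment> \<open>\<open>\<delta>\<close> is the simplex on \<open>U\<close>, and
    \<open>\<omega>\<close> consists of the facets in its boundary that miss a vertex of
    \<open>W\<close>: up to sign, the boundary of W joined with the simplex on U - W. Its own
    boundary is the sphere.\<close>
  define \<delta> :: "nat set \<Rightarrow> 'k" where "\<delta> F = (if F = U then 1 else 0)" for F
  define \<omega> where "\<omega> F = (if W \<subseteq> F then 0 else ?D \<delta> F)" for F
  have finU: "finite U" using N U by (rule finite_subset[rotated])
  have D: "?D c F = 0" if "\<And>i. i \<in> N - F \<Longrightarrow> c (insert i F) = 0" for c F
    unfolding koszul_def by (rule sum.neutral) (use that in simp)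
  have add: "additive (\<lambda>v::'k. v)" by (rule additive.intro) (rule refl)
  have DD: "?D (?D c) J = 0" if "finite J" for c J
    by (rule koszul_koszul[OF add refl N that])
  have \<omega>: "\<exists>j\<in>W. G = U - {j}" if "\<omega> G \<noteq> 0" for G
  proof -
    have G: "\<not> W \<subseteq> G" "?D \<delta> G \<noteq> 0" using that by (auto simp: \<omega>_def split: if_splits)
    then obtain i where i: "i \<in> N - G" "\<delta> (insert i G) \<noteq> 0" using D by blast
    then have "insert i G = U" by (simp add: \<delta>_def split: if_splits)
    then have "G = U - {i}" using i(1) by blast
    moreover have "i \<in> W" using G(1) W \<open>G = U - {i}\<close> by blast
    ultimately show ?thesis by blast
  qed
  have \<omega>1: "\<omega> (U - {j}) \<noteq> 0" if j: "j \<in> W" for j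
  proof -
    have jN: "j \<in> N - (U - {j})" using j W U by blast
    have ins: "insert j (U - {j}) = U" using j W by blast
    have "\<delta> (insert l (U - {j})) = 0" if "l \<noteq> j" for l
      unfolding \<delta>_def using that j W by auto
    from koszul_single_term[OF N jN, of "\<lambda>_ v. v" \<delta>, OF this] ins
    have "?D \<delta> (U - {j}) \<noteq> 0" by (simp add: \<delta>_def)
    then show ?thesis using j by (auto simp: \<omega>_def)
  qed
  have ex: "\<exists>i\<in>N - F. \<omega> (insert i F) \<noteq> 0" if "?D \<omega> F \<noteq> 0" for F
    using D[of F \<omega>] that by blast
  have 2: "\<exists>j\<in>W. \<exists>l\<in>U - W. F = U - {j, l}" if F: "?D \<omega> F \<noteq> 0" for F
  proof -
    obtain i where i: "i \<in> N - F" "\<omega> (insert i F) \<noteq> 0" using ex[OF F] by blast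
    then obtain j where j: "j \<in> W" "insert i F = U - {j}" using \<omega> by blast
    have Fi: "F = U - {j, i}" "i \<in> U" "i \<noteq> j" using i(1) j by blast+
    \<comment> \<open>If both missing vertices were in \<open>W\<close>, then on all sets around F
      the chain \<open>\<omega>\<close> would agree with the boundary of the simplex on U, and the
      boundary of that is 0.\<close>
    have "i \<notin> W"
    proof
      assume iW: "i \<in> W"
      have "\<omega> (insert l F) = ?D \<delta> (insert l F)" for l
      proof -
        have "\<not> W \<subseteq> insert l F" using Fi iW j(1) by blast
        then show ?thesis by (simp add: \<omega>_def)
      qed
      then have "?D \<omega> F = ?D (?D \<delta>) F" by (simp add: koszul_def[of N _ \<omega>] koszul_def[of N _ "?D \<delta>"])
      also have "\<dots> = 0" by (rule DD) (simp add: Fi(1) finU)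
      finally show False using F by simp
    qed
    then show ?thesis using Fi j(1) by blast
  qed
  have 3: "?D \<omega> (U - {j, l}) \<noteq> 0" if j: "j \<in> W" and l: "l \<in> U - W" for j l
  proof -
    have lN: "l \<in> N - (U - {j, l})" using l U by blast
    have ins: "insert l (U - {j, l}) = U - {j}" using j l by blast
    have "\<omega> (insert i (U - {j, l})) = 0" if i: "i \<noteq> l" for i
    proof (rule ccontr)
      assume "\<omega> (insert i (U - {j, l})) \<noteq> 0"
      from \<omega>[OF this] obtain k where k: "k \<in> W" "insert i (U - {j, l}) = U - {k}" by (rule bexE)
      have "l \<notin> insert i (U - {j, l})" using i by simp
      then have "l = k" unfolding k(2) using l by simp
      then show False using k(1) l by simp
    qed
    from koszul_single_term[OF N lN, of "\<lambda>_ v. v" \<omega>, OF this]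
    show ?thesis unfolding ins using \<omega>1[OF j] by simp
  qed
  have 1: "?D (?D \<omega>) J = 0" for J
  proof (cases "finite J")
    case True then show ?thesis by (rule DD)
  next
    case False
    have "?D \<omega> (insert i J) = 0" for i
    proof (rule ccontr)
      assume "?D \<omega> (insert i J) \<noteq> 0"
      from 2[OF this] obtain j l where "insert i J = U - {j, l}" by (elim bexE)
      then have "finite (insert i J)" using finU by simp
      then show False using False by simp
    qed
    then show ?thesis by (rule D)
  qed
  show ?thesis using 1 2 3 by blast
qed

lemma additive_single: "additive (Poly_Mapping.single k)"
  by (rule additive.intro) (rule single_add)

lemma vec_sum_0D:
  assumes "c \<in> nat_vecs m" "vec_sum m c = 0"
  shows "c = 0"
proof (rule poly_mapping_eqI)
  fix t
  show "Poly_Mapping.lookup c t = Poly_Mapping.lookup 0 t"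
  proof (cases "t \<le> m")
    case True
    then show ?thesis using assms(2) by (simp add: vec_sum_def)
  next
    case False
    then have "t \<notin> Poly_Mapping.keys c" using assms(1) by (auto simp: nat_vecs_def)
    then show ?thesis by (simp add: in_keys_iff)
  qed
qed

lemma vec_sum_avec: "i \<in> {1..(d + m) choose m} \<Longrightarrow> vec_sum m (avec m d i) = d"
  using avec_in_simplex[of i d m] by (simp add: simplex_vecs_def)

lemma vec_sum_sum: "vec_sum m (sum f A) = (\<Sum>a\<in>A. vec_sum m (f a))"
  unfolding vec_sum_def lookup_sum by (rule sum.swap)

lemma simplex_in_NA: "a \<in> simplex_vecs m d \<Longrightarrow> a \<in> semigroup_NA m d"
  using semigroup_NA.add[OF _ semigroup_NA.zero] by fastforce

text \<open>In terms of the overview, \<open>U\<close> consists of V, W and a^q, so that W is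
  \<open>U - V - {q}\<close>; \<open>rel\<close> is the exchange relation that turns the sphere into
  a Koszul cycle.\<close>

lemma kclass_exists:
  fixes U V :: "nat set"
  assumes U: "U \<subseteq> {1..(d + m) choose m}" and V: "V \<subseteq> U" and q: "q \<in> U - V" and V0: "V \<noteq> {}"
    and l0: "l0 \<in> U - V - {q}" and cardU: "card U = p + 2"
    and rel: "\<And>j l. j \<in> V \<Longrightarrow> l \<in> U - V - {q} \<Longrightarrow> \<exists>\<beta>\<in>simplex_vecs m d. avec m d j + avec m d l = \<beta> + avec m d q"
    and b: "b = (\<Sum>i\<in>U - {q}. avec m d i)"
  shows "\<exists>c :: nat set \<Rightarrow> 'k::field mpoly. kclass {1..(d + m) choose m} (\<lambda>i f. subst_hom m d (xvar i) * f)
      (\<lambda>I. hcomp (semigroup_ring m d) (wdeg m d (to_mdegree b) I)) p c"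
proof -
  let ?N = "{1..(d + m) choose m}"
  let ?a = "avec m d"
  let ?s = "\<lambda>I. \<Sum>i\<in>I. ?a i"
  let ?x = "\<lambda>i f. subst_hom m d (xvar i) * f :: 'k mpoly"
  let ?C = "\<lambda>I. hcomp (semigroup_ring m d) (wdeg m d (to_mdegree b) I) :: 'k mpoly set"
  have x: "?x i f = Poly_Mapping.single (?a i) 1 * f" for i f by (simp add: subst_hom_xvar)
  obtain \<zeta> :: "nat set \<Rightarrow> 'k" where \<zeta>: "(\<forall>J. koszul ?N (\<lambda>_ v. v) \<zeta> J = 0) \<and>
      (\<forall>F. \<zeta> F \<noteq> 0 \<longrightarrow> (\<exists>j\<in>V. \<exists>l\<in>U - V. F = U - {j, l})) \<and> (\<forall>j\<in>V. \<forall>l\<in>U - V. \<zeta> (U - {j, l}) \<noteq> 0)"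
    by (rule exE[OF join_sphere[OF finite_atLeastAtMost U V]])
  then have z1: "koszul ?N (\<lambda>_ v. v) \<zeta> J = 0"
    and z2: "\<zeta> F \<noteq> 0 \<Longrightarrow> \<exists>j\<in>V. \<exists>l\<in>U - V. F = U - {j, l}"
    and z3: "j \<in> V \<Longrightarrow> l \<in> U - V \<Longrightarrow> \<zeta> (U - {j, l}) \<noteq> 0" for F J j l
    by simp_all
  have finU: "finite U" using U by (rule finite_subset) simp
  have sU: "?s U = b + ?a q" unfolding b using sum.remove[OF finU, of q ?a] q by (simp add: add.commute)
  have inj: "i = l" if "?a i = ?a l" "i \<in> ?N" "l \<in> ?N" for i l
    using bij_betw_imp_inj_on[OF bij_betw_avec] that by (rule inj_onD)
  \<comment> \<open>For a face U - {j, l}, what is missing from b is again a vector in A: a^j if l =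
    q, and otherwise the vector supplied by \<open>rel\<close>.\<close>
  have face: "F \<subseteq> ?N \<and> card F = p \<and> finite F \<and> (\<exists>\<beta>\<in>simplex_vecs m d. b = ?s F + \<beta>)" if F: "\<zeta> F \<noteq> 0" for F
  proof -
    from z2[OF F] obtain j l where j: "j \<in> V" and l: "l \<in> U - V" and F: "F = U - {j, l}" by (elim bexE)
    have jl: "j \<in> U" "l \<in> U" "j \<noteq> l" using j l V by blast+
    have finF: "finite F" using finU F by simp
    have UF: "U = insert j (insert l F)" "j \<notin> insert l F" "l \<notin> F" using jl F by blast+
    have "card U = Suc (Suc (card F))" unfolding UF(1) using UF(2,3) finF by simp
    then have "card F = p" using cardU by simp
    moreover have "F \<subseteq> ?N" using U F by blast
    moreover have "\<exists>\<beta>\<in>simplex_vecs m d. b = ?s F + \<beta>"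
    proof (cases "l = q")
      case True
      have "U - {q} = insert j F" "j \<notin> F" using UF True by blast+
      then have "b = ?s F + ?a j" unfolding b using finF by (simp add: add.commute)
      moreover have "?a j \<in> simplex_vecs m d" using jl(1) U by (intro avec_in_simplex) blast
      ultimately show ?thesis by blast
    next
      case False
      then obtain \<beta> where \<beta>: "\<beta> \<in> simplex_vecs m d" "?a j + ?a l = \<beta> + ?a q" using rel[OF j, of l] l by blast
      have "?s U = ?a j + (?a l + ?s F)" using UF finF by simp
      also have "\<dots> = (?a j + ?a l) + ?s F" by (simp only: add.assoc)
      also have "\<dots> = (?s F + \<beta>) + ?a q" unfolding \<beta>(2) by (simp only: add_ac)
      finally have "b = ?s F + \<beta>" unfolding sU by simp
      then show ?thesis using \<beta>(1) by blast
    qed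
    ultimately show ?thesis using finF by blast
  qed
  \<comment> \<open>Truncated subtraction is safe here: on faces the sum over F is at most b, and
    elsewhere \<open>\<zeta> F\<close> is 0.\<close>
  define z :: "nat set \<Rightarrow> 'k mpoly" where "z F = Poly_Mapping.single (b - ?s F) (\<zeta> F)" for F
  have z_chain: "z \<in> kchain ?N ?C p"
    unfolding kchain_iff
  proof (intro conjI allI impI)
    fix F
    show "z F \<in> ?C F"
    proof (cases "\<zeta> F = 0")
      case True then show ?thesis by (simp add: z_def semigroup_ring_def)
    next
      case False
      then obtain \<beta> where \<beta>: "\<beta> \<in> simplex_vecs m d" "b = ?s F + \<beta>" using face by blast
      have "to_mdegree \<beta> = wdeg m d (to_mdegree b) F"
        by (rule ext) (simp add: wdeg_def to_mdegree_def \<beta>(2) lookup_add lookup_sum)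
      moreover have "b - ?s F = \<beta>" using \<beta>(2) by simp
      ultimately show ?thesis using simplex_in_NA[OF \<beta>(1)] by (simp add: z_def semigroup_ring_def)
    qed
  next
    fix F assume "\<not> (F \<subseteq> ?N \<and> card F = p)"
    then have "\<zeta> F = 0" using face by blast
    then show "z F = 0" by (simp add: z_def)
  qed
  have z_cycle: "koszul ?N ?x z J = 0" for J
  proof -
    \<comment> \<open>For all i, multiplication by x_i leads to the same monomial, of exponent
      \<open>b - ?s J\<close>. Only the cycle condition for the scalars \<open>\<zeta>\<close> then
      remains.\<close>
    have *: "?x i (z (insert i J)) = Poly_Mapping.single (b - ?s J) (\<zeta> (insert i J))" if i: "i \<in> ?N - J" for i
    proof (cases "\<zeta> (insert i J) = 0")
      case True then show ?thesis by (simp add: z_def)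
    next
      case False
      then obtain \<beta> where \<beta>: "b = ?s (insert i J) + \<beta>" "finite (insert i J)" using face by blast
      have "?s (insert i J) = ?a i + ?s J" using \<beta>(2) i by simp
      then have bJ: "b = ?s J + (?a i + \<beta>)" using \<beta>(1) by (simp add: add_ac)
      have "b - ?s (insert i J) = \<beta>" unfolding \<beta>(1) by simp
      moreover have "b - ?s J = ?a i + \<beta>" unfolding bJ by simp
      ultimately show ?thesis unfolding x z_def by (simp add: mult_single)
    qed
    have "koszul ?N ?x z J = (\<Sum>i\<in>?N - J. alt (card {j \<in> J. j < i}) (Poly_Mapping.single (b - ?s J) (\<zeta> (insert i J))))"
      unfolding koszul_def by (rule sum.cong[OF refl]) (simp only: *)
    also have "\<dots> = Poly_Mapping.single (b - ?s J) (koszul ?N (\<lambda>_ v. v) \<zeta> J)"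
      unfolding koszul_def additive.sum[OF additive_single] additive_alt[OF additive_single] ..
    finally show ?thesis unfolding z1 single_zero .
  qed
  have "z \<notin> koszul ?N ?x ` kchain ?N ?C (Suc p)"
  proof
    assume "z \<in> koszul ?N ?x ` kchain ?N ?C (Suc p)"
    then obtain y where zy: "z = koszul ?N ?x y" and y: "y \<in> kchain ?N ?C (Suc p)" by blast
    \<comment> \<open>The p + 1 generators in I already have the entry sum d(p + 1) of b, so a
      nonzero coefficient can only be a constant.\<close>
    have yb: "?s I = b" if "y I \<noteq> 0" for I
    proof -
      have I: "I \<subseteq> ?N" "card I = Suc p" using kchain_zero[OF y] that by blast+
      have "y I \<in> ?C I" by (rule kchainD[OF y I])
      moreover obtain c where "c \<in> Poly_Mapping.keys (y I)" using \<open>y I \<noteq> 0\<close> by (metis keys_eq_empty ex_in_conv)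
      ultimately have c: "c \<in> semigroup_NA m d" "to_mdegree c = wdeg m d (to_mdegree b) I"
        by (auto simp: semigroup_ring_def)
      have "to_mdegree b t = to_mdegree c t + to_mdegree (?s I) t" for t
        using fun_cong[OF c(2), of t] by (simp add: wdeg_def to_mdegree_def lookup_sum)
      then have bc: "b = c + ?s I"
        by (intro poly_mapping_eqI) (simp add: to_mdegree_def lookup_add flip: of_nat_add)
      have "vec_sum m (?s J) = card J * d" if "J \<subseteq> ?N" for J
        unfolding vec_sum_sum using vec_sum_avec that by (simp add: subset_iff)
      moreover have "card (U - {q}) = Suc p" using cardU q finU by simp
      moreover have "U - {q} \<subseteq> ?N" using U by blast
      ultimately have "vec_sum m b = Suc p * d" "vec_sum m (?s I) = Suc p * d" using I unfolding b by simp_all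
      moreover have "vec_sum m b = vec_sum m c + vec_sum m (?s I)"
        unfolding bc by (simp add: vec_sum_def lookup_add sum.distrib)
      ultimately have "vec_sum m c = 0" by simp
      then have "c = 0" by (rule vec_sum_0D[OF semigroup_NA_nat_vecs[OF c(1)]])
      then show ?thesis using bc by simp
    qed
    \<comment> \<open>The degree determines the vertex that completes F, because the generators are
      distinct; hence a single term of the boundary survives.\<close>
    have only: "koszul ?N ?x y F = alt (card {j \<in> F. j < i}) (?x i (y (insert i F)))"
      if i: "i \<in> ?N - F" "insert i F = U - {q}" for F i
    proof (rule koszul_single_term[OF finite_atLeastAtMost i(1)])
      fix l assume l: "l \<in> ?N - F" "l \<noteq> i"
      have "finite (insert i F)" unfolding i(2) using finU by simp
      then have finF: "finite F" by simp
      have "b = ?a i + ?s F" unfolding b i(2)[symmetric] using i(1) finF by simp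
      moreover have "?s (insert l F) = ?a l + ?s F" using l finF by simp
      moreover have "?a l \<noteq> ?a i" using inj[of l i] l i(1) by blast
      ultimately have "?s (insert l F) \<noteq> b" by simp
      then have "y (insert l F) = 0" using yb by blast
      then show "?x l (y (insert l F)) = 0" by simp
    qed
    obtain j0 where j0: "j0 \<in> V" using V0 by blast
    have A: "j0 \<in> ?N - (U - {j0, q})" "insert j0 (U - {j0, q}) = U - {q}" using j0 V U q by blast+
    have "z (U - {j0, q}) \<noteq> 0" using z3[OF j0 q] by (metis z_def lookup_single_eq lookup_zero)
    then have ne: "y (U - {q}) \<noteq> 0" using only[OF A] unfolding zy A(2) by auto
    have B: "l0 \<in> ?N - (U - {l0, q})" "insert l0 (U - {l0, q}) = U - {q}" using l0 U by blast+
    \<comment> \<open>This set contains all of \<open>V\<close>, so it is no face of the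
      sphere.\<close>
    have "\<zeta> (U - {l0, q}) = 0"
    proof (rule ccontr)
      assume "\<zeta> (U - {l0, q}) \<noteq> 0"
      from z2[OF this] obtain j l where j: "j \<in> V" and eq: "U - {l0, q} = U - {j, l}" by (elim bexE)
      have "j \<in> U - {l0, q}" using j l0 q V by auto
      then show False unfolding eq by simp
    qed
    then have "z (U - {l0, q}) = 0" by (simp add: z_def)
    then have "?x l0 (y (U - {q})) = 0" using only[OF B] unfolding zy B(2) by simp
    moreover have "Poly_Mapping.single (?a l0) (1::'k) \<noteq> 0" by (metis lookup_single_eq lookup_zero zero_neq_one)
    ultimately have "y (U - {q}) = 0" unfolding x by simp
    with ne show False ..
  qed
  then show ?thesis using z_chain z_cycle unfolding kclass_def by blast
qed

section \<open>Entry 0 along the lexicographic list of generators\<close>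

lemma avec_0_decreasing:
  assumes "1 \<le> i" "i \<le> j" "j \<le> (d + m) choose m"
  shows "Poly_Mapping.lookup (avec m d j) 0 \<le> Poly_Mapping.lookup (avec m d i) 0"
proof (cases "i = j")
  case False
  then have "avec m d j < avec m d i" using assms by (intro avec_decreasing) auto
  then obtain k where "Poly_Mapping.lookup (avec m d j) k < Poly_Mapping.lookup (avec m d i) k"
    "\<forall>l<k. Poly_Mapping.lookup (avec m d j) l = Poly_Mapping.lookup (avec m d i) l"
    unfolding expo_less_iff_lex by blast
  then show ?thesis by (cases "k = 0") auto
qed simp

lemma simplex_single_add:
  assumes "c \<in> simplex_vecs m d" "i \<le> m"
  shows "c + Poly_Mapping.single i 1 \<in> simplex_vecs m (Suc d)"
proof -
  have "(\<Sum>j=0..m. Poly_Mapping.lookup (Poly_Mapping.single i (1::nat)) j) = 1"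
    using assms(2) by (simp add: lookup_single when_def sum.delta)
  then show ?thesis
    using assms keys_add[of c "Poly_Mapping.single i 1"]
    by (auto simp: simplex_vecs_def nat_vecs_def vec_sum_def lookup_add sum.distrib)
qed

lemma simplex_single_remove:
  assumes a: "a \<in> simplex_vecs m (Suc d)" and i: "Poly_Mapping.lookup a i \<noteq> 0"
  shows "a - Poly_Mapping.single i 1 \<in> simplex_vecs m d"
proof -
  let ?c = "a - Poly_Mapping.single i 1"
  have ac: "a = ?c + Poly_Mapping.single i 1" using diff_single_add[OF i] by simp
  have im: "i \<le> m" using a i by (auto simp: simplex_vecs_def nat_vecs_def in_keys_iff subset_iff)
  have "(\<Sum>j=0..m. Poly_Mapping.lookup (Poly_Mapping.single i (1::nat)) j) = 1"
    using im by (simp add: lookup_single when_def sum.delta)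
  moreover have "vec_sum m (?c + Poly_Mapping.single i 1) = Suc d" using a ac by (simp add: simplex_vecs_def)
  ultimately have "vec_sum m ?c = d" by (simp add: vec_sum_def lookup_add sum.distrib)
  moreover have "Poly_Mapping.keys ?c \<subseteq> Poly_Mapping.keys a" by (auto simp: in_keys_iff lookup_minus)
  ultimately show ?thesis using a by (auto simp: simplex_vecs_def nat_vecs_def)
qed

text \<open>Subtracting e_0 is a bijection onto the vectors of entry sum \<open>d\<close>.\<close>

lemma card_simplex_pos_0:
  "card {a \<in> simplex_vecs m (Suc d). Poly_Mapping.lookup a 0 \<noteq> 0} = (d + m) choose m"
proof -
  have "bij_betw (\<lambda>c. c + Poly_Mapping.single 0 1) (simplex_vecs m d) {a \<in> simplex_vecs m (Suc d). Poly_Mapping.lookup a 0 \<noteq> 0}"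
  proof (rule bij_betw_byWitness[where f' = "\<lambda>a. a - Poly_Mapping.single 0 1"])
    show "\<forall>a\<in>{a \<in> simplex_vecs m (Suc d). Poly_Mapping.lookup a 0 \<noteq> 0}. a - Poly_Mapping.single 0 1 + Poly_Mapping.single 0 1 = a"
      using diff_single_add by blast
  qed (auto simp: lookup_add lookup_single intro: simplex_single_add simplex_single_remove simp del: One_nat_def single_one)
  from bij_betw_same_card[OF this] show ?thesis by (simp add: card_simplex_vecs)
qed

text \<open>Entry 0 does not increase along the list, so the vectors with nonzero entry 0 form an
  initial segment, whose length is given by \<open>card_simplex_pos_0\<close>.\<close>

lemma avec_0_pos_iff:
  assumes d: "d \<ge> 1" and j: "j \<in> {1..(d + m) choose m}"
  shows "Poly_Mapping.lookup (avec m d j) 0 \<noteq> 0 \<longleftrightarrow> j \<le> (d + m - 1) choose m"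
proof -
  let ?n = "(d + m) choose m" and ?M = "(d + m - 1) choose m"
  define J where "J = {j \<in> {1..?n}. Poly_Mapping.lookup (avec m d j) 0 \<noteq> 0}"
  obtain d' where d': "d = Suc d'" using d by (cases d) auto
  have "avec m d ` J = {a \<in> avec m d ` {1..?n}. Poly_Mapping.lookup a 0 \<noteq> 0}"
    unfolding J_def by blast
  then have "avec m d ` J = {a \<in> simplex_vecs m d. Poly_Mapping.lookup a 0 \<noteq> 0}"
    unfolding bij_betw_imp_surj_on[OF bij_betw_avec] .
  moreover have "inj_on (avec m d) J"
    by (rule inj_on_subset[OF bij_betw_imp_inj_on[OF bij_betw_avec]]) (auto simp: J_def)
  ultimately have "card J = card {a \<in> simplex_vecs m d. Poly_Mapping.lookup a 0 \<noteq> 0}"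
    using card_image by fastforce
  then have card: "card J = ?M" using card_simplex_pos_0[of m d'] by (simp add: d')
  have fin: "finite J" by (simp add: J_def)
  have "J \<subseteq> {1..?M}"
  proof
    fix i assume i: "i \<in> J"
    have "{1..i} \<subseteq> J"
    proof
      fix l assume l: "l \<in> {1..i}"
      then have "Poly_Mapping.lookup (avec m d i) 0 \<le> Poly_Mapping.lookup (avec m d l) 0"
        using i by (intro avec_0_decreasing) (auto simp: J_def)
      then show "l \<in> J" using i l by (auto simp: J_def)
    qed
    from card_mono[OF fin this] have "i \<le> ?M" using card by simp
    then show "i \<in> {1..?M}" using i by (simp add: J_def)
  qed
  then have "J = {1..?M}" by (intro card_subset_eq) (simp_all add: card)
  moreover have "Poly_Mapping.lookup (avec m d j) 0 \<noteq> 0 \<longleftrightarrow> j \<in> J" using j by (simp add: J_def)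
  ultimately show ?thesis using j by simp
qed

text \<open>The first bound makes V nonempty. The second, from Pascal's rule, keeps all indices up
  to p + 1 within the list.\<close>

lemma choose_bounds:
  fixes d m :: nat
  assumes d: "d \<ge> 2" and m: "m \<ge> 2"
  shows "2 \<le> (d + m - 1) choose m" and "((d + m - 1) choose m) + m \<le> (d + m) choose m"
proof -
  have "(Suc m) choose m \<le> (d + m - 1) choose m" using d by (intro binomial_right_mono) simp
  then show "2 \<le> (d + m - 1) choose m" using m by simp
  have "Suc (m - 1) choose (m - 1) \<le> (d + m - 1) choose (m - 1)" using d by (intro binomial_right_mono) simp
  moreover have "Suc (m - 1) choose (m - 1) = m" using m using binomial_symmetric[of 1 "Suc (m - 1)"] by simp
  ultimately have "m \<le> (d + m - 1) choose (m - 1)" by simp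
  moreover have "(d + m) choose m = ((d + m - 1) choose m) + ((d + m - 1) choose (m - 1))"
    using binomial_Suc_Suc[of "d + m - 1" "m - 1"] d m by simp
  ultimately show "((d + m - 1) choose m) + m \<le> (d + m) choose m" by simp
qed

text \<open>The vector (1,0,...,0,d-1) has nonzero entry 0, so it stands at position N or earlier;
  from there on entry 0 is at most 1.\<close>

lemma avec_last_pos:
  assumes d: "d \<ge> 2" and m: "m \<ge> 2"
  shows "Poly_Mapping.lookup (avec m d ((d + m - 1) choose m)) 0 = 1"
proof -
  let ?n = "(d + m) choose m" and ?M = "(d + m - 1) choose m"
  have M: "1 \<le> ?M" "?M \<le> ?n" using choose_bounds[OF d m] by auto
  define c :: expo where "c = Poly_Mapping.single m (d - 1) + Poly_Mapping.single 0 1"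
  have "Poly_Mapping.single m (d - 1) \<in> simplex_vecs m (d - 1)"
    by (auto simp: simplex_vecs_def nat_vecs_def vec_sum_def lookup_single when_def sum.delta)
  from simplex_single_add[OF this, of 0] have "c \<in> simplex_vecs m d" using d by (simp add: c_def)
  then have "c \<in> avec m d ` {1..?n}" unfolding bij_betw_imp_surj_on[OF bij_betw_avec] .
  then obtain j where j: "j \<in> {1..?n}" "c = avec m d j" by (rule imageE)
  have c0: "Poly_Mapping.lookup c 0 = 1" using m by (simp add: c_def lookup_add lookup_single)
  then have "j \<le> ?M" using avec_0_pos_iff[OF _ j(1)] d j(2) by simp
  then have "Poly_Mapping.lookup (avec m d ?M) 0 \<le> 1"
    using avec_0_decreasing[of j ?M d m] j M c0 by simp
  moreover have "Poly_Mapping.lookup (avec m d ?M) 0 \<noteq> 0" using avec_0_pos_iff[of d ?M m] d M by simp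
  ultimately show ?thesis by simp
qed

definition shift :: "nat \<Rightarrow> expo \<Rightarrow> expo" where
  "shift i a = a - Poly_Mapping.single 0 1 + Poly_Mapping.single i 1"

lemma shift_eq:
  assumes "Poly_Mapping.lookup a 0 \<noteq> 0"
  shows "shift i a + Poly_Mapping.single 0 1 = a + Poly_Mapping.single i 1"
proof -
  have "shift i a + Poly_Mapping.single 0 1 = (a - Poly_Mapping.single 0 1 + Poly_Mapping.single 0 1) + Poly_Mapping.single i 1"
    by (simp only: shift_def add_ac)
  then show ?thesis unfolding diff_single_add[OF assms] .
qed

lemma shift_simplex:
  assumes "a \<in> simplex_vecs m d" "Poly_Mapping.lookup a 0 \<noteq> 0" "i \<le> m" "d \<ge> 1"
  shows "shift i a \<in> simplex_vecs m d"
proof -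
  have "a - Poly_Mapping.single 0 1 \<in> simplex_vecs m (d - 1)"
    using assms by (intro simplex_single_remove) simp_all
  from simplex_single_add[OF this assms(3)] show ?thesis using assms(4) by (simp add: shift_def)
qed

theorem theorem7p1:
  fixes d m p :: nat
  assumes "d \<ge> 2" and "m \<ge> 2"
    and "1 \<le> p" and "p \<le> ((d + m - 1) choose m) + m - 2"
  shows "\<exists>b \<in> nat_vecs m.
           vec_sum m b = d * (p + 1) \<and>
           int (Poly_Mapping.lookup b 0) = (\<Sum>i=1..p+1. int (Poly_Mapping.lookup (avec m d i) 0)) - 1 \<and>
           betti TYPE('k::field) m d p b \<noteq> 0"
proof -
  let ?n = "(d + m) choose m" and ?M = "(d + m - 1) choose m"
  let ?a = "avec m d"
  have M: "2 \<le> ?M" "?M + m \<le> ?n" using choose_bounds[OF assms(1,2)] by auto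
  define q where "q = min (p + 1) ?M"
  \<comment> \<open>The size of W, chosen so that V and W together have p + 1 elements.\<close>
  define r where "r = p + 2 - q"
  have q: "2 \<le> q" "q \<le> ?M" "q \<le> p + 1" using assms(3) M(1) by (auto simp: q_def)
  have r: "1 \<le> r" "r \<le> m" "q + r = p + 2" using q assms M by (auto simp: r_def q_def min_def)
  have qn: "q \<in> {1..?n}" using q M by simp
  have d1: "d \<ge> 1" using assms(1) by simp
  have pos: "Poly_Mapping.lookup (?a j) 0 \<noteq> 0" if "j \<in> {1..?M}" for j
    using avec_0_pos_iff[OF d1, of j m] that M by simp
  have posq: "Poly_Mapping.lookup (?a q) 0 \<noteq> 0" using q by (intro pos) simp
  have sh: "shift i (?a j) \<in> simplex_vecs m d" if "j \<in> {1..?M}" "i \<le> m" for i j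
    using that M by (intro shift_simplex[OF avec_in_simplex pos _ d1]) auto
  define v where "v i = inv_into {1..?n} ?a (shift i (?a q))" for i
  have v: "v i \<in> {1..?n}" "?a (v i) = shift i (?a q)" if "i \<in> {1..r}" for i
  proof -
    have "shift i (?a q) \<in> ?a ` {1..?n}"
      unfolding bij_betw_imp_surj_on[OF bij_betw_avec] using that r q by (intro sh) auto
    then show "v i \<in> {1..?n}" "?a (v i) = shift i (?a q)"
      unfolding v_def by (rule inv_into_into, rule f_inv_into_f)
  qed
  have shift_0: "Poly_Mapping.lookup (shift i (?a q)) 0 + 1 = Poly_Mapping.lookup (?a q) 0" if "i \<in> {1..r}" for i
    using arg_cong[OF shift_eq[OF posq, of i], of "\<lambda>c. Poly_Mapping.lookup c 0"] that
    by (simp add: lookup_add lookup_single)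
  \<comment> \<open>A vector with smaller entry 0 comes after a^q in the list, so W avoids both V
    and a^q.\<close>
  have vq: "q < v i" if i: "i \<in> {1..r}" for i
  proof (rule ccontr)
    assume "\<not> q < v i"
    then have "Poly_Mapping.lookup (?a q) 0 \<le> Poly_Mapping.lookup (?a (v i)) 0"
      using v(1)[OF i] qn by (intro avec_0_decreasing) auto
    then show False using shift_0[OF i] v(2)[OF i] by simp
  qed
  have injv: "inj_on v {1..r}"
  proof (rule inj_onI)
    fix i l assume i: "i \<in> {1..r}" "l \<in> {1..r}" "v i = v l"
    then have "shift i (?a q) = shift l (?a q)" using v(2) by metis
    then have "?a q + Poly_Mapping.single i 1 = ?a q + Poly_Mapping.single l 1"
      using shift_eq[OF posq] by metis
    then have "Poly_Mapping.lookup (Poly_Mapping.single i (1::nat)) i = Poly_Mapping.lookup (Poly_Mapping.single l (1::nat)) i" by simp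
    then show "i = l" by (simp add: lookup_single when_def split: if_splits)
  qed
  let ?W = "v ` {1..r}" and ?V = "{1..<q}"
  let ?U = "insert q (?V \<union> ?W)"
  define b where "b = (\<Sum>i\<in>?U - {q}. ?a i)"
  have W: "?W \<subseteq> {1..?n}" "q \<notin> ?W" "?V \<inter> ?W = {}"
  proof -
    show "?W \<subseteq> {1..?n}" using v(1) by blast
    show "q \<notin> ?W" using vq by blast
    show "?V \<inter> ?W = {}" using vq by fastforce
  qed
  have UV: "?U \<subseteq> {1..?n}" "?V \<subseteq> ?U" "q \<in> ?U - ?V" "?V \<noteq> {}" using W q qn by auto
  have Uq: "?U - {q} = ?V \<union> ?W" "?U - ?V - {q} = ?W" using W by auto
  have cardW: "card ?W = r" using card_image[OF injv] by simp
  have card: "card (?V \<union> ?W) = p + 1" "card ?U = p + 2"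
  proof -
    have "card (?V \<union> ?W) = (q - 1) + r" using card_Un_disjoint[OF _ _ W(3)] cardW by simp
    then show c: "card (?V \<union> ?W) = p + 1" using r q by simp
    have "q \<notin> ?V \<union> ?W" using W(2) by simp
    then show "card ?U = p + 2" using c by simp
  qed
  have VW: "?V \<union> ?W \<subseteq> {1..?n}" using UV(1) by blast
  have rel: "\<exists>\<beta>\<in>simplex_vecs m d. ?a j + ?a l = \<beta> + ?a q" if j: "j \<in> ?V" and l: "l \<in> ?U - ?V - {q}" for j l
  proof -
    obtain i where i: "i \<in> {1..r}" "l = v i" using l unfolding Uq(2) by (rule imageE)
    have jM: "j \<in> {1..?M}" using j q by simp
    \<comment> \<open>The exchange of e_0 for e_i is moved from a^q to a^j, which is possible
      because a^j has a nonzero entry 0. The extra e_0 on both sides avoids subtraction.\<close>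
    have "(?a j + shift i (?a q)) + Poly_Mapping.single 0 1 = ?a j + (shift i (?a q) + Poly_Mapping.single 0 1)"
      by (simp only: add.assoc)
    also have "\<dots> = (?a j + Poly_Mapping.single i 1) + ?a q"
      unfolding shift_eq[OF posq] by (simp only: add_ac)
    also have "\<dots> = (shift i (?a j) + ?a q) + Poly_Mapping.single 0 1"
      unfolding shift_eq[OF pos[OF jM], symmetric] by (simp only: add_ac)
    finally have "?a j + ?a l = shift i (?a j) + ?a q" using i v(2) by simp
    moreover have "shift i (?a j) \<in> simplex_vecs m d" using sh[OF jM] i(1) r(2) by simp
    ultimately show ?thesis by blast
  qed
  have l0: "v 1 \<in> ?U - ?V - {q}" unfolding Uq(2) using r(1) by simp
  obtain c :: "nat set \<Rightarrow> 'k mpoly" where c: "kclass {1..?n} (\<lambda>i f. subst_hom m d (xvar i) * f)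
      (\<lambda>I. hcomp (semigroup_ring m d) (wdeg m d (to_mdegree b) I)) p c"
    by (rule exE[OF kclass_exists[OF UV l0 card(2) rel b_def]])
  have bV: "b \<in> nat_vecs m"
  proof -
    have "Poly_Mapping.keys (?a i) \<subseteq> {0..m}" if "i \<in> ?V \<union> ?W" for i
      using avec_in_simplex[of i d m] that VW unfolding simplex_vecs_def nat_vecs_def by blast
    then show ?thesis
      using keys_sum[of ?a "?V \<union> ?W"] unfolding b_def Uq(1) nat_vecs_def by blast
  qed
  moreover have "vec_sum m b = d * (p + 1)"
  proof -
    have "vec_sum m b = (\<Sum>i\<in>?V \<union> ?W. d)"
      unfolding b_def Uq(1) vec_sum_sum by (rule sum.cong[OF refl vec_sum_avec]) (use VW in blast)
    then show ?thesis using card(1) by simp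
  qed
  moreover have "int (Poly_Mapping.lookup b 0) = (\<Sum>i=1..p+1. int (Poly_Mapping.lookup (?a i) 0)) - 1"
  proof -
    let ?f = "\<lambda>i. int (Poly_Mapping.lookup (?a i) 0)"
    have "int (Poly_Mapping.lookup b 0) = sum ?f (?V \<union> ?W)" unfolding b_def Uq(1) by (simp add: lookup_sum)
    also have "\<dots> = sum ?f ?V + sum ?f ?W" by (rule sum.union_disjoint) (use W in auto)
    also have "sum ?f ?W = (\<Sum>i\<in>{1..r}. ?f (v i))" by (rule sum.reindex[OF injv, unfolded o_def])
    also have "\<dots> = (\<Sum>i\<in>{1..r}. ?f q - 1)"
    proof (rule sum.cong[OF refl])
      fix i assume i: "i \<in> {1..r}"
      show "?f (v i) = ?f q - 1" using shift_0[OF i] unfolding v(2)[OF i] by simp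
    qed
    also have "\<dots> = int r * (?f q - 1)" by simp
    finally have b0: "int (Poly_Mapping.lookup b 0) = sum ?f ?V + int r * (?f q - 1)" .
    have "{1..q} = insert q ?V" using q by auto
    then have Vq: "sum ?f {1..q} = sum ?f ?V + ?f q" by simp
    \<comment> \<open>If q = p + 1, then r = 1 and exactly one unit is lost. Otherwise
      \<open>?f q\<close> is 1, so W contributes 0, the omitted a^q accounts for the lost unit, and
      the terms beyond q vanish.\<close>
    show ?thesis
    proof (cases "p + 1 \<le> ?M")
      case True
      then have "q = p + 1" by (simp add: q_def)
      moreover have "r = 1" using r(3) \<open>q = p + 1\<close> by simp
      ultimately show ?thesis using b0 Vq by simp
    next
      case False
      then have qM: "q = ?M" by (simp add: q_def)
      then have "?f q = 1" using avec_last_pos[OF assms(1,2)] by simp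
      moreover have "sum ?f {1..p+1} = sum ?f {1..q}"
      proof (rule sum.mono_neutral_right)
        show "\<forall>i\<in>{1..p + 1} - {1..q}. ?f i = 0"
        proof
          fix i assume i: "i \<in> {1..p + 1} - {1..q}"
          have "i \<in> {1..?n}" using i assms(4) M assms(2) by auto
          then show "?f i = 0" using avec_0_pos_iff[OF d1, of i m] i qM by auto
        qed
      qed (use q in auto)
      ultimately show ?thesis using b0 Vq by simp
    qed
  qed
  moreover have "betti TYPE('k) m d p b \<noteq> 0"
    using betti_nonzero[OF bV, of d "p - 1"] c assms(3) by simp
  ultimately show ?thesis by blast
qed

end
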